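(* Let $\{x_j\}_{j\ge1}$ be an increasing sequence with $0<x_j\le1$ and let $\mathcal U=\{\mathcal U_{j,k}\}_{j,k\in\mathbb N}$ be the symmetric matrix with $$\mathcal U_{j,k}=\sum_{i=1}^{j}\Big(\prod_{l=i}^{j-1}x_l\prod_{l=i}^{k-1}x_l\Big),\qquad j\le k,$$ and let $b_j=\prod_{l=1}^{j-1}x_l^{-1}$ (empty products equal $1$). Let $\mathcal X$ be the Markov chain on $\mathbb N$ with potential density $\mathcal U$, and let $f$ be a finite excessive function for $\mathcal X$. For $\alpha>0$ let $\widetilde{\mathcal X}_\alpha=\{\widetilde{\mathcal X}_{\alpha,j}\}_{j\in\mathbb N}$ be an $\alpha$-permanental sequence with kernel $\widetilde{\mathcal U}_{j,k}=\mathcal U_{j,k}+f_k$, $j,k\in\mathbb N$. (i) If $\lim_{j\to\infty}\mathcal U_{j,j}=\infty$, or equivalently, $\lim_{j\to\infty}x_j=1$, and $f=\mathcal Uh$, where $h\in\ell_1^+$, then $$\limsup_{j\to\infty}\frac{\widetilde{\mathcal X}_{\alpha,j}}{\mathcal U_{j,j}\log\log(\mathcal U_{j,j}b_j^2)}=1\quad\text{a.s.}$$ In particular, if $\mathcal U_{j,j}$ is a regularly varying function (of $j$) with index $0<\beta<1$, then $$\limsup_{j\to\infty}\frac{\widetilde{\mathcal X}_{\alpha,j}}{\mathcal U_{j,j}\log j}=1-\beta\quad\text{a.s.}$$ (ii) If $\lim_{j\to\infty}\mathcal U_{j,j}=1/(1-\delta^2)$ for some $0<\delta<1$, or equivalently,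 $\lim_{j\to\infty}x_j=\delta<1$, and $f\in c_0^+$, then $$\limsup_{j\to\infty}\frac{\widetilde{\mathcal X}_{\alpha,j}}{\log j}=\frac1{1-\delta^2}\quad\text{a.s.}$$ Furthermore, when $\lim_{j\to\infty}\mathcal U_{j,j}=1/(1-\delta^2)$ for some $0<\delta<1$, the conditions "$f\in c_0^+$" and "$f=\mathcal Uh$ for some $h\in c_0^+$" are equivalent.
   Context: $\mathbb N=\{1,2,\dots\}$; $\ell_1^+$ is the set of non-negative summable sequences; $c_0^+$ is the set of non-negative sequences converging to $0$; $(\mathcal Uh)_j=\sum_k\mathcal U_{j,k}h_k$. $\mathcal U$ is the covariance of the first order autoregressive Gaussian sequence $\widehat\xi_1=g_1$, $\widehat\xi_n=x_{n-1}\widehat\xi_{n-1}+g_n$, $n\ge2$, with $g_n$ i.i.d. standard normal; it is also the potential density of a symmetric transient continuous time Markov chain $\mathcal X$ on $\mathbb N$, i.e. $\mathcal U_{j,k}=\int_0^\infty p_t(j,k)\,dt$ where $p_t$ are the transition functions of $\mathcal X$ (which may be killed). A non-negative function $f$ on $\mathbb N$ is excessive for $\mathcal X$ if $P_tf(j)\uparrow f(j)$ as $t\downarrow0$ for all $j$, where $P_t$ is the transition semigroup of $\mathcal X$. Permanental sequences: for $\alpha>0$ and a matrix $K=\{K_{j,k}\}_{j,k\in\mathbb N}$, an $\alpha$-permanental sequence with kernel $K$ is a sequence $\{Z_j\}_{j\in\mathbb N}$ of non-negative random variables such that for all $n$, all distinct $i_1,\dots,i_n\in\mathbb N$ and all $s_1,\dots,s_n>0$,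 $E\exp(-\sum_{m=1}^n s_mZ_{i_m})=\det(I+K'S)^{-\alpha}$, where $K'=\{K_{i_p,i_q}\}_{p,q=1}^n$ and $S=\mathrm{diag}(s_1,\dots,s_n)$. It is known that an $\alpha$-permanental sequence with kernel $\widetilde{\mathcal U}$ exists for every $\alpha>0$. *)

theory Defs
  imports
    "HOL-Probability.Probability"
    "Jordan_Normal_Form.Determinant"
begin

text \<open>
  The index set is \<open>{1, 2, \<dots>}\<close>. Sequences and infinite matrices are functions on \<open>nat\<close> whose
  values at index \<open>0\<close> are irrelevant: every definition below only looks at indices \<open>\<ge> 1\<close>.
\<close>

section \<open>The autoregressive covariance\<close>

text \<open>
  Writing \<open>min j k\<close> for the upper limit of the sum gives the stated formula for \<open>j \<le> k\<close> together
  with its symmetric extension; see the two lemmas.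
\<close>

definition ar_cov :: "(nat \<Rightarrow> real) \<Rightarrow> nat \<Rightarrow> nat \<Rightarrow> real" where
  "ar_cov x j k = (\<Sum>i=1..min j k. (\<Prod>l=i..<j. x l) * (\<Prod>l=i..<k. x l))"

lemma ar_cov_le:
  "j \<le> k \<Longrightarrow> ar_cov x j k = (\<Sum>i=1..j. (\<Prod>l=i..<j. x l) * (\<Prod>l=i..<k. x l))"
  by (simp add: ar_cov_def min_absorb1)

lemma ar_cov_sym: "ar_cov x j k = ar_cov x k j"
  by (simp add: ar_cov_def min.commute mult.commute)

definition ar_b :: "(nat \<Rightarrow> real) \<Rightarrow> nat \<Rightarrow> real" where
  "ar_b x j = (\<Prod>l=1..<j. inverse (x l))"

section \<open>Sequence spaces and the action of a matrix on a sequence\<close>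

definition l1_plus :: "(nat \<Rightarrow> real) set" where
  "l1_plus = {h. (\<forall>k\<ge>1. 0 \<le> h k) \<and> h summable_on {1..}}"

definition c0_plus :: "(nat \<Rightarrow> real) set" where
  "c0_plus = {h. (\<forall>k\<ge>1. 0 \<le> h k) \<and> h \<longlonglongrightarrow> 0}"

text \<open>\<open>f = K h\<close>, including convergence of the sums \<open>\<Sum>\<^sub>k K j k * h k\<close>.\<close>

definition is_image :: "(nat \<Rightarrow> nat \<Rightarrow> real) \<Rightarrow> (nat \<Rightarrow> real) \<Rightarrow> (nat \<Rightarrow> real) \<Rightarrow> bool" where
  "is_image K h f \<longleftrightarrow> (\<forall>j\<ge>1. ((\<lambda>k. K j k * h k) has_sum f j) {1..})"

section \<open>Symmetric Markov chains, potential densities and excessive functions\<close>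

text \<open>
  A continuous time Markov chain is given by its transition functions
  \<open>p t j k\<close>, \<open>t > 0\<close>. Row sums may be smaller than \<open>1\<close>, the deficit being the probability that the
  chain has been killed.
\<close>

definition markov_transition :: "(real \<Rightarrow> nat \<Rightarrow> nat \<Rightarrow> real) \<Rightarrow> bool" where
  "markov_transition p \<longleftrightarrow>
     (\<forall>t>0. \<forall>j\<ge>1. \<forall>k\<ge>1. 0 \<le> p t j k) \<and>
     (\<forall>t>0. \<forall>j\<ge>1. p t j summable_on {1..} \<and> (\<Sum>\<^sub>\<infinity>k\<in>{1..}. p t j k) \<le> 1) \<and>
     (\<forall>s>0. \<forall>t>0. \<forall>j\<ge>1. \<forall>k\<ge>1. ((\<lambda>l. p s j l * p t l k) has_sum p (s + t) j k) {1..}) \<and>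
     (\<forall>j\<ge>1. \<forall>k\<ge>1. ((\<lambda>t. p t j k) \<longlongrightarrow> (if j = k then 1 else 0)) (at_right 0))"

definition symmetric_transition :: "(real \<Rightarrow> nat \<Rightarrow> nat \<Rightarrow> real) \<Rightarrow> bool" where
  "symmetric_transition p \<longleftrightarrow> (\<forall>t>0. \<forall>j\<ge>1. \<forall>k\<ge>1. p t j k = p t k j)"

text \<open>Transience is contained in the next definition, since the entries of \<open>K\<close> are finite.\<close>

definition potential_density ::
  "(real \<Rightarrow> nat \<Rightarrow> nat \<Rightarrow> real) \<Rightarrow> (nat \<Rightarrow> nat \<Rightarrow> real) \<Rightarrow> bool" where
  "potential_density p K \<longleftrightarrow>
     (\<forall>j\<ge>1. \<forall>k\<ge>1. 0 \<le> K j k \<and> (\<integral>\<^sup>+t\<in>{0<..}. ennreal (p t j k) \<partial>lborel) = ennreal (K j k))"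

definition semigroup_apply ::
  "(real \<Rightarrow> nat \<Rightarrow> nat \<Rightarrow> real) \<Rightarrow> real \<Rightarrow> (nat \<Rightarrow> real) \<Rightarrow> nat \<Rightarrow> ennreal" where
  "semigroup_apply p t f j = (\<Sum>\<^sub>\<infinity>k\<in>{1..}. ennreal (p t j k * f k))"

text \<open>Finite excessive functions: \<open>P\<^sub>t f j\<close> increases to \<open>f j\<close> as \<open>t\<close> decreases to \<open>0\<close>.\<close>

definition excessive :: "(real \<Rightarrow> nat \<Rightarrow> nat \<Rightarrow> real) \<Rightarrow> (nat \<Rightarrow> real) \<Rightarrow> bool" where
  "excessive p f \<longleftrightarrow>
     (\<forall>j\<ge>1. 0 \<le> f j) \<and>
     (\<forall>j\<ge>1. (\<forall>s t. 0 < s \<and> s \<le> t \<longrightarrow> semigroup_apply p t f j \<le> semigroup_apply p s f j) \<and>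
            ((\<lambda>t. semigroup_apply p t f j) \<longlongrightarrow> ennreal (f j)) (at_right 0))"

section \<open>Permanental sequences\<close>

definition permanental_sequence ::
  "'a measure \<Rightarrow> real \<Rightarrow> (nat \<Rightarrow> nat \<Rightarrow> real) \<Rightarrow> (nat \<Rightarrow> 'a \<Rightarrow> real) \<Rightarrow> bool" where
  "permanental_sequence M \<alpha> K Z \<longleftrightarrow>
     prob_space M \<and>
     (\<forall>j\<ge>1. Z j \<in> borel_measurable M \<and> (\<forall>\<omega>\<in>space M. 0 \<le> Z j \<omega>)) \<and>
     (\<forall>n. \<forall>i :: nat \<Rightarrow> nat. \<forall>s :: nat \<Rightarrow> real.
        inj_on i {..<n} \<and> (\<forall>m<n. 1 \<le> i m) \<and> (\<forall>m<n. 0 < s m) \<longrightarrow>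
        prob_space.expectation M (\<lambda>\<omega>. exp (- (\<Sum>m<n. s m * Z (i m) \<omega>))) =
          Determinant.det
            (1\<^sub>m n + Matrix.mat n n (\<lambda>(p, q). K (i p) (i q)) * mat_diag n s) powr (- \<alpha>))"

section \<open>Regularly varying sequences\<close>

definition regularly_varying :: "(nat \<Rightarrow> real) \<Rightarrow> real \<Rightarrow> bool" where
  "regularly_varying c \<beta> \<longleftrightarrow>
     (\<forall>\<^sub>F n in sequentially. 0 < c n) \<and>
     (\<forall>r>0. (\<lambda>n. c (nat \<lfloor>r * real n\<rfloor>) / c n) \<longlonglongrightarrow> r powr \<beta>)"

end

theory Submission
  imports Defs "HOL-Real_Asymp.Real_Asymp"
begin

text \<open>
  Rescaling by \<open>b\<close> turns \<open>ar_cov x\<close> into \<open>min (A j) (A k)\<close> with \<open>A j = \<Sum>i\<le>j. (b i)\<^sup>2\<close>, and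
  nonnegative functions with nonnegative image under the inverse of \<open>ar_cov x\<close> into
  nondecreasing concave functions of \<open>A\<close>. An excessive function \<open>f\<close> is of this kind, since the
  inverse of the potential density is minus the derivative of the semigroup at time \<open>0\<close>. It follows
  that the kernel of \<open>Z\<close>, restricted to finitely many indices, has an inverse \<open>T\<close> that is an
  M-matrix. Expanding the power \<open>- \<alpha>\<close> of the determinant of \<open>T + S\<close> along Schur complements
  exhibits the law as a mixture of products of gamma laws with shapes \<open>\<alpha> + m i\<close> and rates
  \<open>T i i\<close>, with weights that increase with the off-diagonal of \<open>- T\<close>. This yields two estimates:
  the probability that all coordinates are small is at most that of independent gamma variables
  with shape \<open>\<alpha>\<close>, and an Ottaviani inequality for the maximum over a block of indices.

  With these the proof of the law of the iterated logarithm runs as for Brownian motion, along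
  blocks on which \<open>A\<close> grows geometrically, and gives for all excessive \<open>f\<close> with \<open>f j = o(V j)\<close>,
  \<open>V j = ar_cov x j j\<close>, that the upper limit of \<open>Z j / (V j * ln (ln (A j)))\<close> is \<open>1\<close>. The three
  normalizations only differ in the growth of \<open>ln (A j)\<close>, and \<open>f = o(V)\<close> holds in both cases.
\<close>

section \<open>A cone of completely monotone functions\<close>

text \<open>The kernel \<open>\<lambda>j k. ar_cov x j k + f k\<close> is not symmetric unless
  \<open>f\<close> is constant, so no Gaussian structure is at hand and all information is the
  Laplace transform at strictly positive arguments. Mixtures of gamma laws are therefore never built
  as measures: they live in a cone of functions of \<open>s\<close>, closed under pointwise limits,
  and this cone is paired with polynomials in \<open>exp (- z)\<close>, where finitely many Laplace
  values suffice. Step polynomials then give probabilities of boxes.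

  Both estimates point in the direction that \<open>f\<close> cannot spoil. By the Sherman-Morrison
  formula a concave \<open>f\<close> lowers all entries of the inverse kernel: the rates decrease
  and the off-diagonal of \<open>- T\<close> increases, and both make the coordinates larger. So the
  comparison with independent gamma variables and the domination of a squared Bessel transition
  persist with the entries for \<open>f = 0\<close>. In the opposite direction, the upper bound at a
  single index comes from the exact gamma marginal with scale \<open>V n + f n\<close>; this is
  where \<open>f j = o(V j)\<close> enters.\<close>

definition nonneg_pts :: "nat \<Rightarrow> (nat \<Rightarrow> real) set" where
  "nonneg_pts N = {s. \<forall>i<N. 0 \<le> s i}"

text \<open>Times \<open>\<Prod>i<N. (d i + s i) powr - \<alpha>\<close>, the generating monomials are multiples of Laplace
  transforms of products of gamma laws with rates \<open>d i\<close> and shapes \<open>\<alpha> + m i\<close>. The limit rule only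
  looks at nonnegative \<open>s\<close>, so membership does not depend on values elsewhere.\<close>

inductive_set gamma_cone :: "nat \<Rightarrow> (nat \<Rightarrow> real) \<Rightarrow> ((nat \<Rightarrow> real) \<Rightarrow> real) set"
  for N :: nat and d :: "nat \<Rightarrow> real" where
  monom: "(\<lambda>s. \<Prod>i<N. inverse (d i + s i) ^ m i) \<in> gamma_cone N d"
| scale: "0 \<le> c \<Longrightarrow> \<phi> \<in> gamma_cone N d \<Longrightarrow> (\<lambda>s. c * \<phi> s) \<in> gamma_cone N d"
| add: "\<phi> \<in> gamma_cone N d \<Longrightarrow> \<psi> \<in> gamma_cone N d \<Longrightarrow> (\<lambda>s. \<phi> s + \<psi> s) \<in> gamma_cone N d"
| lim: "(\<And>k::nat. \<Phi> k \<in> gamma_cone N d) \<Longrightarrow>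
    (\<And>s. s \<in> nonneg_pts N \<Longrightarrow> (\<lambda>k. \<Phi> k s) \<longlonglongrightarrow> \<phi> s) \<Longrightarrow> \<phi> \<in> gamma_cone N d"

lemma gamma_cone_cong:
  assumes "\<phi> \<in> gamma_cone N d" "\<And>s. s \<in> nonneg_pts N \<Longrightarrow> \<phi> s = \<psi> s"
  shows "\<psi> \<in> gamma_cone N d"
  by (rule gamma_cone.lim[where \<Phi> = "\<lambda>_. \<phi>"]) (use assms in auto)

lemma gamma_cone_const:
  assumes "0 \<le> c" shows "(\<lambda>s. c) \<in> gamma_cone N d"
  using gamma_cone.scale[OF assms gamma_cone.monom[where m = "\<lambda>_. 0" and N = N and d = d]] by simp

lemma gamma_cone_inverse:
  assumes "i < N" shows "(\<lambda>s. inverse (d i + s i)) \<in> gamma_cone N d"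
proof -
  have "(\<Prod>j<N. inverse (d j + s j) ^ (if j = i then 1 else 0)) = inverse (d i + s i)" for s :: "nat \<Rightarrow> real"
    using assms by (subst prod.remove[of _ i]) auto
  then show ?thesis
    using gamma_cone.monom[where m = "\<lambda>j. if j = i then 1 else 0" and N = N and d = d] by simp
qed

lemma gamma_cone_nonneg:
  assumes "\<phi> \<in> gamma_cone N d" "\<And>i. i < N \<Longrightarrow> 0 < d i" "s \<in> nonneg_pts N"
  shows "0 \<le> \<phi> s"
  using assms(1)
proof induction
  case (monom m)
  show ?case
    using assms(2,3) by (intro prod_nonneg zero_le_power) (force simp: nonneg_pts_def intro!: add_nonneg_nonneg less_imp_le)
next
  case (lim \<Phi> \<phi>)
  show ?case
    by (rule LIMSEQ_le_const[OF lim(2)[OF assms(3)]]) (use lim in auto)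
qed auto

text \<open>Products of monomials are monomials because all of them share the rates
  \<open>d\<close>; the nested inductions extend this to sums, multiples and limits.\<close>

lemma gamma_cone_mult:
  assumes "\<phi> \<in> gamma_cone N d" "\<psi> \<in> gamma_cone N d"
  shows "(\<lambda>s. \<phi> s * \<psi> s) \<in> gamma_cone N d"
  using assms(1)
proof induction
  case (monom m)
  show ?case using assms(2)
  proof induction
    case (monom m')
    have "(\<Prod>i<N. inverse (d i + s i) ^ m i) * (\<Prod>i<N. inverse (d i + s i) ^ m' i)
      = (\<Prod>i<N. inverse (d i + s i) ^ (m i + m' i))" for s
      by (simp add: power_add prod.distrib)
    then show ?case by (simp add: gamma_cone.monom[where m = "\<lambda>i. m i + m' i" and N = N and d = d])
  next
    case (scale c \<psi>)
    from gamma_cone.scale[OF scale(1) scale(3)] show ?case by (simp add: mult.left_commute)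
  next
    case (add \<phi> \<psi>)
    from gamma_cone.add[OF add(3,4)] show ?case by (simp add: distrib_left)
  next
    case (lim \<Phi> \<phi>)
    show ?case
      by (rule gamma_cone.lim[where \<Phi> = "\<lambda>k s. (\<Prod>i<N. inverse (d i + s i) ^ m i) * \<Phi> k s"])
        (use lim in \<open>auto intro!: tendsto_mult_left\<close>)
  qed
next
  case (scale c \<phi>)
  from gamma_cone.scale[OF scale(1) scale(3)] show ?case by (simp add: mult.assoc)
next
  case (add \<phi> \<psi>)
  from gamma_cone.add[OF add(3,4)] show ?case by (simp add: distrib_right)
next
  case (lim \<Phi> \<phi>)
  show ?case
    by (rule gamma_cone.lim[where \<Phi> = "\<lambda>k s. \<Phi> k s * \<psi> s"])
      (use lim in \<open>auto intro!: tendsto_mult_right\<close>)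
qed

lemma gamma_cone_sum:
  assumes "\<And>k. k \<in> A \<Longrightarrow> \<Phi> k \<in> gamma_cone N d"
  shows "(\<lambda>s. \<Sum>k\<in>A. \<Phi> k s) \<in> gamma_cone N d"
  using assms
proof (induction A rule: infinite_finite_induct)
  case (insert k A)
  then show ?case using gamma_cone.add[of "\<Phi> k" N d "\<lambda>s. \<Sum>k\<in>A. \<Phi> k s"] by simp
qed (auto intro: gamma_cone_const)

text \<open>Membership of the smaller function is part of the order because multiplication is to be
  monotone: the splitting in \<open>cone_le_mult\<close> has a term with factor
  \<open>\<phi>\<close>.\<close>

definition cone_le :: "nat \<Rightarrow> (nat \<Rightarrow> real) \<Rightarrow> ((nat \<Rightarrow> real) \<Rightarrow> real) \<Rightarrow> ((nat \<Rightarrow> real) \<Rightarrow> real) \<Rightarrow> bool" where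
  "cone_le N d \<phi> \<psi> \<longleftrightarrow> \<phi> \<in> gamma_cone N d \<and> (\<lambda>s. \<psi> s - \<phi> s) \<in> gamma_cone N d"

lemma cone_le_refl: "\<phi> \<in> gamma_cone N d \<Longrightarrow> cone_le N d \<phi> \<phi>"
  by (simp add: cone_le_def gamma_cone_const)

lemma cone_le_upper:
  assumes "cone_le N d \<phi> \<psi>" shows "\<psi> \<in> gamma_cone N d"
  using gamma_cone.add[of \<phi> N d "\<lambda>s. \<psi> s - \<phi> s"] assms by (simp add: cone_le_def)

lemma cone_le_cong:
  assumes "cone_le N d \<phi> \<psi>" "\<And>s. s \<in> nonneg_pts N \<Longrightarrow> \<phi> s = \<phi>' s" "\<And>s. s \<in> nonneg_pts N \<Longrightarrow> \<psi> s = \<psi>' s"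
  shows "cone_le N d \<phi>' \<psi>'"
  using assms by (auto simp: cone_le_def intro: gamma_cone_cong)

lemma cone_le_add:
  assumes "cone_le N d \<phi> \<psi>" "cone_le N d \<phi>' \<psi>'"
  shows "cone_le N d (\<lambda>s. \<phi> s + \<phi>' s) (\<lambda>s. \<psi> s + \<psi>' s)"
  using assms gamma_cone.add[of \<phi> N d \<phi>']
    gamma_cone.add[of "\<lambda>s. \<psi> s - \<phi> s" N d "\<lambda>s. \<psi>' s - \<phi>' s"]
  by (simp add: cone_le_def algebra_simps)

lemma cone_le_mult:
  assumes "cone_le N d \<phi> \<psi>" "cone_le N d \<phi>' \<psi>'"
  shows "cone_le N d (\<lambda>s. \<phi> s * \<phi>' s) (\<lambda>s. \<psi> s * \<psi>' s)"
proof -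
  have "(\<lambda>s. (\<psi> s - \<phi> s) * \<psi>' s + \<phi> s * (\<psi>' s - \<phi>' s)) \<in> gamma_cone N d"
    using assms cone_le_upper[OF assms(2)] unfolding cone_le_def
    by (intro gamma_cone.add gamma_cone_mult) auto
  then show ?thesis
    using assms unfolding cone_le_def by (simp add: algebra_simps gamma_cone_mult)
qed

lemma cone_le_power:
  assumes "cone_le N d \<phi> \<psi>"
  shows "cone_le N d (\<lambda>s. \<phi> s ^ k) (\<lambda>s. \<psi> s ^ k)"
proof (induction k)
  case (Suc k)
  then show ?case using cone_le_mult[OF assms Suc] by simp
qed (simp add: cone_le_refl gamma_cone_const)

lemma cone_le_le:
  assumes "cone_le N d \<phi> \<psi>" "\<And>i. i < N \<Longrightarrow> 0 < d i" "s \<in> nonneg_pts N"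
  shows "0 \<le> \<phi> s \<and> \<phi> s \<le> \<psi> s"
  using assms gamma_cone_nonneg[of \<phi> N d s] gamma_cone_nonneg[of "\<lambda>s. \<psi> s - \<phi> s" N d s]
  by (auto simp: cone_le_def)

text \<open>For positive \<open>\<gamma>\<close> the binomial series with exponent
  \<open>- \<gamma>\<close> has nonnegative coefficients, which is what keeps such powers inside the
  cone.\<close>

lemma one_minus_powr_sums:
  fixes t \<gamma> :: real
  assumes "0 \<le> t" "t < 1"
  shows "(\<lambda>k. pochhammer \<gamma> k / fact k * t ^ k) sums (1 - t) powr - \<gamma>"
proof -
  have "(\<lambda>k. (- \<gamma> gchoose k) * (- t) ^ k) sums (1 + - t) powr - \<gamma>"
    using assms by (intro gen_binomial_real) auto
  moreover have "(- \<gamma> gchoose k) * (- t) ^ k = pochhammer \<gamma> k / fact k * t ^ k" for k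
  proof -
    have "(- 1 :: real) ^ k * (- 1) ^ k = 1" by (simp flip: power_mult_distrib)
    moreover have "(- \<gamma> gchoose k) * (- t) ^ k = ((- 1) ^ k * (- 1) ^ k) * (pochhammer \<gamma> k / fact k * t ^ k)"
      unfolding gbinomial_pochhammer power_minus[of t] by simp
    ultimately show ?thesis by simp
  qed
  ultimately show ?thesis by simp
qed

text \<open>The order passes through each term of the binomial series, and the limit rule of the
  cone absorbs the infinite sum; the series converges at the points of
  \<open>nonneg_pts\<close>.\<close>

lemma cone_le_powr:
  assumes le: "cone_le N d \<phi> \<psi>" and d: "\<And>i. i < N \<Longrightarrow> 0 < d i"
    and lt: "\<And>s. s \<in> nonneg_pts N \<Longrightarrow> \<psi> s < 1" and \<gamma>: "0 < \<gamma>"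
  shows "cone_le N d (\<lambda>s. (1 - \<phi> s) powr - \<gamma>) (\<lambda>s. (1 - \<psi> s) powr - \<gamma>)"
proof -
  define c where "c k = pochhammer \<gamma> k / fact k" for k
  have c: "0 \<le> c k" for k using \<gamma> by (simp add: c_def pochhammer_nonneg)
  have lim: "(\<lambda>n. \<Sum>k<n. c k * \<xi> s ^ k) \<longlonglongrightarrow> (1 - \<xi> s) powr - \<gamma>"
    if "\<xi> \<in> {\<phi>, \<psi>}" "s \<in> nonneg_pts N" for \<xi> s
  proof -
    from cone_le_le[OF le d that(2)] lt[OF that(2)] that(1)
    have "0 \<le> \<xi> s" "\<xi> s < 1" by auto
    from one_minus_powr_sums[OF this, of \<gamma>] show ?thesis by (simp add: sums_def c_def)
  qed
  have le': "cone_le N d (\<lambda>s. c k * \<phi> s ^ k) (\<lambda>s. c k * \<psi> s ^ k)" for k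
    using cone_le_mult[OF cone_le_refl[OF gamma_cone_const[OF c]] cone_le_power[OF le]] by simp
  have 1: "(\<lambda>s. \<Sum>k<n. c k * \<phi> s ^ k) \<in> gamma_cone N d" for n
    using le' by (intro gamma_cone_sum) (simp add: cone_le_def)
  have "(\<lambda>s. \<Sum>k<n. (c k * \<psi> s ^ k - c k * \<phi> s ^ k)) \<in> gamma_cone N d" for n
    using le' by (intro gamma_cone_sum) (simp add: cone_le_def)
  then have 2: "(\<lambda>s. (\<Sum>k<n. c k * \<psi> s ^ k) - (\<Sum>k<n. c k * \<phi> s ^ k)) \<in> gamma_cone N d" for n
    by (simp add: sum_subtractf)
  show ?thesis unfolding cone_le_def
  proof
    show "(\<lambda>s. (1 - \<phi> s) powr - \<gamma>) \<in> gamma_cone N d"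
      by (rule gamma_cone.lim[OF 1]) (rule lim, auto)
    show "(\<lambda>s. (1 - \<psi> s) powr - \<gamma> - (1 - \<phi> s) powr - \<gamma>) \<in> gamma_cone N d"
      by (rule gamma_cone.lim[where \<Phi> = "\<lambda>n s. (\<Sum>k<n. c k * \<psi> s ^ k) - (\<Sum>k<n. c k * \<phi> s ^ k)"])
        (use 2 lim[of \<phi>] lim[of \<psi>] in \<open>auto intro: tendsto_diff\<close>)
  qed
qed

section \<open>Determinants as products of pivots\<close>

fun gdet :: "nat \<Rightarrow> (nat \<Rightarrow> nat \<Rightarrow> real) \<Rightarrow> real" where
  "gdet 0 M = 1"
| "gdet (Suc n) M = M n n * gdet n (\<lambda>i j. M i j - M i n * M n j / M n n)"

lemma gdet_cong:
  assumes "\<And>i j. i < n \<Longrightarrow> j < n \<Longrightarrow> M i j = M' i j"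
  shows "gdet n M = gdet n M'"
  using assms
proof (induction n arbitrary: M M')
  case (Suc n)
  have "gdet n (\<lambda>i j. M i j - M i n * M n j / M n n) = gdet n (\<lambda>i j. M' i j - M' i n * M' n j / M' n n)"
    using Suc.prems by (intro Suc.IH) simp
  then show ?case using Suc.prems by simp
qed simp

abbreviation fmat :: "nat \<Rightarrow> (nat \<Rightarrow> nat \<Rightarrow> real) \<Rightarrow> real mat" where
  "fmat n M \<equiv> Matrix.mat n n (\<lambda>(i, j). M i j)"

text \<open>\<open>X\<close> is block upper triangular with the Schur complement as leading block,
  and \<open>Y\<close> is unit lower triangular.\<close>

lemma det_schur:
  assumes "M n n \<noteq> 0"
  shows "Determinant.det (fmat (Suc n) M)
    = M n n * Determinant.det (fmat n (\<lambda>i j. M i j - M i n * M n j / M n n))"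
proof -
  let ?M' = "\<lambda>i j. M i j - M i n * M n j / M n n"
  define X where "X = four_block_mat (fmat n ?M') (Matrix.mat n 1 (\<lambda>(i, _). M i n)) (0\<^sub>m 1 n) (Matrix.mat 1 1 (\<lambda>_. M n n))"
  define Y where "Y = four_block_mat (1\<^sub>m n) (0\<^sub>m n 1) (Matrix.mat 1 n (\<lambda>(_, j). M n j / M n n)) (1\<^sub>m 1)"
  have XY: "X * Y = fmat (Suc n) M"
    unfolding X_def Y_def using assms
    by (subst mult_four_block_mat[of _ n n _ 1 _ 1 _ _ n _ 1])
       (auto intro!: eq_matI simp: scalar_prod_def four_block_mat_def Let_def less_Suc_eq not_less)
  have "Determinant.det X = Determinant.det (fmat n ?M') * M n n"
    unfolding X_def by (subst det_four_block_mat_lower_left_zero[of _ n _ 1]) (auto simp: det_single)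
  moreover have "Determinant.det Y = 1"
    unfolding Y_def by (subst det_four_block_mat_upper_right_zero[of _ n _ 1]) auto
  moreover have "X \<in> carrier_mat (Suc n) (Suc n)" "Y \<in> carrier_mat (Suc n) (Suc n)"
    by (auto simp: X_def Y_def)
  ultimately show ?thesis by (simp flip: XY add: det_mult)
qed

text \<open>Nonpositive off-diagonal entries together with a positive vector \<open>v\<close> that
  has a positive image characterize nonsingular M-matrices. The same \<open>v\<close> survives
  elimination: row \<open>i\<close> of the Schur complement is row \<open>i\<close> plus a
  nonnegative multiple of row \<open>n\<close>, chosen to cancel the last entry.\<close>

lemma schur_positive:
  fixes M :: "nat \<Rightarrow> nat \<Rightarrow> real"
  assumes off: "\<And>i j. i \<le> n \<Longrightarrow> j \<le> n \<Longrightarrow> i \<noteq> j \<Longrightarrow> M i j \<le> 0"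
    and v: "\<And>i. i \<le> n \<Longrightarrow> 0 < v i"
    and pos: "\<And>i. i \<le> n \<Longrightarrow> 0 < (\<Sum>j<Suc n. M i j * v j)"
  shows "0 < M n n"
    and "i < n \<Longrightarrow> 0 < (\<Sum>j<n. (M i j - M i n * M n j / M n n) * v j)"
    and "i < n \<Longrightarrow> j < n \<Longrightarrow> i \<noteq> j \<Longrightarrow> M i j - M i n * M n j / M n n \<le> 0"
proof -
  have "(\<Sum>j<n. M n j * v j) \<le> 0"
    using off v by (intro sum_nonpos mult_nonpos_nonneg) (auto simp: less_imp_le)
  then have "0 < M n n * v n" using pos[of n] by simp
  then show P: "0 < M n n" using v[of n] by (simp add: zero_less_mult_iff)
  have in0: "M i n / M n n \<le> 0" if "i < n" for i
    using off[of i n] that P by (simp add: divide_le_0_iff)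
  show "0 < (\<Sum>j<n. (M i j - M i n * M n j / M n n) * v j)" if "i < n"
  proof -
    have "(\<Sum>j<n. (M i j - M i n * M n j / M n n) * v j)
      = (\<Sum>j<n. M i j * v j) - M i n / M n n * (\<Sum>j<n. M n j * v j)"
      by (simp add: sum_subtractf algebra_simps sum_distrib_left)
    also have "\<dots> = (\<Sum>j<Suc n. M i j * v j) - M i n / M n n * (\<Sum>j<Suc n. M n j * v j)"
      using P by (simp add: field_simps)
    also have "\<dots> > 0"
      using pos[of i] that mult_nonpos_nonneg[OF in0[OF that] less_imp_le[OF pos[of n]]] by linarith
    finally show ?thesis .
  qed
  show "M i j - M i n * M n j / M n n \<le> 0" if "i < n" "j < n" "i \<noteq> j"
    using off[of i j] mult_nonpos_nonpos[OF in0[OF that(1)], of "M n j"] off[of n j] that by simp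
qed

text \<open>All pivots are positive, so the divisions in \<open>gdet\<close> are legitimate at every
  stage. The recursive form is preferred to \<open>Determinant.det\<close> because its powers factor
  pivot by pivot.\<close>

lemma gdet_m_matrix:
  assumes "\<And>i j. i < n \<Longrightarrow> j < n \<Longrightarrow> i \<noteq> j \<Longrightarrow> M i j \<le> 0"
    and "\<And>i. i < n \<Longrightarrow> 0 < v i"
    and "\<And>i. i < n \<Longrightarrow> 0 < (\<Sum>j<n. M i j * v j)"
  shows "0 < gdet n M \<and> Determinant.det (fmat n M) = gdet n M"
  using assms
proof (induction n arbitrary: M)
  case 0
  then show ?case by (simp add: det_dim_zero)
next
  case (Suc n)
  have s: "0 < M n n" "\<And>i. i < n \<Longrightarrow> 0 < (\<Sum>j<n. (M i j - M i n * M n j / M n n) * v j)"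
    "\<And>i j. i < n \<Longrightarrow> j < n \<Longrightarrow> i \<noteq> j \<Longrightarrow> M i j - M i n * M n j / M n n \<le> 0"
    using schur_positive[of n M v] Suc.prems by auto
  have "0 < gdet n (\<lambda>i j. M i j - M i n * M n j / M n n) \<and>
    Determinant.det (fmat n (\<lambda>i j. M i j - M i n * M n j / M n n)) = gdet n (\<lambda>i j. M i j - M i n * M n j / M n n)"
    using s Suc.prems(2) by (intro Suc.IH) auto
  then show ?case using s(1) det_schur[of M n] by simp
qed

text \<open>Eliminating the last index writes the pivot as \<open>d n + s n\<close> times
  \<open>1 - t\<close>, with \<open>t\<close> in the cone. The first factor is compensated by the
  product of powers of \<open>d i + s i\<close>, the power of the second is a series with
  nonnegative coefficients, and the fill-in of the elimination adds products of cone elements to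
  \<open>q\<close>. This is why the entries of \<open>q\<close> may depend on \<open>s\<close>. The
  M-matrix condition is imposed on the larger family \<open>r\<close>, and
  \<open>t q s \<le> t r s < 1\<close> carries it over to \<open>q\<close>.\<close>

lemma gdet_cone_le:
  fixes q r :: "nat \<Rightarrow> nat \<Rightarrow> (nat \<Rightarrow> real) \<Rightarrow> real" and d v :: "nat \<Rightarrow> real"
  defines "M \<equiv> \<lambda>q s i j. (if i = j then d i + s i else 0) - q i j s"
  assumes d: "\<And>i. i < N \<Longrightarrow> 0 < d i" and \<alpha>: "0 < \<alpha>" and n: "n \<le> N"
    and le: "\<And>i j. i < n \<Longrightarrow> j < n \<Longrightarrow> cone_le N d (q i j) (r i j)"
    and v: "\<And>i. i < n \<Longrightarrow> 0 < v i"
    and pos: "\<And>s i. s \<in> nonneg_pts N \<Longrightarrow> i < n \<Longrightarrow> 0 < (\<Sum>j<n. M r s i j * v j)"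
  shows "cone_le N d (\<lambda>s. gdet n (M q s) powr - \<alpha> * (\<Prod>i<n. (d i + s i) powr \<alpha>))
    (\<lambda>s. gdet n (M r s) powr - \<alpha> * (\<Prod>i<n. (d i + s i) powr \<alpha>))"
  using n le v pos
proof (induction n arbitrary: q r)
  case 0
  then show ?case by (simp add: cone_le_refl gamma_cone_const)
next
  case (Suc n)
  \<comment> \<open>\<open>t\<close> is the share of \<open>d n + s n\<close> that
    \<open>q n n\<close> removes from the last pivot. In \<open>q'\<close>, the family after
    elimination, the inverse pivot appears as \<open>e s * (1 - t q s) powr - 1\<close>, which is
    visibly in the cone.\<close>
  define e where "e s = inverse (d n + s n)" for s :: "nat \<Rightarrow> real"
  define t where "t q s = e s * q n n s" for q :: "nat \<Rightarrow> nat \<Rightarrow> (nat \<Rightarrow> real) \<Rightarrow> real" and s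
  define q' where "q' q i j s = q i j s + q i n s * q n j s * (e s * (1 - t q s) powr - 1)"
    for q :: "nat \<Rightarrow> nat \<Rightarrow> (nat \<Rightarrow> real) \<Rightarrow> real" and i j s
  have econe: "e \<in> gamma_cone N d"
    unfolding e_def using Suc.prems(1) by (intro gamma_cone_inverse) simp
  have ds: "0 < d i + s i" if "s \<in> nonneg_pts N" "i \<le> n" for s i
    using that d[of i] Suc.prems(1) by (auto simp: nonneg_pts_def intro!: add_pos_nonneg)
  have le: "cone_le N d (q i j) (r i j)" if "i \<le> n" "j \<le> n" for i j
    using Suc.prems(2) that by simp
  have tle: "cone_le N d (t q) (t r)"
    unfolding t_def by (intro cone_le_mult cone_le_refl econe le) auto
  have piv: "0 < M r s n n \<and> (\<forall>i<n. 0 < (\<Sum>j<n. (M r s i j - M r s i n * M r s n j / M r s n n) * v j))"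
    if s: "s \<in> nonneg_pts N" for s
  proof -
    have "M r s i j \<le> 0" if "i \<le> n" "j \<le> n" "i \<noteq> j" for i j
      using cone_le_le[OF le[OF that(1,2)] d s] that by (simp add: M_def)
    then show ?thesis
      using schur_positive(1,2)[of n "M r s" v] Suc.prems(3) Suc.prems(4)[OF s] by auto
  qed
  have tlt: "t r s < 1" if s: "s \<in> nonneg_pts N" for s
    using conjunct1[OF piv[OF s]] ds[OF s, of n] by (simp add: M_def t_def e_def field_simps)
  have tlt': "t q s < 1" if s: "s \<in> nonneg_pts N" for s
    using tlt[OF s] cone_le_le[OF tle d s] by simp
  have tpow: "cone_le N d (\<lambda>s. (1 - t q s) powr - \<gamma>) (\<lambda>s. (1 - t r s) powr - \<gamma>)" if "0 < \<gamma>" for \<gamma>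
    by (rule cone_le_powr[OF tle d tlt that])
  have le': "cone_le N d (q' q i j) (q' r i j)" if "i < n" "j < n" for i j
    unfolding q'_def using that
    by (intro cone_le_add cone_le_mult cone_le_refl econe le tpow) auto
  have schur: "M p s i j - M p s i n * M p s n j / M p s n n = M (q' p) s i j"
    if "i < n" "j < n" "s \<in> nonneg_pts N" "t p s < 1" for p s i j
  proof -
    have "M p s n n = (d n + s n) * (1 - t p s)"
      using ds[OF that(3), of n] by (simp add: M_def t_def e_def field_simps)
    then have "inverse (M p s n n) = e s * (1 - t p s) powr - 1"
      using that(4) by (simp add: e_def powr_minus)
    then show ?thesis using that by (simp add: M_def q'_def divide_inverse)
  qed
  have rec: "((1 - t p s) powr - \<alpha>) * (gdet n (M (q' p) s) powr - \<alpha> * (\<Prod>i<n. (d i + s i) powr \<alpha>))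
      = gdet (Suc n) (M p s) powr - \<alpha> * (\<Prod>i<Suc n. (d i + s i) powr \<alpha>)"
    if s: "s \<in> nonneg_pts N" and t: "t p s < 1" for p s
  proof -
    have m: "M p s n n = (d n + s n) * (1 - t p s)"
      using ds[OF s, of n] by (simp add: M_def t_def e_def field_simps)
    have "gdet (Suc n) (M p s) = (d n + s n) * (1 - t p s) * gdet n (M (q' p) s)"
      unfolding gdet.simps m[symmetric] using schur[OF _ _ s t] by (auto intro!: gdet_cong)
    then have "gdet (Suc n) (M p s) powr - \<alpha>
        = (d n + s n) powr - \<alpha> * (1 - t p s) powr - \<alpha> * gdet n (M (q' p) s) powr - \<alpha>"
      using t ds[OF s, of n] by (simp only: powr_mult)
    moreover have "(d n + s n) powr - \<alpha> * (d n + s n) powr \<alpha> = 1"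
      using ds[OF s, of n] by (simp flip: powr_add)
    ultimately show ?thesis
      by (simp only: prod.lessThan_Suc) (simp add: mult_ac)
  qed
  have "cone_le N d (\<lambda>s. gdet n (M (q' q) s) powr - \<alpha> * (\<Prod>i<n. (d i + s i) powr \<alpha>))
    (\<lambda>s. gdet n (M (q' r) s) powr - \<alpha> * (\<Prod>i<n. (d i + s i) powr \<alpha>))"
  proof (rule Suc.IH)
    fix s i assume "s \<in> nonneg_pts N" "i < n"
    then have "0 < (\<Sum>j<n. (M r s i j - M r s i n * M r s n j / M r s n n) * v j)"
      using piv[of s] by blast
    also have "\<dots> = (\<Sum>j<n. M (q' r) s i j * v j)"
      using \<open>s \<in> _\<close> \<open>i < n\<close> schur tlt by simp
    finally show "0 < (\<Sum>j<n. M (q' r) s i j * v j)" .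
  qed (use Suc.prems(1,3) le' in simp_all)
  from cone_le_mult[OF tpow[OF \<alpha>] this]
  show ?case
    by (rule cone_le_cong) (simp_all only: rec tlt tlt')
qed

section \<open>Gamma laws and step polynomials\<close>

text \<open>The gamma law with shape \<open>\<alpha>\<close> and rate \<open>d\<close>, so with mean
  \<open>\<alpha> / d\<close>.\<close>

definition gdens :: "real \<Rightarrow> real \<Rightarrow> real \<Rightarrow> real" where
  "gdens \<alpha> d z = (if 0 < z then d powr \<alpha> * z powr (\<alpha> - 1) * exp (- d * z) / Gamma \<alpha> else 0)"

definition gexp :: "real \<Rightarrow> real \<Rightarrow> (real \<Rightarrow> real) \<Rightarrow> real" where
  "gexp \<alpha> d g = (LINT z|lborel. gdens \<alpha> d z * g z)"

lemma gdens_nonneg: "0 < \<alpha> \<Longrightarrow> 0 \<le> gdens \<alpha> d z"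
  by (simp add: gdens_def Gamma_real_nonneg)

lemma gdens_measurable [measurable]: "gdens \<alpha> d \<in> borel_measurable borel"
  unfolding gdens_def by measurable

lemma nn_integral_gdens:
  assumes "0 < \<alpha>" "0 < d"
  shows "(\<integral>\<^sup>+z. ennreal (gdens \<alpha> d z) \<partial>lborel) = 1"
proof -
  define f where "f t = indicator {0..} t * t powr (\<alpha> - 1) / exp t" for t :: real
  have [measurable]: "f \<in> borel_measurable borel" unfolding f_def by measurable
  have G: "0 < Gamma \<alpha>" using assms by (simp add: Gamma_real_pos)
  then have G1: "Gamma \<alpha> * inverse (Gamma \<alpha>) = 1" by (metis less_irrefl right_inverse)
  have "ennreal (Gamma \<alpha>) = (\<integral>\<^sup>+t. ennreal (f t) \<partial>lborel)"
    unfolding f_def using assms by (simp add: Gamma_conv_nn_integral_real)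
  also have "\<dots> = ennreal \<bar>d\<bar> * (\<integral>\<^sup>+z. ennreal (f (0 + d * z)) \<partial>lborel)"
    using assms by (intro nn_integral_real_affine) auto
  also have "\<dots> = (\<integral>\<^sup>+z. ennreal (d * f (d * z)) \<partial>lborel)"
    using assms by (simp add: ennreal_mult' nn_integral_cmult)
  also have "\<dots> = (\<integral>\<^sup>+z. ennreal (Gamma \<alpha>) * ennreal (gdens \<alpha> d z) \<partial>lborel)"
  proof (intro nn_integral_cong_AE, use AE_lborel_singleton[of 0] in eventually_elim)
    case (elim z)
    have "d * f (d * z) = Gamma \<alpha> * gdens \<alpha> d z"
    proof (cases "0 < z")
      case True
      have "d * (d * z) powr (\<alpha> - 1) = d powr \<alpha> * z powr (\<alpha> - 1)"
        using assms True by (simp add: powr_mult powr_diff)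
      then show ?thesis using True assms G1 by (simp add: f_def gdens_def exp_minus divide_inverse mult_ac)
    next
      case False
      then have "d * z < 0" using elim assms by (simp add: mult_pos_neg)
      then show ?thesis using False by (simp add: f_def gdens_def)
    qed
    then show ?case using G by (simp add: ennreal_mult'[symmetric])
  qed
  also have "\<dots> = ennreal (Gamma \<alpha>) * (\<integral>\<^sup>+z. ennreal (gdens \<alpha> d z) \<partial>lborel)"
    by (rule nn_integral_cmult) simp
  finally have "ennreal (Gamma \<alpha>) * (\<integral>\<^sup>+z. ennreal (gdens \<alpha> d z) \<partial>lborel) = ennreal (Gamma \<alpha>) * 1"
    by simp
  then show ?thesis
    using G by (subst (asm) ennreal_mult_cancel_left) auto
qed

lemma integrable_gdens:
  assumes "0 < \<alpha>" "0 < d"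
  shows "integrable lborel (gdens \<alpha> d)" "(LINT z|lborel. gdens \<alpha> d z) = 1"
proof -
  have "has_bochner_integral lborel (gdens \<alpha> d) 1"
    using nn_integral_gdens[OF assms] assms
    by (intro has_bochner_integral_nn_integral) (auto simp: gdens_nonneg)
  then show "integrable lborel (gdens \<alpha> d)" "(LINT z|lborel. gdens \<alpha> d z) = 1"
    by (auto simp: has_bochner_integral_iff)
qed

lemma integrable_gdens_mult:
  assumes "0 < \<alpha>" "0 < d" "g \<in> borel_measurable borel" "\<And>z. 0 < z \<Longrightarrow> \<bar>g z\<bar> \<le> B"
  shows "integrable lborel (\<lambda>z. gdens \<alpha> d z * g z)"
proof (rule Bochner_Integration.integrable_bound)
  show "integrable lborel (\<lambda>z. B * gdens \<alpha> d z)" using assms integrable_gdens by simp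
  show "AE z in lborel. norm (gdens \<alpha> d z * g z) \<le> norm (B * gdens \<alpha> d z)"
  proof (rule AE_I2)
    fix z :: real
    show "norm (gdens \<alpha> d z * g z) \<le> norm (B * gdens \<alpha> d z)"
    proof (cases "0 < z")
      case True
      then have "\<bar>g z\<bar> * \<bar>gdens \<alpha> d z\<bar> \<le> \<bar>B\<bar> * \<bar>gdens \<alpha> d z\<bar>"
        using assms(4)[OF True] by (intro mult_right_mono) auto
      then show ?thesis by (simp add: abs_mult mult.commute)
    qed (simp add: gdens_def)
  qed
qed (use assms in measurable)

text \<open>Exponential tilting: the factor \<open>exp (- k * z)\<close> raises the rate to
  \<open>d + k\<close> and keeps the shape.\<close>

lemma gexp_exp:
  assumes "0 < \<alpha>" "0 < d" "0 \<le> k"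
  shows "gexp \<alpha> d (\<lambda>z. exp (- k * z)) = (d / (d + k)) powr \<alpha>"
proof -
  have "gdens \<alpha> d z * exp (- k * z) = (d / (d + k)) powr \<alpha> * gdens \<alpha> (d + k) z" for z
    using assms by (auto simp: gdens_def powr_divide exp_add[symmetric] algebra_simps)
  then show ?thesis
    using integrable_gdens(2)[of \<alpha> "d + k"] assms by (simp add: gexp_def)
qed

text \<open>Raising the shape by one multiplies the density by the increasing factor \<open>d * z / \<alpha>\<close> with
  mean \<open>1\<close>, so this is Chebyshev's association inequality.\<close>

lemma gexp_mono_shape:
  assumes "0 < \<alpha>" "0 < d" and g[measurable]: "g \<in> borel_measurable borel"
    and B: "\<And>z. 0 < z \<Longrightarrow> \<bar>g z\<bar> \<le> B" and anti: "\<And>y z. 0 < y \<Longrightarrow> y \<le> z \<Longrightarrow> g z \<le> g y"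
  shows "gexp (\<alpha> + 1) d g \<le> gexp \<alpha> d g"
proof -
  \<comment> \<open>The density ratio \<open>d * z / \<alpha>\<close> crosses \<open>1\<close> at
    \<open>\<alpha> / d\<close>, exactly where the decreasing \<open>g\<close> crosses
    \<open>c\<close>. Hence ratio minus \<open>1\<close> and \<open>g z - c\<close> have opposite
    signs at every \<open>z\<close>.\<close>
  define c where "c = g (\<alpha> / d)"
  have "\<alpha> \<notin> \<int>\<^sub>\<le>\<^sub>0" using assms(1) nonpos_Ints_nonpos[of \<alpha>] by auto
  then have "Gamma (\<alpha> + 1) = \<alpha> * Gamma \<alpha>" by (rule Gamma_plus1)
  moreover have "z powr \<alpha> = z * z powr (\<alpha> - 1)" "d powr (\<alpha> + 1) = d * d powr \<alpha>" if "0 < z" for z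
    using that assms(2) by (simp_all add: powr_diff powr_add)
  ultimately have rel: "gdens (\<alpha> + 1) d z = gdens \<alpha> d z * (d * z / \<alpha>)" for z
    by (simp add: gdens_def mult_ac)
  have int: "integrable lborel (\<lambda>z. gdens \<beta> d z * (g z - c))" if "0 < \<beta>" for \<beta>
    using that assms by (intro integrable_gdens_mult[where B = "B + \<bar>c\<bar>"]) (auto intro!: abs_triangle_ineq4[THEN order_trans])
  have eq: "(LINT z|lborel. gdens \<beta> d z * (g z - c)) = gexp \<beta> d g - c" if "0 < \<beta>" for \<beta>
    unfolding right_diff_distrib gexp_def
    using integrable_gdens_mult[OF that assms(2) g B] integrable_gdens[OF that assms(2)]
    by (subst Bochner_Integration.integral_diff) auto
  have "(LINT z|lborel. gdens (\<alpha> + 1) d z * (g z - c)) \<le> (LINT z|lborel. gdens \<alpha> d z * (g z - c))"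
  proof (intro integral_mono int)
    fix z :: real
    show "gdens (\<alpha> + 1) d z * (g z - c) \<le> gdens \<alpha> d z * (g z - c)"
    proof (cases "0 < z")
      case True
      have "(d * z / \<alpha>) * (g z - c) \<le> g z - c"
      proof (cases "z \<le> \<alpha> / d")
        case True
        then have "0 \<le> g z - c" "d * z / \<alpha> \<le> 1"
          using anti[OF \<open>0 < z\<close> True] assms by (auto simp: c_def field_simps)
        then show ?thesis using mult_right_mono[of "d * z / \<alpha>" 1 "g z - c"] by simp
      next
        case False
        then have "g z - c \<le> 0" "1 \<le> d * z / \<alpha>"
          using anti[of "\<alpha> / d" z] assms by (auto simp: c_def field_simps)
        then show ?thesis using mult_right_mono_neg[of 1 "d * z / \<alpha>" "g z - c"] by simp
      qed
      from mult_left_mono[OF this gdens_nonneg[OF assms(1)], of d z] show ?thesis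
        unfolding rel by (simp only: mult.assoc)
    qed (simp add: gdens_def)
  qed (use assms in auto)
  then show ?thesis using assms by (simp add: eq)
qed

lemma gexp_mono_shape_nat:
  assumes "0 < \<alpha>" "0 < d" "g \<in> borel_measurable borel"
    "\<And>z. 0 < z \<Longrightarrow> \<bar>g z\<bar> \<le> B" "\<And>y z. 0 < y \<Longrightarrow> y \<le> z \<Longrightarrow> g z \<le> g y"
  shows "gexp (\<alpha> + real m) d g \<le> gexp \<alpha> d g"
proof (induction m)
  case (Suc m)
  have "gexp (\<alpha> + real m + 1) d g \<le> gexp (\<alpha> + real m) d g"
    using assms by (intro gexp_mono_shape) auto
  then show ?case using Suc by (simp add: add_ac)
qed simp

lemma gexp_nonneg:
  assumes "0 < \<alpha>" "\<And>z. 0 < z \<Longrightarrow> 0 \<le> g z"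
  shows "0 \<le> gexp \<alpha> d g"
  unfolding gexp_def
proof (rule integral_nonneg_AE, rule AE_I2)
  fix z show "0 \<le> gdens \<alpha> d z * g z"
    using assms gdens_nonneg[of \<alpha> d z] by (cases "0 < z") (auto simp: gdens_def)
qed

section \<open>Pairing the cone with polynomials in \<open>exp (- z)\<close>\<close>

lemma poly_eq_sum:
  fixes P :: "real poly"
  assumes "coeff P 0 = 0" "degree P \<le> R"
  shows "poly P u = (\<Sum>k = 1..R. coeff P k * u ^ k)"
proof -
  have "poly P u = (\<Sum>k\<le>R. coeff P k * u ^ k)"
    unfolding poly_altdef using assms(2)
    by (intro sum.mono_neutral_left) (auto simp: coeff_eq_0)
  also have "\<dots> = (\<Sum>k = 1..R. coeff P k * u ^ k)"
    using assms(1) by (intro sum.mono_neutral_right) (auto simp: Suc_le_eq)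
  finally show ?thesis .
qed

lemma gexp_poly:
  fixes P :: "real poly"
  assumes "0 < \<alpha>" "0 < d" "coeff P 0 = 0" "degree P \<le> R"
  shows "gexp \<alpha> d (\<lambda>z. poly P (exp (- z))) = (\<Sum>k = 1..R. coeff P k * (d / (d + real k)) powr \<alpha>)"
proof -
  have "gexp \<alpha> d (\<lambda>z. poly P (exp (- z)))
      = (LINT z|lborel. (\<Sum>k = 1..R. coeff P k * (gdens \<alpha> d z * exp (- real k * z))))"
    unfolding gexp_def poly_eq_sum[OF assms(3,4)] exp_of_nat_mult[symmetric]
    by (simp add: sum_distrib_left mult_ac)
  also have "\<dots> = (\<Sum>k = 1..R. coeff P k * gexp \<alpha> d (\<lambda>z. exp (- real k * z)))"
    unfolding gexp_def using assms
    by (subst Bochner_Integration.integral_sum)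
       (auto intro!: integrable_gdens_mult[where B = 1])
  also have "\<dots> = (\<Sum>k = 1..R. coeff P k * (d / (d + real k)) powr \<alpha>)"
    using assms by (intro sum.cong refl) (simp only: gexp_exp of_nat_0_le_iff)
  finally show ?thesis .
qed

text \<open>The expectation of the product of the \<open>poly (P i) (exp (- Z i))\<close> when
  \<open>Z\<close> has the Laplace transform \<open>\<phi>\<close> times that of independent gamma
  variables with shape \<open>\<alpha>\<close> and rates \<open>d i\<close>. It evaluates
  \<open>\<phi>\<close> at finitely many points, so it is linear in \<open>\<phi>\<close> and
  respects pointwise limits. The range starts at \<open>1\<close>, hence the polynomials without
  constant term, because Laplace transforms are given at strictly positive arguments.\<close>

definition cone_pairing ::
  "nat \<Rightarrow> (nat \<Rightarrow> real) \<Rightarrow> real \<Rightarrow> nat \<Rightarrow> (nat \<Rightarrow> real poly) \<Rightarrow> ((nat \<Rightarrow> real) \<Rightarrow> real) \<Rightarrow> real" where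
  "cone_pairing N d \<alpha> R P \<phi> = (\<Sum>k\<in>PiE {..<N} (\<lambda>_. {1..R}).
     (\<Prod>i<N. coeff (P i) (k i)) * ((\<Prod>i<N. (d i / (d i + real (k i))) powr \<alpha>) * \<phi> (\<lambda>i. real (k i))))"

context
  fixes N R :: nat and d :: "nat \<Rightarrow> real" and \<alpha> :: real and P :: "nat \<Rightarrow> real poly"
  assumes d: "\<And>i. i < N \<Longrightarrow> 0 < d i" and \<alpha>: "0 < \<alpha>"
    and P0: "\<And>i. i < N \<Longrightarrow> coeff (P i) 0 = 0" and R: "\<And>i. i < N \<Longrightarrow> degree (P i) \<le> R"
begin

text \<open>A monomial raises the shape of coordinate \<open>i\<close> to
  \<open>\<alpha> + m i\<close>. The transform for that shape carries an additional
  \<open>d i ^ m i\<close>, which the prefactor removes.\<close>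

lemma cone_pairing_monom:
  "cone_pairing N d \<alpha> R P (\<lambda>s. \<Prod>i<N. inverse (d i + s i) ^ m i)
    = (\<Prod>i<N. inverse (d i) ^ m i * gexp (\<alpha> + real (m i)) (d i) (\<lambda>z. poly (P i) (exp (- z))))"
proof -
  have "(\<Prod>i<N. inverse (d i) ^ m i * gexp (\<alpha> + real (m i)) (d i) (\<lambda>z. poly (P i) (exp (- z))))
    = (\<Prod>i<N. \<Sum>k = 1..R. coeff (P i) k * ((d i / (d i + real k)) powr \<alpha> * inverse (d i + real k) ^ m i))"
  proof (rule prod.cong[OF refl])
    fix i assume "i \<in> {..<N}"
    then have i: "i < N" by simp
    have *: "inverse (d i) ^ m i * (d i / (d i + real k)) powr (\<alpha> + real (m i))
      = (d i / (d i + real k)) powr \<alpha> * inverse (d i + real k) ^ m i" for k :: nat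
    proof -
      have "inverse (d i) * (d i / (d i + real k)) = inverse (d i + real k)"
        using d[OF i] by (simp add: field_simps)
      then have "inverse (d i) ^ m i * (d i / (d i + real k)) ^ m i = inverse (d i + real k) ^ m i"
        by (metis power_mult_distrib)
      then show ?thesis
        using d[OF i] by (simp add: powr_add powr_realpow add_pos_nonneg)
    qed
    show "inverse (d i) ^ m i * gexp (\<alpha> + real (m i)) (d i) (\<lambda>z. poly (P i) (exp (- z)))
      = (\<Sum>k = 1..R. coeff (P i) k * ((d i / (d i + real k)) powr \<alpha> * inverse (d i + real k) ^ m i))"
      using \<alpha> by (subst gexp_poly[OF _ d[OF i] P0[OF i] R[OF i]])
        (auto simp: sum_distrib_left simp flip: * intro!: sum.cong)
  qed
  also have "\<dots> = cone_pairing N d \<alpha> R P (\<lambda>s. \<Prod>i<N. inverse (d i + s i) ^ m i)"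
    unfolding cone_pairing_def by (subst prod_sum_PiE) (auto simp: prod.distrib)
  finally show ?thesis by simp
qed

text \<open>For monomials this is a product of gamma expectations, and the other rules of the cone
  preserve the sign. It stands in for positivity of the mixing measure.\<close>

lemma cone_pairing_nonneg:
  assumes "\<phi> \<in> gamma_cone N d" and nonneg: "\<And>i u. i < N \<Longrightarrow> 0 \<le> u \<Longrightarrow> u \<le> 1 \<Longrightarrow> 0 \<le> poly (P i) u"
  shows "0 \<le> cone_pairing N d \<alpha> R P \<phi>"
  using assms(1)
proof induction
  case (monom m)
  show ?case unfolding cone_pairing_monom
  proof (rule prod_nonneg)
    fix i assume "i \<in> {..<N}"
    then show "0 \<le> inverse (d i) ^ m i * gexp (\<alpha> + real (m i)) (d i) (\<lambda>z. poly (P i) (exp (- z)))"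
      using d[of i] \<alpha> nonneg[of i] by (intro mult_nonneg_nonneg gexp_nonneg) (auto simp: less_imp_le)
  qed
next
  case (scale c \<phi>)
  have "cone_pairing N d \<alpha> R P (\<lambda>s. c * \<phi> s) = c * cone_pairing N d \<alpha> R P \<phi>"
    by (simp add: cone_pairing_def sum_distrib_left mult_ac)
  then show ?case using scale by simp
next
  case (add \<phi> \<psi>)
  have "cone_pairing N d \<alpha> R P (\<lambda>s. \<phi> s + \<psi> s) = cone_pairing N d \<alpha> R P \<phi> + cone_pairing N d \<alpha> R P \<psi>"
    by (simp add: cone_pairing_def sum.distrib distrib_left)
  then show ?case using add by simp
next
  case (lim \<Phi> \<phi>)
  have "(\<lambda>k. cone_pairing N d \<alpha> R P (\<Phi> k)) \<longlonglongrightarrow> cone_pairing N d \<alpha> R P \<phi>"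
    unfolding cone_pairing_def by (intro tendsto_intros lim(2)) (auto simp: nonneg_pts_def)
  then show ?case by (rule LIMSEQ_le_const) (use lim(3) in auto)
qed

text \<open>Lowering all shapes from \<open>\<alpha> + m i\<close> to \<open>\<alpha>\<close>
  increases the expectation of a decreasing function, and a polynomial increasing in
  \<open>u\<close> is decreasing in \<open>z\<close> for \<open>u = exp (- z)\<close>. The value of
  \<open>\<phi>\<close> at zero is the total weight of the mixture.\<close>

lemma cone_pairing_le:
  assumes "\<phi> \<in> gamma_cone N d" and nonneg: "\<And>i u. i < N \<Longrightarrow> 0 \<le> u \<Longrightarrow> u \<le> 1 \<Longrightarrow> 0 \<le> poly (P i) u"
    and mono: "\<And>i u w. i < N \<Longrightarrow> 0 \<le> u \<Longrightarrow> u \<le> w \<Longrightarrow> w \<le> 1 \<Longrightarrow> poly (P i) u \<le> poly (P i) w"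
  shows "cone_pairing N d \<alpha> R P \<phi> \<le> \<phi> (\<lambda>_. 0) * (\<Prod>i<N. gexp \<alpha> (d i) (\<lambda>z. poly (P i) (exp (- z))))"
  using assms(1)
proof induction
  case (monom m)
  have "(\<Prod>i<N. inverse (d i) ^ m i * gexp (\<alpha> + real (m i)) (d i) (\<lambda>z. poly (P i) (exp (- z))))
    \<le> (\<Prod>i<N. inverse (d i) ^ m i * gexp \<alpha> (d i) (\<lambda>z. poly (P i) (exp (- z))))"
  proof (rule prod_mono, intro conjI)
    fix i assume "i \<in> {..<N}"
    then have i: "i < N" by simp
    show "0 \<le> inverse (d i) ^ m i * gexp (\<alpha> + real (m i)) (d i) (\<lambda>z. poly (P i) (exp (- z)))"
      using d[of i] \<alpha> nonneg[of i] i by (intro mult_nonneg_nonneg gexp_nonneg) (auto simp: less_imp_le)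
    have "gexp (\<alpha> + real (m i)) (d i) (\<lambda>z. poly (P i) (exp (- z))) \<le> gexp \<alpha> (d i) (\<lambda>z. poly (P i) (exp (- z)))"
    proof (rule gexp_mono_shape_nat[OF \<alpha> d[OF i], where B = "poly (P i) 1"])
      show "(\<lambda>z. poly (P i) (exp (- z))) \<in> borel_measurable borel"
        by (intro borel_measurable_continuous_onI continuous_intros)
    qed (use nonneg[OF i] mono[OF i] in auto)
    then show "inverse (d i) ^ m i * gexp (\<alpha> + real (m i)) (d i) (\<lambda>z. poly (P i) (exp (- z)))
      \<le> inverse (d i) ^ m i * gexp \<alpha> (d i) (\<lambda>z. poly (P i) (exp (- z)))"
      using d[OF i] by (intro mult_left_mono) (auto simp: less_imp_le)
  qed
  then show ?case unfolding cone_pairing_monom by (simp add: prod.distrib)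
next
  case (scale c \<phi>)
  have "cone_pairing N d \<alpha> R P (\<lambda>s. c * \<phi> s) = c * cone_pairing N d \<alpha> R P \<phi>"
    by (simp add: cone_pairing_def sum_distrib_left mult_ac)
  then show ?case using mult_left_mono[OF scale(3,1)] by (simp add: mult.assoc)
next
  case (add \<phi> \<psi>)
  have "cone_pairing N d \<alpha> R P (\<lambda>s. \<phi> s + \<psi> s) = cone_pairing N d \<alpha> R P \<phi> + cone_pairing N d \<alpha> R P \<psi>"
    by (simp add: cone_pairing_def sum.distrib distrib_left)
  then show ?case using add by (simp add: distrib_right)
next
  case (lim \<Phi> \<phi>)
  have "(\<lambda>k. cone_pairing N d \<alpha> R P (\<Phi> k)) \<longlonglongrightarrow> cone_pairing N d \<alpha> R P \<phi>"
    unfolding cone_pairing_def by (intro tendsto_intros lim(2)) (auto simp: nonneg_pts_def)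
  moreover have "(\<lambda>k. \<Phi> k (\<lambda>_. 0) * (\<Prod>i<N. gexp \<alpha> (d i) (\<lambda>z. poly (P i) (exp (- z)))))
    \<longlonglongrightarrow> \<phi> (\<lambda>_. 0) * (\<Prod>i<N. gexp \<alpha> (d i) (\<lambda>z. poly (P i) (exp (- z))))"
    by (intro tendsto_intros lim(2)) (auto simp: nonneg_pts_def)
  ultimately show ?case
    by (rule LIMSEQ_le) (use lim(3) in auto)
qed

end

text \<open>Evaluated at \<open>exp (- z)\<close>, these polynomials converge to the indicator of \<open>{..l}\<close>; the factor
  \<open>Suc m\<close> in the exponent makes the limit at \<open>z = l\<close> equal to \<open>1\<close>.\<close>

definition step_poly :: "real \<Rightarrow> nat \<Rightarrow> real poly" where
  "step_poly l m = 1 - (1 - monom 1 (Suc m)) ^ nat \<lceil>real (Suc m) * exp (l * real (Suc m))\<rceil>"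

lemma poly_step_poly:
  "poly (step_poly l m) u = 1 - (1 - u ^ Suc m) ^ nat \<lceil>real (Suc m) * exp (l * real (Suc m))\<rceil>"
  by (simp add: step_poly_def poly_power poly_monom)

lemma coeff_step_poly_0: "coeff (step_poly l m) 0 = 0"
  using poly_step_poly[of l m 0] by (simp add: poly_0_coeff_0)

lemma step_poly_bounds:
  assumes "0 \<le> u" "u \<le> 1"
  shows "0 \<le> poly (step_poly l m) u" "poly (step_poly l m) u \<le> 1"
proof -
  have "0 \<le> 1 - u ^ Suc m" "1 - u ^ Suc m \<le> 1"
    using assms power_le_one[of u "Suc m"] by auto
  then show "0 \<le> poly (step_poly l m) u" "poly (step_poly l m) u \<le> 1"
    unfolding poly_step_poly by (auto intro: power_le_one)
qed

lemma step_poly_mono: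
  assumes "0 \<le> u" "u \<le> w" "w \<le> 1"
  shows "poly (step_poly l m) u \<le> poly (step_poly l m) w"
proof -
  have "u ^ Suc m \<le> w ^ Suc m" "w ^ Suc m \<le> 1"
    using assms by (intro power_mono power_le_one; simp)+
  then show ?thesis unfolding poly_step_poly by (auto intro!: power_mono)
qed

lemma step_poly_mono_level:
  assumes "l \<le> l'" "0 \<le> u" "u \<le> 1"
  shows "poly (step_poly l m) u \<le> poly (step_poly l' m) u"
proof -
  have "0 \<le> 1 - u ^ Suc m" "1 - u ^ Suc m \<le> 1"
    using assms power_le_one[of u "Suc m"] by auto
  moreover have "nat \<lceil>real (Suc m) * exp (l * real (Suc m))\<rceil> \<le> nat \<lceil>real (Suc m) * exp (l' * real (Suc m))\<rceil>"
    using assms by (intro nat_mono ceiling_mono mult_left_mono) (auto intro!: mult_right_mono)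
  ultimately show ?thesis unfolding poly_step_poly by (auto intro!: power_decreasing)
qed

text \<open>The power \<open>(1 - t m) ^ K m\<close> is governed by \<open>K m * t m\<close>, which
  is about \<open>real (Suc m) * exp ((l - z) * real (Suc m))\<close>: it tends to infinity for
  \<open>z \<le> l\<close>, including \<open>z = l\<close> thanks to the factor in front, and to
  \<open>0\<close> for \<open>z > l\<close>. The first case uses
  \<open>1 - t \<le> exp (- t)\<close>, the second Bernoulli's inequality.\<close>

lemma step_poly_tendsto:
  assumes "0 \<le> l" "0 \<le> z"
  shows "(\<lambda>m. poly (step_poly l m) (exp (- z))) \<longlonglongrightarrow> indicator {..l} z"
proof -
  define K where "K m = nat \<lceil>real (Suc m) * exp (l * real (Suc m))\<rceil>" for m
  define t where "t m = exp (- z) ^ Suc m" for m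
  have t: "t m = exp (- z * real (Suc m))" for m
    unfolding t_def by (subst exp_of_nat2_mult) (rule refl)
  have t01: "0 \<le> t m" "t m \<le> 1" for m
    unfolding t using assms by (auto simp del: of_nat_Suc intro: mult_nonneg_nonneg)
  have Kge: "real (Suc m) * exp (l * real (Suc m)) \<le> real (K m)" for m
    unfolding K_def by (rule real_nat_ceiling_ge)
  have Kle: "real (K m) \<le> real (Suc m) * exp (l * real (Suc m)) + 1" for m
  proof -
    have "0 \<le> real (Suc m) * exp (l * real (Suc m))" by simp
    then have "0 \<le> \<lceil>real (Suc m) * exp (l * real (Suc m))\<rceil>" by linarith
    then have "real (K m) = of_int \<lceil>real (Suc m) * exp (l * real (Suc m))\<rceil>"
      unfolding K_def by (rule of_nat_nat)
    then show ?thesis using of_int_ceiling_le_add_one by metis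
  qed
  have eq: "poly (step_poly l m) (exp (- z)) = 1 - (1 - t m) ^ K m" for m
    by (simp add: poly_step_poly K_def t_def)
  show ?thesis
  proof (cases "z \<le> l")
    case True
    have bd: "(1 - t m) ^ K m \<le> exp (- real (Suc m))" for m
    proof -
      have "(1 - t m) ^ K m \<le> exp (- t m) ^ K m"
        using t01[of m] exp_ge_add_one_self[of "- t m"] by (intro power_mono) auto
      also have "\<dots> = exp (- (real (K m) * t m))"
        by (simp flip: exp_of_nat_mult)
      also have "\<dots> \<le> exp (- real (Suc m))"
      proof -
        have "real (Suc m) * 1 \<le> real (Suc m) * exp ((l - z) * real (Suc m))"
          using True by (intro mult_left_mono) (auto simp del: of_nat_Suc intro: mult_nonneg_nonneg)
        also have "\<dots> = real (Suc m) * exp (l * real (Suc m)) * t m"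
          unfolding t by (simp add: mult.assoc left_diff_distrib flip: exp_add del: of_nat_Suc)
        also have "\<dots> \<le> real (K m) * t m"
          using Kge t01 by (intro mult_right_mono)
        finally show ?thesis by simp
      qed
      finally show ?thesis .
    qed
    have "(\<lambda>m. (1 - t m) ^ K m) \<longlonglongrightarrow> 0"
    proof (rule tendsto_sandwich[OF _ _ tendsto_const])
      show "\<forall>\<^sub>F m in sequentially. 0 \<le> (1 - t m) ^ K m" using t01 by (intro always_eventually allI zero_le_power) auto
      show "\<forall>\<^sub>F m in sequentially. (1 - t m) ^ K m \<le> exp (- real (Suc m))" using bd by simp
      show "(\<lambda>m. exp (- real (Suc m))) \<longlonglongrightarrow> 0"
        by (rule LIMSEQ_Suc[where f = "\<lambda>m. exp (- real m)"]) real_asymp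
    qed
    from tendsto_diff[OF tendsto_const[of 1] this] show ?thesis using True by (simp add: eq)
  next
    case False
    have bd: "1 - (1 - t m) ^ K m \<le> real (Suc m) * exp (- ((z - l) * real (Suc m))) + exp (- z * real (Suc m))" for m
    proof -
      have "1 + real (K m) * (- t m) \<le> (1 + - t m) ^ K m"
        using t01[of m] by (intro Bernoulli_inequality) auto
      then have "1 - (1 - t m) ^ K m \<le> real (K m) * t m" by simp
      also have "\<dots> \<le> (real (Suc m) * exp (l * real (Suc m)) + 1) * t m"
        using Kle t01 by (intro mult_right_mono)
      also have "\<dots> = real (Suc m) * exp (- ((z - l) * real (Suc m))) + exp (- z * real (Suc m))"
        unfolding t by (simp add: distrib_right mult.assoc left_diff_distrib flip: exp_add del: of_nat_Suc)
      finally show ?thesis .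
    qed
    have zl: "0 < z - l" "0 < z" using False assms by auto
    have "(\<lambda>m. 1 - (1 - t m) ^ K m) \<longlonglongrightarrow> 0"
    proof (rule tendsto_sandwich[OF _ _ tendsto_const])
      show "\<forall>\<^sub>F m in sequentially. 0 \<le> 1 - (1 - t m) ^ K m" using t01 by (auto intro!: always_eventually power_le_one)
      show "\<forall>\<^sub>F m in sequentially. 1 - (1 - t m) ^ K m \<le> real (Suc m) * exp (- ((z - l) * real (Suc m))) + exp (- z * real (Suc m))"
        using bd by simp
      show "(\<lambda>m. real (Suc m) * exp (- ((z - l) * real (Suc m))) + exp (- z * real (Suc m))) \<longlonglongrightarrow> 0"
        by (rule LIMSEQ_Suc[where f = "\<lambda>m. real m * exp (- ((z - l) * real m)) + exp (- z * real m)"])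
          (intro tendsto_add_zero; use zl in real_asymp)
    qed
    then show ?thesis using False by (simp add: eq)
  qed
qed

lemma gexp_step_tendsto:
  assumes "0 < \<alpha>" "0 < d" "0 \<le> b"
  shows "(\<lambda>m. gexp \<alpha> d (\<lambda>z. poly (step_poly b m) (exp (- z)))) \<longlonglongrightarrow> gexp \<alpha> d (indicator {..b})"
  unfolding gexp_def
proof (rule integral_dominated_convergence[where w = "gdens \<alpha> d"])
  show "integrable lborel (gdens \<alpha> d)" using assms by (intro integrable_gdens)
  have "(\<lambda>z. poly (step_poly b m) (exp (- z))) \<in> borel_measurable borel" for m
    by (intro borel_measurable_continuous_onI continuous_intros)
  then show "(\<lambda>z. gdens \<alpha> d z * poly (step_poly b m) (exp (- z))) \<in> borel_measurable lborel" for m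
    by measurable
  show "AE z in lborel. (\<lambda>m. gdens \<alpha> d z * poly (step_poly b m) (exp (- z))) \<longlonglongrightarrow> gdens \<alpha> d z * indicator {..b} z"
  proof (rule AE_I2)
    fix z :: real
    show "(\<lambda>m. gdens \<alpha> d z * poly (step_poly b m) (exp (- z))) \<longlonglongrightarrow> gdens \<alpha> d z * indicator {..b} z"
    proof (cases "0 < z")
      case True
      then show ?thesis using assms by (intro tendsto_mult_left step_poly_tendsto) auto
    qed (simp add: gdens_def)
  qed
  show "AE z in lborel. norm (gdens \<alpha> d z * poly (step_poly b m) (exp (- z))) \<le> gdens \<alpha> d z" for m
  proof (rule AE_I2)
    fix z :: real
    show "norm (gdens \<alpha> d z * poly (step_poly b m) (exp (- z))) \<le> gdens \<alpha> d z"
    proof (cases "0 < z")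
      case True
      then show ?thesis
        using step_poly_bounds[of "exp (- z)" b m] gdens_nonneg[OF assms(1), of d z]
        by (auto simp: abs_mult intro!: mult_left_le)
    qed (simp add: gdens_def)
  qed
qed measurable

section \<open>From Laplace transforms to probabilities of boxes\<close>

text \<open>The weight \<open>X\<close> may change sign. With \<open>X = 1\<close> the locale
  describes one law; with a difference of two exponentials it compares two weighted laws, and
  membership of \<open>\<phi>\<close> in the cone expresses that one dominates the other.\<close>

locale laplace_family = prob_space M for M :: "'a measure" +
  fixes N :: nat and Z :: "nat \<Rightarrow> 'a \<Rightarrow> real" and d :: "nat \<Rightarrow> real" and \<alpha> :: real
    and X :: "'a \<Rightarrow> real" and \<phi> :: "(nat \<Rightarrow> real) \<Rightarrow> real"
  assumes d: "\<And>i. i < N \<Longrightarrow> 0 < d i" and \<alpha>: "0 < \<alpha>"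
    and Z_meas: "\<And>i. i < N \<Longrightarrow> Z i \<in> borel_measurable M"
    and Z_nonneg: "\<And>i \<omega>. i < N \<Longrightarrow> \<omega> \<in> space M \<Longrightarrow> 0 \<le> Z i \<omega>"
    and X_meas [measurable]: "X \<in> borel_measurable M"
    and X_bound: "\<And>\<omega>. \<omega> \<in> space M \<Longrightarrow> \<bar>X \<omega>\<bar> \<le> 1"
    and cone: "\<phi> \<in> gamma_cone N d"
    and laplace: "\<And>s. (\<And>i. i < N \<Longrightarrow> 0 < s i) \<Longrightarrow>
      expectation (\<lambda>\<omega>. exp (- (\<Sum>i<N. s i * Z i \<omega>)) * X \<omega>) = (\<Prod>i<N. (d i / (d i + s i)) powr \<alpha>) * \<phi> s"
begin

text \<open>After multiplying out, every exponent vector has coordinates at least \<open>1\<close>,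
  so \<open>laplace\<close> applies term by term.\<close>

lemma expectation_poly:
  assumes P0: "\<And>i. i < N \<Longrightarrow> coeff (P i) 0 = 0" and R: "\<And>i. i < N \<Longrightarrow> degree (P i) \<le> R"
  shows "expectation (\<lambda>\<omega>. (\<Prod>i<N. poly (P i) (exp (- Z i \<omega>))) * X \<omega>) = cone_pairing N d \<alpha> R P \<phi>"
proof -
  let ?K = "PiE {..<N} (\<lambda>_. {1..R})"
  have fin: "finite ?K" by (intro finite_PiE) auto
  have prod_eq: "(\<Prod>i<N. poly (P i) (exp (- Z i \<omega>))) * X \<omega>
    = (\<Sum>k\<in>?K. (\<Prod>i<N. coeff (P i) (k i)) * (exp (- (\<Sum>i<N. real (k i) * Z i \<omega>)) * X \<omega>))" for \<omega>
  proof -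
    have "(\<Prod>i<N. poly (P i) (exp (- Z i \<omega>))) = (\<Prod>i<N. \<Sum>k = 1..R. coeff (P i) k * exp (- (real k * Z i \<omega>)))"
    proof (rule prod.cong[OF refl])
      fix i assume "i \<in> {..<N}"
      then show "poly (P i) (exp (- Z i \<omega>)) = (\<Sum>k = 1..R. coeff (P i) k * exp (- (real k * Z i \<omega>)))"
        by (subst poly_eq_sum[OF P0 R]) (auto simp flip: exp_of_nat_mult)
    qed
    also have "\<dots> = (\<Sum>k\<in>?K. (\<Prod>i<N. coeff (P i) (k i)) * exp (- (\<Sum>i<N. real (k i) * Z i \<omega>)))"
      by (subst prod_sum_PiE) (auto simp: prod.distrib exp_sum sum_negf[symmetric])
    finally show ?thesis by (simp add: sum_distrib_right mult.assoc)
  qed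
  have int: "integrable M (\<lambda>\<omega>. exp (- (\<Sum>i<N. real (k i) * Z i \<omega>)) * X \<omega>)" for k :: "nat \<Rightarrow> nat"
  proof (rule integrable_const_bound[where B = 1])
    show "AE \<omega> in M. norm (exp (- (\<Sum>i<N. real (k i) * Z i \<omega>)) * X \<omega>) \<le> 1"
    proof (rule AE_I2)
      fix \<omega> assume \<omega>: "\<omega> \<in> space M"
      have "0 \<le> (\<Sum>i<N. real (k i) * Z i \<omega>)"
        using Z_nonneg[OF _ \<omega>] by (intro sum_nonneg) auto
      then show "norm (exp (- (\<Sum>i<N. real (k i) * Z i \<omega>)) * X \<omega>) \<le> 1"
        using X_bound[OF \<omega>] by (auto simp: abs_mult intro!: mult_le_one)
    qed
    show "(\<lambda>\<omega>. exp (- (\<Sum>i<N. real (k i) * Z i \<omega>)) * X \<omega>) \<in> borel_measurable M"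
      using Z_meas by (intro borel_measurable_times borel_measurable_exp borel_measurable_uminus borel_measurable_sum) auto
  qed
  have "expectation (\<lambda>\<omega>. (\<Prod>i<N. poly (P i) (exp (- Z i \<omega>))) * X \<omega>)
    = (\<Sum>k\<in>?K. (\<Prod>i<N. coeff (P i) (k i)) * expectation (\<lambda>\<omega>. exp (- (\<Sum>i<N. real (k i) * Z i \<omega>)) * X \<omega>))"
    unfolding prod_eq using int by (subst Bochner_Integration.integral_sum) auto
  also have "\<dots> = cone_pairing N d \<alpha> R P \<phi>"
    unfolding cone_pairing_def
  proof (intro sum.cong refl arg_cong2[where f = "(*)"])
    fix k assume "k \<in> ?K"
    then have "0 < real (k i)" if "i < N" for i using that by (auto simp: PiE_def Pi_def Suc_le_eq)
    then show "expectation (\<lambda>\<omega>. exp (- (\<Sum>i<N. real (k i) * Z i \<omega>)) * X \<omega>)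
      = (\<Prod>i<N. (d i / (d i + real (k i))) powr \<alpha>) * \<phi> (\<lambda>i. real (k i))"
      by (rule laplace)
  qed
  finally show ?thesis .
qed

lemma degree_bound: "\<exists>R. \<forall>i<N. degree (P i) \<le> R" for P :: "nat \<Rightarrow> real poly"
  by (rule exI[of _ "\<Sum>i<N. degree (P i)"]) (auto intro: member_le_sum)

lemma expectation_step_tendsto:
  fixes c a b :: "nat \<Rightarrow> real"
  assumes ab: "\<And>i. i < N \<Longrightarrow> 0 \<le> a i" "\<And>i. i < N \<Longrightarrow> 0 \<le> b i"
  shows "(\<lambda>m. expectation (\<lambda>\<omega>. (\<Prod>i<N. poly (step_poly (b i) m - Polynomial.smult (c i) (step_poly (a i) m)) (exp (- Z i \<omega>))) * X \<omega>))
    \<longlonglongrightarrow> expectation (\<lambda>\<omega>. (\<Prod>i<N. indicator {..b i} (Z i \<omega>) - c i * indicator {..a i} (Z i \<omega>)) * X \<omega>)"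
proof (rule integral_dominated_convergence[where w = "\<lambda>_. \<Prod>i<N. 1 + \<bar>c i\<bar>"])
  show "(\<lambda>\<omega>. (\<Prod>i<N. indicator {..b i} (Z i \<omega>) - c i * indicator {..a i} (Z i \<omega>)) * X \<omega>) \<in> borel_measurable M"
    using Z_meas by (intro borel_measurable_times borel_measurable_prod borel_measurable_diff X_meas borel_measurable_const
      measurable_compose[OF _ borel_measurable_indicator]) auto
  show "(\<lambda>\<omega>. (\<Prod>i<N. poly (step_poly (b i) m - Polynomial.smult (c i) (step_poly (a i) m)) (exp (- Z i \<omega>))) * X \<omega>) \<in> borel_measurable M" for m
  proof (intro borel_measurable_times borel_measurable_prod X_meas)
    fix i assume "i \<in> {..<N}"
    then have "Z i \<in> borel_measurable M" using Z_meas by simp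
    moreover have "(\<lambda>z. poly (step_poly (b i) m - Polynomial.smult (c i) (step_poly (a i) m)) (exp (- z))) \<in> borel_measurable borel"
      by (intro borel_measurable_continuous_onI continuous_intros)
    ultimately show "(\<lambda>\<omega>. poly (step_poly (b i) m - Polynomial.smult (c i) (step_poly (a i) m)) (exp (- Z i \<omega>))) \<in> borel_measurable M"
      by (rule measurable_compose)
  qed
  show "AE \<omega> in M. (\<lambda>m. (\<Prod>i<N. poly (step_poly (b i) m - Polynomial.smult (c i) (step_poly (a i) m)) (exp (- Z i \<omega>))) * X \<omega>)
      \<longlonglongrightarrow> (\<Prod>i<N. indicator {..b i} (Z i \<omega>) - c i * indicator {..a i} (Z i \<omega>)) * X \<omega>"
    unfolding poly_diff poly_smult using ab Z_nonneg
    by (intro AE_I2 tendsto_intros step_poly_tendsto) auto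
  show "AE \<omega> in M. norm ((\<Prod>i<N. poly (step_poly (b i) m - Polynomial.smult (c i) (step_poly (a i) m)) (exp (- Z i \<omega>))) * X \<omega>) \<le> (\<Prod>i<N. 1 + \<bar>c i\<bar>)" for m
  proof (rule AE_I2)
    fix \<omega> assume \<omega>: "\<omega> \<in> space M"
    have "\<bar>poly (step_poly (b i) m - Polynomial.smult (c i) (step_poly (a i) m)) (exp (- Z i \<omega>))\<bar> \<le> 1 + \<bar>c i\<bar>" if "i < N" for i
    proof -
      have u: "0 \<le> exp (- Z i \<omega>)" "exp (- Z i \<omega>) \<le> 1" using Z_nonneg[OF that \<omega>] by auto
      have "\<bar>c i * poly (step_poly (a i) m) (exp (- Z i \<omega>))\<bar> \<le> \<bar>c i\<bar> * 1"
        unfolding abs_mult using step_poly_bounds[OF u, of "a i" m] by (intro mult_left_mono) auto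
      then show ?thesis using step_poly_bounds[OF u, of "b i" m] by simp
    qed
    then have "(\<Prod>i<N. \<bar>poly (step_poly (b i) m - Polynomial.smult (c i) (step_poly (a i) m)) (exp (- Z i \<omega>))\<bar>) * \<bar>X \<omega>\<bar> \<le> (\<Prod>i<N. 1 + \<bar>c i\<bar>) * 1"
      using X_bound[OF \<omega>] by (intro mult_mono prod_mono prod_nonneg conjI) (auto simp del: poly_diff poly_smult)
    then show "norm ((\<Prod>i<N. poly (step_poly (b i) m - Polynomial.smult (c i) (step_poly (a i) m)) (exp (- Z i \<omega>))) * X \<omega>) \<le> (\<Prod>i<N. 1 + \<bar>c i\<bar>)"
      by (simp add: abs_mult abs_prod del: poly_diff poly_smult)
  qed
qed (intro integrable_const)

text \<open>A factor with \<open>c i = 0\<close> tests \<open>Z i \<le> b i\<close>, one with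
  \<open>c i = 1\<close> tests \<open>a i < Z i \<le> b i\<close>. Since the step polynomials
  increase with the level, their weighted differences are nonnegative on the unit interval, as
  \<open>cone_pairing_nonneg\<close> requires.\<close>

lemma expectation_nonneg_boxes:
  fixes c a b :: "nat \<Rightarrow> real"
  assumes ab: "\<And>i. i < N \<Longrightarrow> 0 \<le> a i" "\<And>i. i < N \<Longrightarrow> a i \<le> b i" "\<And>i. i < N \<Longrightarrow> 0 \<le> c i" "\<And>i. i < N \<Longrightarrow> c i \<le> 1"
  shows "0 \<le> expectation (\<lambda>\<omega>. (\<Prod>i<N. indicator {..b i} (Z i \<omega>) - c i * indicator {..a i} (Z i \<omega>)) * X \<omega>)"
proof (rule LIMSEQ_le_const[OF expectation_step_tendsto[of a b c]])
  show "\<exists>K. \<forall>m\<ge>K. 0 \<le> expectation (\<lambda>\<omega>. (\<Prod>i<N. poly (step_poly (b i) m - Polynomial.smult (c i) (step_poly (a i) m)) (exp (- Z i \<omega>))) * X \<omega>)"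
  proof (intro exI allI impI)
    fix m
    obtain R where R: "\<And>i. i < N \<Longrightarrow> degree (step_poly (b i) m - Polynomial.smult (c i) (step_poly (a i) m)) \<le> R"
      using degree_bound[of "\<lambda>i. step_poly (b i) m - Polynomial.smult (c i) (step_poly (a i) m)"] by blast
    have "0 \<le> cone_pairing N d \<alpha> R (\<lambda>i. step_poly (b i) m - Polynomial.smult (c i) (step_poly (a i) m)) \<phi>"
    proof (rule cone_pairing_nonneg[OF d \<alpha> _ R cone])
      fix i :: nat and u :: real assume *: "i < N" "0 \<le> u" "u \<le> 1"
      have "c i * poly (step_poly (a i) m) u \<le> 1 * poly (step_poly (b i) m) u"
        using * ab step_poly_bounds[of u "a i" m] step_poly_mono_level[of "a i" "b i" u m]
        by (intro mult_mono) auto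
      then show "0 \<le> poly (step_poly (b i) m - Polynomial.smult (c i) (step_poly (a i) m)) u" by simp
    qed (auto simp: coeff_step_poly_0)
    then show "0 \<le> expectation (\<lambda>\<omega>. (\<Prod>i<N. poly (step_poly (b i) m - Polynomial.smult (c i) (step_poly (a i) m)) (exp (- Z i \<omega>))) * X \<omega>)"
      by (subst expectation_poly[OF _ R]) (auto simp: coeff_step_poly_0)
  qed
qed (use ab order_trans[OF ab(1,2)] in simp_all)

text \<open>Step polynomials increase in \<open>exp (- z)\<close>, so \<open>cone_pairing_le\<close>
  applies before passing to the limit.\<close>

lemma expectation_le_boxes:
  fixes b :: "nat \<Rightarrow> real"
  assumes b: "\<And>i. i < N \<Longrightarrow> 0 \<le> b i"
  shows "expectation (\<lambda>\<omega>. (\<Prod>i<N. indicator {..b i} (Z i \<omega>)) * X \<omega>) \<le> \<phi> (\<lambda>_. 0) * (\<Prod>i<N. gexp \<alpha> (d i) (indicator {..b i}))"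
proof (rule LIMSEQ_le)
  show "(\<lambda>m. expectation (\<lambda>\<omega>. (\<Prod>i<N. poly (step_poly (b i) m) (exp (- Z i \<omega>))) * X \<omega>))
      \<longlonglongrightarrow> expectation (\<lambda>\<omega>. (\<Prod>i<N. indicator {..b i} (Z i \<omega>)) * X \<omega>)"
    using expectation_step_tendsto[of b b "\<lambda>_. 0"] b by simp
  show "(\<lambda>m. \<phi> (\<lambda>_. 0) * (\<Prod>i<N. gexp \<alpha> (d i) (\<lambda>z. poly (step_poly (b i) m) (exp (- z)))))
    \<longlonglongrightarrow> \<phi> (\<lambda>_. 0) * (\<Prod>i<N. gexp \<alpha> (d i) (indicator {..b i}))"
    using d b \<alpha> by (intro tendsto_intros gexp_step_tendsto) auto
  show "\<exists>K. \<forall>m\<ge>K. expectation (\<lambda>\<omega>. (\<Prod>i<N. poly (step_poly (b i) m) (exp (- Z i \<omega>))) * X \<omega>)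
      \<le> \<phi> (\<lambda>_. 0) * (\<Prod>i<N. gexp \<alpha> (d i) (\<lambda>z. poly (step_poly (b i) m) (exp (- z))))"
  proof (intro exI allI impI)
    fix m
    obtain R where R: "\<And>i. i < N \<Longrightarrow> degree (step_poly (b i) m) \<le> R"
      using degree_bound[of "\<lambda>i. step_poly (b i) m"] by blast
    show "expectation (\<lambda>\<omega>. (\<Prod>i<N. poly (step_poly (b i) m) (exp (- Z i \<omega>))) * X \<omega>)
      \<le> \<phi> (\<lambda>_. 0) * (\<Prod>i<N. gexp \<alpha> (d i) (\<lambda>z. poly (step_poly (b i) m) (exp (- z))))"
      by (subst expectation_poly[OF _ R])
        (auto simp: coeff_step_poly_0 intro!: cone_pairing_le[OF d \<alpha> _ R cone] step_poly_bounds step_poly_mono)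
  qed
qed

end

text \<open>Uniqueness of the Laplace transform, tested on step polynomials: for one coordinate and
  \<open>\<phi> = 1\<close>, the monomial with exponent zero, both sides are limits of the same
  pairing.\<close>

lemma (in prob_space) gamma_marginal:
  assumes [measurable]: "Y \<in> borel_measurable M" and nonneg: "\<And>\<omega>. \<omega> \<in> space M \<Longrightarrow> 0 \<le> Y \<omega>"
    and "0 < \<alpha>" "0 < c" "0 \<le> b"
    and laplace: "\<And>s. 0 < s \<Longrightarrow> expectation (\<lambda>\<omega>. exp (- (s * Y \<omega>))) = (1 + c * s) powr - \<alpha>"
  shows "prob {\<omega> \<in> space M. Y \<omega> \<le> b} = gexp \<alpha> (inverse c) (indicator {..b})"
proof -
  interpret laplace_family M 1 "\<lambda>_. Y" "\<lambda>_. inverse c" \<alpha> "\<lambda>_. 1" "\<lambda>_. 1"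
  proof unfold_locales
    fix s :: "nat \<Rightarrow> real" assume "\<And>i. i < 1 \<Longrightarrow> 0 < s i"
    then have s: "0 < s 0" by simp
    have "inverse c / (inverse c + s 0) = inverse (1 + c * s 0)" using s \<open>0 < c\<close> by (simp add: field_simps)
    then have "(inverse c / (inverse c + s 0)) powr \<alpha> = (1 + c * s 0) powr - \<alpha>"
      using s \<open>0 < c\<close> by (simp add: powr_minus inverse_powr)
    then show "expectation (\<lambda>\<omega>. exp (- (\<Sum>i<1. s i * Y \<omega>)) * 1) = (\<Prod>i<1. (inverse c / (inverse c + s i)) powr \<alpha>) * 1"
      using laplace[OF s] by simp
  qed (use assms gamma_cone_const[of 1] in auto)
  have "(\<lambda>m. expectation (\<lambda>\<omega>. poly (step_poly b m) (exp (- Y \<omega>)))) \<longlonglongrightarrow> expectation (\<lambda>\<omega>. indicator {..b} (Y \<omega>))"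
    using expectation_step_tendsto[of "\<lambda>_. b" "\<lambda>_. b" "\<lambda>_. 0"] assms by simp
  moreover have "expectation (\<lambda>\<omega>. poly (step_poly b m) (exp (- Y \<omega>))) = gexp \<alpha> (inverse c) (\<lambda>z. poly (step_poly b m) (exp (- z)))" for m
  proof -
    let ?P = "\<lambda>_::nat. step_poly b m"
    have "expectation (\<lambda>\<omega>. poly (step_poly b m) (exp (- Y \<omega>))) = cone_pairing 1 (\<lambda>_. inverse c) \<alpha> (degree (step_poly b m)) ?P (\<lambda>_. 1)"
      using expectation_poly[of ?P "degree (step_poly b m)"] by (simp add: coeff_step_poly_0)
    also have "\<dots> = gexp \<alpha> (inverse c) (\<lambda>z. poly (step_poly b m) (exp (- z)))"
      using cone_pairing_monom[of 1 "\<lambda>_. inverse c" \<alpha> ?P "degree (step_poly b m)" "\<lambda>_. 0"] assms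
      by (simp add: coeff_step_poly_0)
    finally show ?thesis .
  qed
  ultimately have "(\<lambda>m. gexp \<alpha> (inverse c) (\<lambda>z. poly (step_poly b m) (exp (- z)))) \<longlonglongrightarrow> expectation (\<lambda>\<omega>. indicator {..b} (Y \<omega>))"
    by simp
  then have "expectation (\<lambda>\<omega>. indicator {..b} (Y \<omega>)) = gexp \<alpha> (inverse c) (indicator {..b})"
    using gexp_step_tendsto[of \<alpha> "inverse c" b] assms by (intro LIMSEQ_unique) auto
  moreover have "expectation (\<lambda>\<omega>. indicat_real {..b} (Y \<omega>)) = expectation (indicat_real {\<omega> \<in> space M. Y \<omega> \<le> b})"
    by (intro Bochner_Integration.integral_cong) (auto simp: indicator_def)
  ultimately show ?thesis by simp
qed

section \<open>Tails of gamma laws\<close>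

definition gtail :: "real \<Rightarrow> real \<Rightarrow> real \<Rightarrow> real" where
  "gtail \<alpha> d c = gexp \<alpha> d (indicator {c<..})"

lemma gexp_atMost:
  assumes "0 < \<alpha>" "0 < d"
  shows "gexp \<alpha> d (indicator {..c}) = 1 - gtail \<alpha> d c"
proof -
  have int: "integrable lborel (\<lambda>z. gdens \<alpha> d z * indicator S z)" if "S \<in> sets borel" for S
    using assms that by (intro integrable_gdens_mult[where B = 1]) (auto simp: indicator_def)
  have "gexp \<alpha> d (indicator {..c}) + gtail \<alpha> d c = (LINT z|lborel. gdens \<alpha> d z * indicator {..c} z + gdens \<alpha> d z * indicator {c<..} z)"
    unfolding gexp_def gtail_def by (rule Bochner_Integration.integral_add[symmetric]) (auto intro: int)
  also have "\<dots> = (LINT z|lborel. gdens \<alpha> d z)"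
    by (intro Bochner_Integration.integral_cong) (auto simp: indicator_def)
  also have "\<dots> = 1" using assms by (rule integrable_gdens)
  finally show ?thesis by simp
qed

lemma gtail_le_1: "0 < \<alpha> \<Longrightarrow> 0 < d \<Longrightarrow> gtail \<alpha> d c \<le> 1"
  using gexp_atMost[of \<alpha> d c] gexp_nonneg[of \<alpha> "indicator {..c}" d] by simp

text \<open>Compare with the gamma law of the smaller rate \<open>\<epsilon> * d\<close>. The
  density ratio is \<open>\<epsilon> powr - \<alpha> * exp (- (1 - \<epsilon>) * (d * z))\<close>,
  hence at most the claimed bound on \<open>z > c\<close>.\<close>

lemma gtail_upper:
  assumes "0 < \<alpha>" "0 < d" "0 < \<epsilon>" "\<epsilon> < 1"
  shows "gtail \<alpha> d c \<le> \<epsilon> powr - \<alpha> * exp (- (1 - \<epsilon>) * (d * c))"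
proof -
  define D where "D = \<epsilon> powr - \<alpha> * exp (- (1 - \<epsilon>) * (d * c))"
  have "gtail \<alpha> d c \<le> (LINT z|lborel. D * gdens \<alpha> (\<epsilon> * d) z)"
    unfolding gtail_def gexp_def
  proof (intro integral_mono)
    show "integrable lborel (\<lambda>z. gdens \<alpha> d z * indicator {c<..} z)"
      using assms by (intro integrable_gdens_mult[where B = 1]) (auto simp: indicator_def)
    show "integrable lborel (\<lambda>z. D * gdens \<alpha> (\<epsilon> * d) z)" using assms integrable_gdens by simp
    fix z :: real
    show "gdens \<alpha> d z * indicator {c<..} z \<le> D * gdens \<alpha> (\<epsilon> * d) z"
    proof (cases "c < z \<and> 0 < z")
      case True
      have "D * gdens \<alpha> (\<epsilon> * d) z = gdens \<alpha> d z * exp ((1 - \<epsilon>) * (d * (z - c)))"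
      proof -
        have "D * gdens \<alpha> (\<epsilon> * d) z = (\<epsilon> powr - \<alpha> * \<epsilon> powr \<alpha>) * (d powr \<alpha> * z powr (\<alpha> - 1) / Gamma \<alpha>) * (exp (- (1 - \<epsilon>) * (d * c)) * exp (- (\<epsilon> * d) * z))"
          using True assms by (simp add: D_def gdens_def powr_mult)
        also have "\<epsilon> powr - \<alpha> * \<epsilon> powr \<alpha> = 1" using assms by (simp flip: powr_add)
        also have "exp (- (1 - \<epsilon>) * (d * c)) * exp (- (\<epsilon> * d) * z) = exp (- d * z) * exp ((1 - \<epsilon>) * (d * (z - c)))"
          by (simp add: algebra_simps flip: exp_add)
        finally show ?thesis using True by (simp add: gdens_def)
      qed
      moreover have "1 \<le> exp ((1 - \<epsilon>) * (d * (z - c)))" using True assms by simp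
      ultimately show ?thesis
        using True gdens_nonneg[OF assms(1), of d z] by (simp add: mult_le_cancel_left1)
    next
      case False
      have "0 \<le> D * gdens \<alpha> (\<epsilon> * d) z"
        using gdens_nonneg[OF assms(1)] by (intro mult_nonneg_nonneg) (auto simp: D_def)
      then show ?thesis using False by (auto simp: gdens_def indicator_def)
    qed
  qed
  also have "\<dots> = D" using assms integrable_gdens(2)[of \<alpha> "\<epsilon> * d"] by simp
  finally show ?thesis by (simp add: D_def)
qed

text \<open>The interval of length \<open>1 / d\<close> to the right of \<open>c\<close> already
  carries enough mass. The constant must be uniform in \<open>d\<close> and \<open>c\<close>,
  because the rates vary along the subsequence of \<open>AE_lower\<close>.\<close>

lemma gtail_lower:
  assumes "0 < \<alpha>" "0 < \<epsilon>"
  obtains \<kappa> where "0 < \<kappa>" "\<And>d c. 0 < d \<Longrightarrow> 1 \<le> d * c \<Longrightarrow> \<kappa> * exp (- (1 + \<epsilon>) * (d * c)) \<le> gtail \<alpha> d c"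
proof -
  \<comment> \<open>The factor \<open>min 1 \<epsilon>\<close> comes from \<open>base\<close>, which
    bounds the power in the density at the price of a factor \<open>exp (- \<epsilon> * y)\<close>.
    The factor \<open>exp (- (1 + \<epsilon>))\<close> pays for moving from \<open>d * c\<close> to
    \<open>d * c + 1\<close>.\<close>
  define \<kappa> where "\<kappa> = min 1 \<epsilon> * exp (- (1 + \<epsilon>)) / Gamma \<alpha>"
  have G: "0 < Gamma \<alpha>" using assms by (simp add: Gamma_real_pos)
  have base: "min 1 \<epsilon> * exp (- \<epsilon> * y) \<le> y powr (\<alpha> - 1)" if "1 \<le> y" for y
  proof (cases "1 \<le> \<alpha>")
    case True
    have "min 1 \<epsilon> * exp (- \<epsilon> * y) \<le> 1 * 1" using assms that by (intro mult_mono) auto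
    moreover have "1 \<le> y powr (\<alpha> - 1)" using True that by (simp add: ge_one_powr_ge_zero)
    ultimately show ?thesis by linarith
  next
    case False
    have "\<epsilon> * y \<le> exp (\<epsilon> * y)" using exp_ge_add_one_self[of "\<epsilon> * y"] by linarith
    then have "\<epsilon> * exp (- \<epsilon> * y) \<le> y powr - 1"
      using that by (simp add: powr_minus exp_minus field_simps)
    also have "\<dots> \<le> y powr (\<alpha> - 1)" using that assms by (intro powr_mono) auto
    finally have "\<epsilon> * exp (- \<epsilon> * y) \<le> y powr (\<alpha> - 1)" .
    moreover have "min 1 \<epsilon> * exp (- \<epsilon> * y) \<le> \<epsilon> * exp (- \<epsilon> * y)" by (intro mult_right_mono) auto
    ultimately show ?thesis by linarith
  qed
  have "\<kappa> * exp (- (1 + \<epsilon>) * (d * c)) \<le> gtail \<alpha> d c" if d: "0 < d" and c: "1 \<le> d * c" for d c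
  proof -
    have "0 < d * c" using c by linarith
    then have cpos: "0 < c" using d by (simp add: zero_less_mult_iff)
    define D where "D = d * (\<kappa> * exp (- (1 + \<epsilon>) * (d * c)))"
    have "\<kappa> * exp (- (1 + \<epsilon>) * (d * c)) = (LINT z|lborel. D * indicator {c<..c + 1 / d} z)"
      using d by (simp add: D_def)
    also have "\<dots> \<le> gtail \<alpha> d c"
      unfolding gtail_def gexp_def
    proof (intro integral_mono)
      show "integrable lborel (\<lambda>z. gdens \<alpha> d z * indicator {c<..} z)"
        using assms d by (intro integrable_gdens_mult[where B = 1]) (auto simp: indicator_def)
      show "integrable lborel (\<lambda>z. D * indicator {c<..c + 1 / d} z)"
        using d by (intro integrable_mult_right integrable_real_indicator) (auto simp: emeasure_lborel_Ioc)
      fix z :: real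
      show "D * indicator {c<..c + 1 / d} z \<le> gdens \<alpha> d z * indicator {c<..} z"
      proof (cases "c < z \<and> z \<le> c + 1 / d")
        case True
        have z0: "0 < z" using True cpos by simp
        have dz: "d * c \<le> d * z" "d * z \<le> d * c + 1" using True d by (auto simp: field_simps)
        have "exp (- (1 + \<epsilon>)) * exp (- (1 + \<epsilon>) * (d * c)) \<le> exp (- \<epsilon> * (d * z)) * exp (- (d * z))"
        proof -
          have "(1 + \<epsilon>) * (d * z) \<le> (1 + \<epsilon>) * (d * c + 1)" using dz assms by (intro mult_left_mono) auto
          then show ?thesis by (simp add: algebra_simps flip: exp_add)
        qed
        then have "min 1 \<epsilon> * (exp (- (1 + \<epsilon>)) * exp (- (1 + \<epsilon>) * (d * c))) \<le> min 1 \<epsilon> * (exp (- \<epsilon> * (d * z)) * exp (- (d * z)))"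
          using assms by (intro mult_left_mono) auto
        also have "\<dots> = (min 1 \<epsilon> * exp (- \<epsilon> * (d * z))) * exp (- (d * z))" by simp
        also have "\<dots> \<le> (d * z) powr (\<alpha> - 1) * exp (- (d * z))"
          using dz c by (intro mult_right_mono base) auto
        finally have "D \<le> d * ((d * z) powr (\<alpha> - 1) * exp (- (d * z))) / Gamma \<alpha>"
          using d G by (simp add: D_def \<kappa>_def divide_right_mono mult.assoc)
        also have "\<dots> = gdens \<alpha> d z" using z0 d by (simp add: gdens_def powr_mult powr_diff)
        finally show ?thesis using True by simp
      next
        case False
        then show ?thesis using gdens_nonneg[OF assms(1), of d z] by (auto simp: indicator_def)
      qed
    qed
    finally show ?thesis .
  qed
  moreover have "0 < \<kappa>" using assms G by (simp add: \<kappa>_def)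
  ultimately show thesis using that by blast
qed

section \<open>Permanental vectors with an M-matrix inverse\<close>

definition permanental_vector ::
  "'a measure \<Rightarrow> real \<Rightarrow> nat \<Rightarrow> (nat \<Rightarrow> nat \<Rightarrow> real) \<Rightarrow> (nat \<Rightarrow> 'a \<Rightarrow> real) \<Rightarrow> bool" where
  "permanental_vector M \<alpha> N k Z \<longleftrightarrow> prob_space M \<and>
     (\<forall>i<N. Z i \<in> borel_measurable M \<and> (\<forall>\<omega>\<in>space M. 0 \<le> Z i \<omega>)) \<and>
     (\<forall>s. (\<forall>i<N. 0 < s i) \<longrightarrow>
        prob_space.expectation M (\<lambda>\<omega>. exp (- (\<Sum>i<N. s i * Z i \<omega>)))
          = Determinant.det (1\<^sub>m N + fmat N k * mat_diag N s) powr - \<alpha>)"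

text \<open>Positivity of \<open>k\<close> makes its row sums a positive vector, which
  \<open>T\<close> maps to the constant vector \<open>1\<close>. These row sums are the vector
  \<open>v\<close> in all uses of \<open>gdet_m_matrix\<close> and
  \<open>gdet_cone_le\<close>.\<close>

definition m_inverse :: "nat \<Rightarrow> (nat \<Rightarrow> nat \<Rightarrow> real) \<Rightarrow> (nat \<Rightarrow> nat \<Rightarrow> real) \<Rightarrow> bool" where
  "m_inverse N T k \<longleftrightarrow>
     (\<forall>i<N. \<forall>j<N. 0 < k i j) \<and>
     (\<forall>i<N. \<forall>j<N. i \<noteq> j \<longrightarrow> T i j \<le> 0) \<and>
     (\<forall>i<N. \<forall>j<N. (\<Sum>l<N. T i l * k l j) = (if i = j then 1 else 0))"

lemma m_inverse_row_sums:
  assumes "m_inverse N T k" "i < N"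
  shows "(\<Sum>j<N. T i j * (\<Sum>l<N. k j l)) = 1"
proof -
  have "(\<Sum>j<N. T i j * (\<Sum>l<N. k j l)) = (\<Sum>l<N. \<Sum>j<N. T i j * k j l)"
    unfolding sum_distrib_left by (rule sum.swap)
  also have "\<dots> = (\<Sum>l<N. if i = l then 1 else 0)"
    using assms by (intro sum.cong) (auto simp: m_inverse_def)
  also have "\<dots> = 1" using assms by simp
  finally show ?thesis .
qed

lemma m_inverse_weight:
  assumes "m_inverse N T k" "i < N"
  shows "0 < (\<Sum>l<N. k i l)"
  using assms by (intro sum_pos) (auto simp: m_inverse_def)

abbreviation diag_shift :: "(nat \<Rightarrow> nat \<Rightarrow> real) \<Rightarrow> (nat \<Rightarrow> real) \<Rightarrow> nat \<Rightarrow> nat \<Rightarrow> real" where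
  "diag_shift T s \<equiv> \<lambda>i j. T i j + (if i = j then s i else 0)"

lemma diag_shift_weight:
  assumes "m_inverse N T k" "i < N" "0 \<le> s i"
  shows "0 < (\<Sum>j<N. diag_shift T s i j * (\<Sum>l<N. k j l))"
proof -
  have "(\<Sum>j<N. diag_shift T s i j * (\<Sum>l<N. k j l)) = 1 + (\<Sum>j<N. if i = j then s i * (\<Sum>l<N. k i l) else 0)"
    using m_inverse_row_sums[OF assms(1,2)]
    by (simp add: distrib_right sum.distrib if_distrib[of "\<lambda>x. x * _"] cong: if_cong)
  also have "\<dots> = 1 + s i * (\<Sum>l<N. k i l)" using assms(2) by simp
  finally show ?thesis using assms m_inverse_weight[OF assms(1,2)] by (simp add: add_pos_nonneg)
qed

text \<open>Multiplying the matrix in the Laplace transform by \<open>T\<close> from the left gives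
  \<open>T\<close> plus the diagonal matrix of \<open>s\<close>. This moves the variables onto the
  diagonal, as \<open>gdet_cone_le\<close> needs.\<close>

lemma gdet_diag_shift:
  assumes T: "m_inverse N T k" and s: "\<And>i. i < N \<Longrightarrow> 0 \<le> s i"
  shows "0 < gdet N (diag_shift T s)"
    and "Determinant.det (1\<^sub>m N + fmat N k * mat_diag N s) = gdet N (diag_shift T s) / gdet N T"
proof -
  have gs: "0 < gdet N (diag_shift T s') \<and> Determinant.det (fmat N (diag_shift T s')) = gdet N (diag_shift T s')"
    if "\<And>i. i < N \<Longrightarrow> 0 \<le> s' i" for s'
    using T diag_shift_weight[OF T] that m_inverse_weight[OF T]
    by (intro gdet_m_matrix[where v = "\<lambda>j. \<Sum>l<N. k j l"]) (auto simp: m_inverse_def)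
  have gs': "0 < gdet N (diag_shift T s)" "Determinant.det (fmat N (diag_shift T s)) = gdet N (diag_shift T s)"
    using gs[of s] s by auto
  then show "0 < gdet N (diag_shift T s)" by blast
  have g0: "0 < gdet N T" "Determinant.det (fmat N T) = gdet N T"
    using gs[of "\<lambda>_. 0"] by simp_all
  have car: "fmat N T \<in> carrier_mat N N" "fmat N k \<in> carrier_mat N N" "mat_diag N s \<in> carrier_mat N N"
    "fmat N k * mat_diag N s \<in> carrier_mat N N" "1\<^sub>m N + fmat N k * mat_diag N s \<in> carrier_mat N N"
    by (simp_all add: mat_diag_def mult_carrier_mat[of _ N N] add_carrier_mat)
  have "fmat N T * (1\<^sub>m N + fmat N k * mat_diag N s) = fmat N (diag_shift T s)"
  proof -
    have "fmat N T * fmat N k = 1\<^sub>m N"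
      using T by (intro eq_matI) (auto simp: scalar_prod_def m_inverse_def atLeast0LessThan)
    then have "fmat N T * (fmat N k * mat_diag N s) = mat_diag N s"
      using assoc_mult_mat[OF car(1-3)] left_mult_one_mat[OF car(3)] by simp
    then have "fmat N T * (1\<^sub>m N + fmat N k * mat_diag N s) = fmat N T + mat_diag N s"
      using mult_add_distrib_mat[OF car(1) one_carrier_mat car(4)] right_mult_one_mat[OF car(1)] by simp
    also have "\<dots> = fmat N (diag_shift T s)" by (intro eq_matI) (auto simp: mat_diag_def)
    finally show ?thesis .
  qed
  then have "Determinant.det (fmat N T) * Determinant.det (1\<^sub>m N + fmat N k * mat_diag N s) = Determinant.det (fmat N (diag_shift T s))"
    using det_mult[OF car(1,5)] by simp
  then show "Determinant.det (1\<^sub>m N + fmat N k * mat_diag N s) = gdet N (diag_shift T s) / gdet N T"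
    using g0 gs' by (simp add: field_simps)
qed

lemma permanental_vector_laplace:
  assumes "permanental_vector M \<alpha> N k Z" "m_inverse N T k" "\<And>i. i < N \<Longrightarrow> 0 < s i"
  shows "prob_space.expectation M (\<lambda>\<omega>. exp (- (\<Sum>i<N. s i * Z i \<omega>)))
    = gdet N T powr \<alpha> * gdet N (diag_shift T s) powr - \<alpha>"
proof -
  have s: "\<And>i. i < N \<Longrightarrow> 0 \<le> s i" using assms(3) by (simp add: less_imp_le)
  note g = gdet_diag_shift[where s = s, OF assms(2), OF s]
  have "0 < gdet N T" using gdet_diag_shift(1)[OF assms(2), of "\<lambda>_. 0"] by simp
  moreover have "prob_space.expectation M (\<lambda>\<omega>. exp (- (\<Sum>i<N. s i * Z i \<omega>))) = (gdet N (diag_shift T s) / gdet N T) powr - \<alpha>"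
    using assms(1,3) g(2) unfolding permanental_vector_def by auto
  ultimately show ?thesis using g(1) by (simp add: divide_inverse powr_mult powr_minus inverse_powr)
qed

text \<open>Rates above \<open>T i i\<close> are possible because the excess
  \<open>d i - T i i\<close> can join the diagonal of \<open>q\<close> as a nonnegative constant. So
  explicit upper bounds can replace the diagonal of the exact inverse.\<close>

lemma permanental_vector_lower:
  assumes Z: "permanental_vector M \<alpha> N k Z" and \<alpha>: "0 < \<alpha>" and T: "m_inverse N T k"
    and d: "\<And>i. i < N \<Longrightarrow> 0 < d i" "\<And>i. i < N \<Longrightarrow> T i i \<le> d i"
    and b: "\<And>i. i < N \<Longrightarrow> 0 \<le> b i"
  shows "measure M {\<omega> \<in> space M. \<forall>i<N. Z i \<omega> \<le> b i} \<le> (\<Prod>i<N. gexp \<alpha> (d i) (indicator {..b i}))"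
proof -
  interpret prob_space M using Z by (simp add: permanental_vector_def)
  define q where "q i j = (\<lambda>s::nat \<Rightarrow> real. if i = j then d i - T i i else - T i j)" for i j
  define P where "P s = gdet N (diag_shift T s) powr - \<alpha> * (\<Prod>i<N. (d i + s i) powr \<alpha>)" for s
  define C where "C = gdet N T powr \<alpha> * (\<Prod>i<N. d i powr - \<alpha>)"
  have Meq: "(\<lambda>i j. (if i = j then d i + s i else 0) - q i j s) = diag_shift T s" for s
    by (intro ext) (simp add: q_def)
  have "cone_le N d P P"
    unfolding P_def Meq[symmetric]
  proof (rule gdet_cone_le[OF d(1) \<alpha> order_refl, where v = "\<lambda>j. \<Sum>l<N. k j l"])
    show "cone_le N d (q i j) (q i j)" if "i < N" "j < N" for i j
      unfolding q_def using T d(2) that by (intro cone_le_refl gamma_cone_const) (auto simp: m_inverse_def)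
    show "0 < (\<Sum>j<N. ((if i = j then d i + s i else 0) - q i j s) * (\<Sum>l<N. k j l))"
      if "s \<in> nonneg_pts N" "i < N" for s i
      using fun_cong[OF fun_cong[OF Meq[of s]], of i] diag_shift_weight[OF T that(2), of s] that
      by (simp add: nonneg_pts_def)
  qed (use m_inverse_weight[OF T] in auto)
  then have P: "P \<in> gamma_cone N d" by (simp add: cone_le_def)
  have g0: "0 < gdet N T" using gdet_diag_shift(1)[OF T, of "\<lambda>_. 0"] by simp
  interpret laplace_family M N Z d \<alpha> "\<lambda>_. 1" "\<lambda>s. C * P s"
  proof unfold_locales
    show "(\<lambda>s. C * P s) \<in> gamma_cone N d"
      by (rule gamma_cone.scale[OF _ P]) (auto simp: C_def intro!: mult_nonneg_nonneg prod_nonneg)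
    fix s :: "nat \<Rightarrow> real" assume s: "\<And>i. i < N \<Longrightarrow> 0 < s i"
    have "(\<Prod>i<N. (d i / (d i + s i)) powr \<alpha>) * ((\<Prod>i<N. d i powr - \<alpha>) * (\<Prod>i<N. (d i + s i) powr \<alpha>)) = 1"
      unfolding prod.distrib[symmetric]
    proof (rule prod.neutral, rule ballI)
      fix i assume "i \<in> {..<N}"
      then have "0 < d i" "0 < s i" using d s by auto
      then show "(d i / (d i + s i)) powr \<alpha> * (d i powr - \<alpha> * (d i + s i) powr \<alpha>) = 1"
        by (simp add: powr_divide powr_minus field_simps)
    qed
    then show "expectation (\<lambda>\<omega>. exp (- (\<Sum>i<N. s i * Z i \<omega>)) * 1) = (\<Prod>i<N. (d i / (d i + s i)) powr \<alpha>) * (C * P s)"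
      using permanental_vector_laplace[where s = s, OF Z T, OF s]
      by (simp add: C_def P_def)
  qed (use Z d \<alpha> in \<open>auto simp: permanental_vector_def\<close>)
  \<comment> \<open>The transform of a probability law is \<open>1\<close> at \<open>s = 0\<close>,
    so the final comparison has no prefactor.\<close>
  have 0: "C * P (\<lambda>_. 0) = 1"
  proof -
    have "(\<Prod>i<N. d i powr - \<alpha>) * (\<Prod>i<N. d i powr \<alpha>) = 1"
      unfolding prod.distrib[symmetric]
    proof (rule prod.neutral, rule ballI)
      fix i assume "i \<in> {..<N}"
      then have "0 < d i" using d(1) by simp
      then show "d i powr - \<alpha> * d i powr \<alpha> = 1" by (simp flip: powr_add)
    qed
    moreover have "gdet N T powr \<alpha> * gdet N T powr - \<alpha> = 1" using g0 by (simp flip: powr_add)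
    moreover have "C * P (\<lambda>_. 0) = (gdet N T powr \<alpha> * gdet N T powr - \<alpha>) * ((\<Prod>i<N. d i powr - \<alpha>) * (\<Prod>i<N. d i powr \<alpha>))"
      by (simp add: C_def P_def)
    ultimately show ?thesis by (simp only: mult_1)
  qed
  have "measure M {\<omega> \<in> space M. \<forall>i<N. Z i \<omega> \<le> b i} = expectation (indicat_real {\<omega> \<in> space M. \<forall>i<N. Z i \<omega> \<le> b i})"
    by (simp add: Int_def conj_commute)
  also have "\<dots> = expectation (\<lambda>\<omega>. (\<Prod>i<N. indicat_real {..b i} (Z i \<omega>)) * 1)"
  proof (rule Bochner_Integration.integral_cong[OF refl])
    fix \<omega> assume "\<omega> \<in> space M"
    then show "indicat_real {\<omega> \<in> space M. \<forall>i<N. Z i \<omega> \<le> b i} \<omega> = (\<Prod>i<N. indicat_real {..b i} (Z i \<omega>)) * 1"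
    proof (cases "\<forall>i<N. Z i \<omega> \<le> b i")
      case False
      then obtain i where "i < N" "indicat_real {..b i} (Z i \<omega>) = 0" by auto
      then have "(\<Prod>i<N. indicat_real {..b i} (Z i \<omega>)) = 0" by (intro prod_zero) auto
      then show ?thesis using False by simp
    qed simp
  qed
  also have "\<dots> \<le> C * P (\<lambda>_. 0) * (\<Prod>i<N. gexp \<alpha> (d i) (indicator {..b i}))"
    using b by (rule expectation_le_boxes)
  finally show ?thesis by (simp add: 0)
qed

text \<open>Eliminating an index from the inverse gives the inverse of the leading block of
  \<open>k\<close>, which is the kernel of the marginal law of the remaining coordinates.\<close>

lemma m_inverse_schur:
  assumes T: "m_inverse (Suc n) T k"
  shows "0 < T n n" "m_inverse n (\<lambda>i j. T i j - T i n * T n j / T n n) k"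
proof -
  have *: "0 < (\<Sum>l<Suc n. k i l)" "0 < (\<Sum>j<Suc n. T i j * (\<Sum>l<Suc n. k j l))" if "i \<le> n" for i
    using m_inverse_weight[OF T] m_inverse_row_sums[OF T] that by auto
  have off: "T i j \<le> 0" if "i \<le> n" "j \<le> n" "i \<noteq> j" for i j
    using T that by (simp add: m_inverse_def)
  show P: "0 < T n n"
    using schur_positive(1)[where n = n and M = T and v = "\<lambda>i. \<Sum>l<Suc n. k i l"] off * by blast
  have "T i j - T i n * T n j / T n n \<le> 0" if "i < n" "j < n" "i \<noteq> j" for i j
  proof -
    have "0 \<le> T i n * T n j / T n n"
      using off[of i n] off[of n j] that P by (intro divide_nonneg_pos mult_nonpos_nonpos) auto
    then show ?thesis using off[of i j] that by simp
  qed
  moreover have "(\<Sum>l<n. (T i l - T i n * T n l / T n n) * k l j) = (if i = j then 1 else 0)" if "i < n" "j < n" for i j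
  proof -
    have 1: "(\<Sum>l<n. T i l * k l j) = (if i = j then 1 else 0) - T i n * k n j"
      using T that by (auto simp: m_inverse_def eq_diff_eq)
    have 2: "(\<Sum>l<n. T n l * k l j) = - T n n * k n j"
      using T that by (auto simp: m_inverse_def eq_neg_iff_add_eq_0 dest: spec[of _ n])
    have "(\<Sum>l<n. (T i l - T i n * T n l / T n n) * k l j) = (\<Sum>l<n. T i l * k l j) - T i n / T n n * (\<Sum>l<n. T n l * k l j)"
    proof -
      have "(T i l - T i n * T n l / T n n) * k l j = T i l * k l j - T i n / T n n * (T n l * k l j)" for l
        by (simp add: left_diff_distrib)
      then show ?thesis by (simp only: sum_subtractf sum_distrib_left)
    qed
    also have "\<dots> = (if i = j then 1 else 0)" unfolding 1 2 using P by simp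
    finally show ?thesis .
  qed
  ultimately show "m_inverse n (\<lambda>i j. T i j - T i n * T n j / T n n) k"
    using T by (auto simp: m_inverse_def)
qed

text \<open>Conditionally on \<open>Z\<^sub>0, \<dots>, Z\<^sub>m\<close>, the variable \<open>Z\<^sub>m\<^sub>+\<^sub>1\<close> is, in Laplace transform order, at
  least as large as a squared Bessel transition started from \<open>Z\<^sub>m\<close>.\<close>

lemma permanental_vector_upper:
  assumes Z: "permanental_vector M \<alpha> (Suc (Suc m)) k Z" and Z': "permanental_vector M \<alpha> (Suc m) k Z"
    and \<alpha>: "0 < \<alpha>" and T: "m_inverse (Suc (Suc m)) T k"
    and n: "n = Suc m" and s0: "0 < s0" and s1: "0 \<le> s1" "s1 \<le> T m n * T n m * (s0 / (T n n * (T n n + s0)))"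
    and b: "\<And>i. i \<le> m \<Longrightarrow> 0 \<le> b i"
  shows "0 \<le> prob_space.expectation M (\<lambda>\<omega>. indicator {\<omega>. (\<forall>i<m. Z i \<omega> \<le> b i) \<and> b m < Z m \<omega>} \<omega> *
    (exp (- s1 * Z m \<omega>) - exp (- s0 * Z n \<omega>)))"
proof -
  interpret prob_space M using Z by (simp add: permanental_vector_def)
  \<comment> \<open>\<open>\<kappa>\<close> is \<open>1 / T n n - 1 / (T n n + s0)\<close>. The
    matrix \<open>T'\<close> belongs to the law of the first \<open>n\<close> coordinates and
    \<open>T1\<close> to the same law weighted by \<open>exp (- s0 * Z n)\<close>; \<open>c\<close>
    is the corresponding power of the ratio of their last pivots.\<close>
  define \<kappa> where "\<kappa> = s0 / (T n n * (T n n + s0))"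
  define T' where "T' i j = T i j - T i n * T n j / T n n" for i j
  define T1 where "T1 i j = T i j - T i n * T n j / (T n n + s0)" for i j
  define c where "c = ((T n n + s0) / T n n) powr - \<alpha>"
  have P: "0 < T n n" and T': "m_inverse n T' k"
    using m_inverse_schur[of n T k] T by (simp_all add: T'_def[abs_def] n)
  have \<kappa>: "T1 i j = T' i j + T i n * T n j * \<kappa>" for i j
  proof -
    have "T i n * T n j / T n n - T i n * T n j / (T n n + s0) = T i n * T n j * \<kappa>"
      using P s0 unfolding \<kappa>_def by (simp add: field_simps)
    then show ?thesis by (simp add: T1_def T'_def)
  qed
  have \<kappa>0: "0 \<le> \<kappa>" unfolding \<kappa>_def using P s0 by simp
  have TT: "0 \<le> T i n * T n j * \<kappa>" if "i < n" "j < n" for i j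
    using T that \<kappa>0 by (intro mult_nonneg_nonneg mult_nonpos_nonpos) (auto simp: m_inverse_def n)
  have T1off: "T1 i j \<le> 0" if "i < n" "j < n" "i \<noteq> j" for i j
  proof -
    have "0 \<le> T i n * T n j / (T n n + s0)"
      using T that P s0 by (intro divide_nonneg_pos mult_nonpos_nonpos) (auto simp: m_inverse_def n)
    moreover have "T i j \<le> 0" using T that by (simp add: m_inverse_def n)
    ultimately show ?thesis by (simp add: T1_def)
  qed
  \<comment> \<open>With the diagonal of \<open>T1\<close> as rates, the weighted law has zero
    diagonal in \<open>ql\<close>. On the other side the slack at \<open>m\<close> is
    \<open>T m n * T n m * \<kappa> - s1\<close>, and the hypothesis on \<open>s1\<close> says that
    it is nonnegative.\<close>
  define d where "d i = T1 i i" for i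
  have d: "0 < d i" if "i < n" for i
  proof -
    have "0 < T' i i"
    proof -
      have "(\<Sum>j<n. T' i j * (\<Sum>l<n. k j l)) = T' i i * (\<Sum>l<n. k i l) + (\<Sum>j\<in>{..<n} - {i}. T' i j * (\<Sum>l<n. k j l))"
        using that by (subst sum.remove[of _ i]) auto
      moreover have "(\<Sum>j\<in>{..<n} - {i}. T' i j * (\<Sum>l<n. k j l)) \<le> 0"
        using T' that m_inverse_weight[OF T'] by (intro sum_nonpos mult_nonpos_nonneg) (auto simp: m_inverse_def less_imp_le)
      ultimately have "0 < T' i i * (\<Sum>l<n. k i l)" using m_inverse_row_sums[OF T' that] by linarith
      then show ?thesis using m_inverse_weight[OF T' that] by (simp add: zero_less_mult_iff)
    qed
    then show ?thesis using TT[OF that that] by (simp add: d_def \<kappa>)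
  qed
  define sh where "sh s i = s i + (if i = m then s1 else 0)" for s :: "nat \<Rightarrow> real" and i
  define ql where "ql i j = (\<lambda>s::nat \<Rightarrow> real. if i = j then 0 else - T1 i j)" for i j
  define qr where "qr i j = (\<lambda>s::nat \<Rightarrow> real. if i = j then d i - T' i i - (if i = m then s1 else 0) else - T' i j)" for i j
  have Ml: "(\<lambda>i j. (if i = j then d i + s i else 0) - ql i j s) = diag_shift T1 s" for s
    by (intro ext) (simp add: ql_def d_def)
  have Mr: "(\<lambda>i j. (if i = j then d i + s i else 0) - qr i j s) = diag_shift T' (sh s)" for s
    by (intro ext) (simp add: qr_def sh_def)
  define PL where "PL s = gdet n (diag_shift T1 s) powr - \<alpha> * (\<Prod>i<n. (d i + s i) powr \<alpha>)" for s
  define PR where "PR s = gdet n (diag_shift T' (sh s)) powr - \<alpha> * (\<Prod>i<n. (d i + s i) powr \<alpha>)" for s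
  have le: "cone_le n d PL PR"
    unfolding PL_def PR_def Ml[symmetric] Mr[symmetric]
  proof (rule gdet_cone_le[OF d \<alpha> order_refl, where v = "\<lambda>j. \<Sum>l<n. k j l"])
    show "cone_le n d (ql i j) (qr i j)" if "i < n" "j < n" for i j
    proof -
      have "0 \<le> (if i = j then 0 else - T1 i j)" using T1off that by simp
      moreover have "0 \<le> (if i = j then d i - T' i i - (if i = m then s1 else 0) else - T' i j) - (if i = j then 0 else - T1 i j)"
        using TT[OF that] s1 by (auto simp: \<kappa> d_def \<kappa>_def)
      ultimately show ?thesis
        unfolding cone_le_def ql_def qr_def by (intro conjI gamma_cone_const)
    qed
    show "0 < (\<Sum>j<n. ((if i = j then d i + s i else 0) - qr i j s) * (\<Sum>l<n. k j l))"
      if "s \<in> nonneg_pts n" "i < n" for s i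
      using fun_cong[OF fun_cong[OF Mr[of s]], of i] diag_shift_weight[OF T' that(2), of "sh s"] that s1
      by (simp add: nonneg_pts_def sh_def)
  qed (use m_inverse_weight[OF T'] in auto)
  have "1 \<le> (T n n + s0) / T n n" using P s0 by simp
  then have c: "0 \<le> c" "c \<le> 1"
    using powr_mono2'[of "- \<alpha>" 1 "(T n n + s0) / T n n"] \<alpha> by (auto simp: c_def)
  define C where "C = gdet n T' powr \<alpha> * (\<Prod>i<n. d i powr - \<alpha>)"
  have C: "0 \<le> C" by (auto simp: C_def intro!: mult_nonneg_nonneg prod_nonneg)
  have "(\<lambda>s. (PR s - PL s) + (1 - c) * PL s) \<in> gamma_cone n d"
    using le c by (intro gamma_cone.add gamma_cone.scale) (auto simp: cone_le_def)
  then have "(\<lambda>s. C * ((PR s - PL s) + (1 - c) * PL s)) \<in> gamma_cone n d"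
    by (rule gamma_cone.scale[OF C])
  then have cone: "(\<lambda>s. C * (PR s - c * PL s)) \<in> gamma_cone n d"
    by (simp add: algebra_simps)
  have meas: "Z i \<in> borel_measurable M" "\<omega> \<in> space M \<Longrightarrow> 0 \<le> Z i \<omega>" if "i \<le> n" for i \<omega>
    using Z that by (auto simp: permanental_vector_def n less_Suc_eq_le)
  have [measurable]: "Z m \<in> borel_measurable M" "Z n \<in> borel_measurable M" using meas by (auto simp: n)
  define X where "X \<omega> = exp (- s1 * Z m \<omega>) - exp (- s0 * Z n \<omega>)" for \<omega>
  have Xb: "\<bar>X \<omega>\<bar> \<le> 1" if "\<omega> \<in> space M" for \<omega>
  proof -
    have "exp (- s1 * Z m \<omega>) \<le> 1" "exp (- s0 * Z n \<omega>) \<le> 1"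
      using meas(2)[of m \<omega>] meas(2)[of n \<omega>] that s0 s1 by (auto simp: n)
    moreover have "0 \<le> exp (- s1 * Z m \<omega>)" "0 \<le> exp (- s0 * Z n \<omega>)" by simp_all
    ultimately show ?thesis unfolding X_def abs_le_iff by linarith
  qed
  interpret laplace_family M n Z d \<alpha> X "\<lambda>s. C * (PR s - c * PL s)"
  proof unfold_locales
    fix s :: "nat \<Rightarrow> real" assume s: "\<And>i. i < n \<Longrightarrow> 0 < s i"
    have pr: "(\<Prod>i<n. (d i / (d i + s i)) powr \<alpha>) * ((\<Prod>i<n. d i powr - \<alpha>) * (\<Prod>i<n. (d i + s i) powr \<alpha>)) = 1"
      unfolding prod.distrib[symmetric]
    proof (rule prod.neutral, rule ballI)
      fix i assume "i \<in> {..<n}"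
      then have "0 < d i" "0 < s i" using d s by auto
      then show "(d i / (d i + s i)) powr \<alpha> * (d i powr - \<alpha> * (d i + s i) powr \<alpha>) = 1"
        by (simp add: powr_divide powr_minus field_simps)
    qed
    have R: "expectation (\<lambda>\<omega>. exp (- (\<Sum>i<n. s i * Z i \<omega>)) * exp (- s1 * Z m \<omega>))
      = gdet n T' powr \<alpha> * gdet n (diag_shift T' (sh s)) powr - \<alpha>"
    proof -
      have "(\<Sum>i<n. sh s i * Z i \<omega>) = (\<Sum>i<n. s i * Z i \<omega>) + s1 * Z m \<omega>" for \<omega>
        by (simp add: sh_def n distrib_right)
      then have "exp (- (\<Sum>i<n. s i * Z i \<omega>)) * exp (- s1 * Z m \<omega>) = exp (- (\<Sum>i<n. sh s i * Z i \<omega>))" for \<omega>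
        by (simp flip: exp_add)
      moreover have "0 < sh s i" if "i < n" for i using s[OF that] s1 by (simp add: sh_def add_pos_nonneg)
      ultimately show ?thesis
        using permanental_vector_laplace[where s = "sh s", OF Z'[folded n] T'] by simp
    qed
    have L: "expectation (\<lambda>\<omega>. exp (- (\<Sum>i<n. s i * Z i \<omega>)) * exp (- s0 * Z n \<omega>))
      = c * (gdet n T' powr \<alpha> * gdet n (diag_shift T1 s) powr - \<alpha>)"
    proof -
      define r where "r i = (if i = n then s0 else s i)" for i
      have r0: "0 < r i" if "i < Suc n" for i using s[of i] s0 that by (auto simp: r_def)
      have "(\<Sum>i<Suc n. r i * Z i \<omega>) = (\<Sum>i<n. s i * Z i \<omega>) + s0 * Z n \<omega>" for \<omega>
        by (simp add: r_def)
      then have "expectation (\<lambda>\<omega>. exp (- (\<Sum>i<n. s i * Z i \<omega>)) * exp (- s0 * Z n \<omega>))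
        = expectation (\<lambda>\<omega>. exp (- (\<Sum>i<Suc n. r i * Z i \<omega>)))"
        by (simp flip: exp_add)
      also have "\<dots> = gdet (Suc n) T powr \<alpha> * gdet (Suc n) (diag_shift T r) powr - \<alpha>"
        using permanental_vector_laplace[where s = r, OF Z[folded n] T[folded n], OF r0] by simp
      also have "gdet (Suc n) T = T n n * gdet n T'"
        by (simp add: T'_def[abs_def])
      also have "gdet (Suc n) (diag_shift T r) = (T n n + s0) * gdet n (diag_shift T1 s)"
      proof -
        have "gdet n (\<lambda>i j. diag_shift T r i j - diag_shift T r i n * diag_shift T r n j / diag_shift T r n n)
          = gdet n (diag_shift T1 s)"
          by (rule gdet_cong) (simp add: r_def T1_def)
        then show ?thesis by (simp add: r_def)
      qed
      also have "(T n n * gdet n T') powr \<alpha> * ((T n n + s0) * gdet n (diag_shift T1 s)) powr - \<alpha>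
        = c * (gdet n T' powr \<alpha> * gdet n (diag_shift T1 s) powr - \<alpha>)"
        using P s0 by (simp only: powr_mult c_def powr_divide) (simp add: powr_minus field_simps)
      finally show ?thesis .
    qed
    have int: "integrable M (\<lambda>\<omega>. exp (- (\<Sum>i<n. s i * Z i \<omega>)) * exp (- t * Z j \<omega>))" if "0 \<le> t" "j \<le> n" for t j
    proof (rule integrable_const_bound[where B = 1])
      show "AE \<omega> in M. norm (exp (- (\<Sum>i<n. s i * Z i \<omega>)) * exp (- t * Z j \<omega>)) \<le> 1"
      proof (rule AE_I2)
        fix \<omega> assume \<omega>: "\<omega> \<in> space M"
        have "0 \<le> (\<Sum>i<n. s i * Z i \<omega>)" using meas(2)[OF _ \<omega>] s by (intro sum_nonneg) (auto simp: less_imp_le)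
        then show "norm (exp (- (\<Sum>i<n. s i * Z i \<omega>)) * exp (- t * Z j \<omega>)) \<le> 1"
          using meas(2)[OF that(2) \<omega>] that by (simp add: mult_le_one)
      qed
      show "(\<lambda>\<omega>. exp (- (\<Sum>i<n. s i * Z i \<omega>)) * exp (- t * Z j \<omega>)) \<in> borel_measurable M"
        using meas(1) that by (intro borel_measurable_times borel_measurable_exp borel_measurable_uminus borel_measurable_sum borel_measurable_const) auto
    qed
    have "expectation (\<lambda>\<omega>. exp (- (\<Sum>i<n. s i * Z i \<omega>)) * X \<omega>)
      = gdet n T' powr \<alpha> * gdet n (diag_shift T' (sh s)) powr - \<alpha> - c * (gdet n T' powr \<alpha> * gdet n (diag_shift T1 s) powr - \<alpha>)"
    proof -
      have "integrable M (\<lambda>\<omega>. exp (- (\<Sum>i<n. s i * Z i \<omega>)) * exp (- s1 * Z m \<omega>))"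
        "integrable M (\<lambda>\<omega>. exp (- (\<Sum>i<n. s i * Z i \<omega>)) * exp (- s0 * Z n \<omega>))"
        by (rule int; use s0 s1(1) n in simp)+
      from Bochner_Integration.integral_diff[OF this] show ?thesis
        unfolding X_def right_diff_distrib R L .
    qed
    also have "\<dots> = (\<Prod>i<n. (d i / (d i + s i)) powr \<alpha>) * (C * (PR s - c * PL s))"
    proof -
      have "(\<Prod>i<n. (d i / (d i + s i)) powr \<alpha>) * (C * (PR s - c * PL s))
        = ((\<Prod>i<n. (d i / (d i + s i)) powr \<alpha>) * ((\<Prod>i<n. d i powr - \<alpha>) * (\<Prod>i<n. (d i + s i) powr \<alpha>))) *
          (gdet n T' powr \<alpha> * gdet n (diag_shift T' (sh s)) powr - \<alpha> - c * (gdet n T' powr \<alpha> * gdet n (diag_shift T1 s) powr - \<alpha>))"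
        unfolding C_def PR_def PL_def by (simp only: algebra_simps)
      then show ?thesis by (simp only: pr mult_1_left)
    qed
    finally show "expectation (\<lambda>\<omega>. exp (- (\<Sum>i<n. s i * Z i \<omega>)) * X \<omega>) = (\<Prod>i<n. (d i / (d i + s i)) powr \<alpha>) * (C * (PR s - c * PL s))" .
  next
    show "X \<in> borel_measurable M" unfolding X_def by measurable
  qed (use meas d \<alpha> cone Xb in auto)
  \<comment> \<open>Boxes are bounded above, so coordinate \<open>m\<close> is first confined to
    values above \<open>b m\<close> and at most \<open>r\<close>. Letting \<open>r\<close> tend to
    infinity recovers the event.\<close>
  define G where "G r \<omega> = (\<Prod>i<n. indicat_real {..if i = m then r else b i} (Z i \<omega>) - (if i = m then 1 else 0) * indicat_real {..b i} (Z i \<omega>)) * X \<omega>" for r \<omega>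
  have G: "0 \<le> expectation (G (b m + real r))" for r
    unfolding G_def by (rule expectation_nonneg_boxes) (use b in \<open>auto simp: n\<close>)
  have Geq: "G r \<omega> = indicat_real {\<omega>. (\<forall>i<m. Z i \<omega> \<le> b i) \<and> b m < Z m \<omega> \<and> Z m \<omega> \<le> r} \<omega> * X \<omega>" if "b m \<le> r" for r \<omega>
    using that by (auto simp: G_def n indicator_def)
  have "(\<lambda>r. expectation (G (b m + real r))) \<longlonglongrightarrow> expectation (\<lambda>\<omega>. indicat_real {\<omega>. (\<forall>i<m. Z i \<omega> \<le> b i) \<and> b m < Z m \<omega>} \<omega> * X \<omega>)"
  proof (rule integral_dominated_convergence[where w = "\<lambda>_. 1"])
    have ind: "(\<lambda>\<omega>. indicat_real A (Z i \<omega>)) \<in> borel_measurable M" if "i \<le> n" "A \<in> sets borel" for i A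
      by (rule measurable_compose[OF meas(1)[OF that(1)] borel_measurable_indicator[OF that(2)]])
    have "(\<lambda>\<omega>. (\<Prod>i<m. indicat_real {..b i} (Z i \<omega>)) * indicat_real {b m<..} (Z m \<omega>) * X \<omega>) \<in> borel_measurable M"
      by (intro borel_measurable_times borel_measurable_prod X_meas ind) (auto simp: n)
    also have "(\<lambda>\<omega>. (\<Prod>i<m. indicat_real {..b i} (Z i \<omega>)) * indicat_real {b m<..} (Z m \<omega>) * X \<omega>)
       = (\<lambda>\<omega>. indicat_real {\<omega>. (\<forall>i<m. Z i \<omega> \<le> b i) \<and> b m < Z m \<omega>} \<omega> * X \<omega>)"
      by (auto simp: fun_eq_iff indicator_def)
    finally show "(\<lambda>\<omega>. indicat_real {\<omega>. (\<forall>i<m. Z i \<omega> \<le> b i) \<and> b m < Z m \<omega>} \<omega> * X \<omega>) \<in> borel_measurable M" .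
    show "G (b m + real r) \<in> borel_measurable M" for r
      unfolding G_def
      by (intro borel_measurable_times borel_measurable_prod borel_measurable_diff X_meas borel_measurable_const ind) auto
    show "AE \<omega> in M. (\<lambda>r. G (b m + real r) \<omega>) \<longlonglongrightarrow> indicat_real {\<omega>. (\<forall>i<m. Z i \<omega> \<le> b i) \<and> b m < Z m \<omega>} \<omega> * X \<omega>"
    proof (rule AE_I2, rule tendsto_eventually)
      fix \<omega>
      obtain r0 :: nat where "Z m \<omega> - b m \<le> real r0" using real_arch_simple by blast
      then have "G (b m + real r) \<omega> = indicat_real {\<omega>. (\<forall>i<m. Z i \<omega> \<le> b i) \<and> b m < Z m \<omega>} \<omega> * X \<omega>" if "r0 \<le> r" for r
        using that by (subst Geq) (auto simp: indicator_def)
      then show "\<forall>\<^sub>F r in sequentially. G (b m + real r) \<omega> = indicat_real {\<omega>. (\<forall>i<m. Z i \<omega> \<le> b i) \<and> b m < Z m \<omega>} \<omega> * X \<omega>"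
        by (rule eventually_sequentiallyI)
    qed
    show "AE \<omega> in M. norm (G (b m + real r) \<omega>) \<le> 1" for r
      using Xb by (intro AE_I2) (subst Geq, auto simp: indicator_def)
  qed (intro integrable_const)
  then have "0 \<le> expectation (\<lambda>\<omega>. indicat_real {\<omega>. (\<forall>i<m. Z i \<omega> \<le> b i) \<and> b m < Z m \<omega>} \<omega> * X \<omega>)"
    by (rule LIMSEQ_le_const) (use G in blast)
  then show ?thesis by (simp add: X_def)
qed

section \<open>The autoregressive covariance in its natural scale\<close>

locale ar_weights =
  fixes x :: "nat \<Rightarrow> real"
  assumes mono: "mono_on {1..} x" and bounds: "\<And>j. 1 \<le> j \<Longrightarrow> 0 < x j \<and> x j \<le> 1"
begin

abbreviation V :: "nat \<Rightarrow> real" where "V j \<equiv> ar_cov x j j"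
abbreviation b :: "nat \<Rightarrow> real" where "b \<equiv> ar_b x"

text \<open>The clock of the underlying random walk: \<open>b n\<close> times the autoregressive
  variable at \<open>n\<close> is the sum of independent centred Gaussian steps with variances
  \<open>(b i)\<^sup>2\<close>, because \<open>b n * x (n - 1) = b (n - 1)\<close>.\<close>

definition A :: "nat \<Rightarrow> real" where "A j = (\<Sum>i=1..j. (b i)\<^sup>2)"

lemma b_pos: "0 < b j"
  unfolding ar_b_def using bounds by (intro prod_pos) auto

lemma b_Suc: "1 \<le> j \<Longrightarrow> b (Suc j) = b j / x j"
  by (simp add: ar_b_def divide_inverse)

lemma b_1: "b (Suc 0) = 1" by (simp add: ar_b_def)

lemma b_mono:
  assumes "1 \<le> i" "i \<le> j"
  shows "b i \<le> b j"
  using assms(2)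
proof (induction j rule: dec_induct)
  case (step j)
  have "b j \<le> b (Suc j)"
    using bounds[of j] b_pos[of j] step assms(1) by (simp add: b_Suc le_divide_eq mult_left_le)
  then show ?case using step by simp
qed simp

lemma b_ge_1: "1 \<le> j \<Longrightarrow> 1 \<le> b j"
  using b_mono[of 1 j] by (simp add: b_1)

lemma prod_x:
  assumes "1 \<le> i" "i \<le> j"
  shows "(\<Prod>l=i..<j. x l) = b i / b j"
  using assms(2)
proof (induction j rule: dec_induct)
  case base
  then show ?case using b_pos[of i] by simp
next
  case (step j)
  then show ?case using bounds[of j] b_pos[of j] assms(1) by (simp add: b_Suc)
qed

lemma A_0: "A 0 = 0" by (simp add: A_def)

lemma A_Suc: "A (Suc j) = A j + (b (Suc j))\<^sup>2" by (simp add: A_def)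

lemma A_strict_mono: "i < j \<Longrightarrow> A i < A j"
proof (rule strict_monoD[OF strict_monoI_Suc])
  show "A n < A (Suc n)" for n using b_pos[of "Suc n"] by (simp add: A_Suc)
qed

lemma A_ge: "real j \<le> A j"
proof (induction j)
  case (Suc j)
  have "1 \<le> (b (Suc j))\<^sup>2" using b_ge_1[of "Suc j"] by (simp add: one_le_power)
  then show ?case using Suc by (simp add: A_Suc)
qed (simp add: A_0)

lemma ar_cov_eq:
  assumes "1 \<le> j" "1 \<le> k"
  shows "ar_cov x j k = A (min j k) / (b j * b k)"
proof -
  have "ar_cov x j k = (\<Sum>i=1..min j k. (b i)\<^sup>2 / (b j * b k))"
    unfolding ar_cov_def using assms by (intro sum.cong) (auto simp: prod_x power2_eq_square)
  then show ?thesis by (simp add: A_def sum_divide_distrib)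
qed

lemma V_eq: "1 \<le> j \<Longrightarrow> V j = A j / (b j)\<^sup>2"
  by (simp add: ar_cov_eq power2_eq_square)

lemma V_b: "1 \<le> j \<Longrightarrow> V j * (b j)\<^sup>2 = A j"
  using b_pos[of j] by (simp add: V_eq)

lemma V_Suc: "1 \<le> j \<Longrightarrow> V (Suc j) = 1 + (x j)\<^sup>2 * V j"
  using b_pos[of j] b_pos[of "Suc j"] bounds[of j]
  by (simp add: V_eq A_Suc b_Suc field_simps power_divide)

lemma V_1: "V (Suc 0) = 1" by (simp add: V_eq A_Suc A_0 b_1)

text \<open>The recursion \<open>V_Suc\<close> passes an increase of \<open>V\<close> on to the next
  index because \<open>x\<close> increases as well; nonnegativity is carried along in the
  induction.\<close>

lemma V_mono:
  assumes "1 \<le> i" "i \<le> j"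
  shows "V i \<le> V j"
proof -
  have "V j \<le> V (Suc j) \<and> 0 \<le> V j" if "1 \<le> j" for j
    using that
  proof (induction j rule: nat_induct_at_least)
    case base
    then show ?case using bounds[of 1] by (simp add: V_Suc V_1)
  next
    case (Suc j)
    have "x j \<le> x (Suc j)" using mono Suc by (auto simp: mono_on_def)
    then have "(x j)\<^sup>2 * V j \<le> (x (Suc j))\<^sup>2 * V (Suc j)"
      using Suc bounds[of j] by (intro mult_mono power_mono) auto
    then show ?case using Suc by (simp add: V_Suc)
  qed
  then have step: "V j \<le> V (Suc j)" if "1 \<le> j" for j using that by blast
  show ?thesis using assms(2)
  proof (induction j rule: dec_induct)
    case (step j)
    then show ?case using \<open>\<And>j. 1 \<le> j \<Longrightarrow> V j \<le> V (Suc j)\<close>[of j] assms(1) by linarith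
  qed simp
qed

lemma V_ge_1: "1 \<le> j \<Longrightarrow> 1 \<le> V j"
  using V_mono[of 1 j] by (simp add: V_1)

lemma A_pos: "1 \<le> n \<Longrightarrow> 0 < A n"
  using A_strict_mono[of 0 n] by (simp add: A_0)

definition LL :: "nat \<Rightarrow> real" where "LL j = ln (ln (A j))"

lemma A_at_top: "filterlim A at_top sequentially"
  by (rule filterlim_at_top_mono[OF filterlim_real_sequentially]) (simp add: A_ge)

lemma LL_at_top: "filterlim LL at_top sequentially"
  unfolding LL_def[abs_def]
  by (intro filterlim_compose[OF ln_at_top] A_at_top)

text \<open>The newest summand of \<open>A (Suc n)\<close> is
  \<open>(b n)\<^sup>2 / (x n)\<^sup>2\<close>, and \<open>(b n)\<^sup>2\<close> is at most
  \<open>A n\<close>. Hence \<open>A\<close> overshoots a geometric level by at most a fixed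
  factor.\<close>

lemma A_ratio:
  assumes "1 \<le> n"
  shows "A (Suc n) \<le> (1 + 1 / (x 1)\<^sup>2) * A n"
proof -
  have x: "0 < x 1" "x 1 \<le> x n" using bounds[of 1] mono assms by (auto simp: mono_on_def)
  have "(b (Suc n))\<^sup>2 = (b n)\<^sup>2 / (x n)\<^sup>2" using assms by (simp add: b_Suc power_divide)
  also have "\<dots> \<le> A n / (x 1)\<^sup>2"
  proof (rule frac_le)
    show "(b n)\<^sup>2 \<le> A n"
      using V_b[OF assms] mult_right_mono[OF V_ge_1[OF assms], of "(b n)\<^sup>2"] by simp
    show "(x 1)\<^sup>2 \<le> (x n)\<^sup>2" using x by (intro power_mono) auto
  qed (use x A_pos[OF assms] in auto)
  finally show ?thesis by (simp add: A_Suc distrib_right)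
qed

section \<open>Limits of \<open>x\<close> and \<open>V\<close>\<close>

lemma x_convergent: obtains L where "x \<longlonglongrightarrow> L" "0 < L" "L \<le> 1"
proof -
  have inc: "incseq (\<lambda>j. x (Suc j))" using mono by (auto simp: incseq_def mono_on_def)
  obtain L where L: "(\<lambda>j. x (Suc j)) \<longlonglongrightarrow> L" "\<And>j. x (Suc j) \<le> L"
    using incseq_convergent[OF inc, of 1] bounds by (metis le_add1 plus_1_eq_Suc)
  have "x \<longlonglongrightarrow> L" using L(1) by (rule LIMSEQ_imp_Suc)
  moreover have "0 < L" using L(2)[of 0] bounds[of 1] by simp
  moreover have "L \<le> 1" by (rule LIMSEQ_le_const2[OF L(1)]) (use bounds in auto)
  ultimately show thesis by (rule that)
qed

lemma x_le_lim: assumes "x \<longlonglongrightarrow> L" "1 \<le> j" shows "x j \<le> L"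
  by (rule LIMSEQ_le_const[OF assms(1)]) (use mono assms in \<open>auto simp: mono_on_def intro!: exI[of _ j]\<close>)

text \<open>\<open>V\<close> increases, so it converges or diverges. A finite limit \<open>v\<close>
  satisfies \<open>v = 1 + L\<^sup>2 * v\<close>, which is impossible for \<open>L = 1\<close> and
  has a single solution for \<open>0 < L < 1\<close>.\<close>

lemma V_limit:
  assumes L: "x \<longlonglongrightarrow> L"
  shows "L = 1 \<Longrightarrow> filterlim V at_top sequentially"
    and "L < 1 \<Longrightarrow> 0 < L \<Longrightarrow> V \<longlonglongrightarrow> 1 / (1 - L\<^sup>2)"
proof -
  have inc: "incseq (\<lambda>j. V (Suc j))" by (auto simp: incseq_def intro: V_mono)
  have conv: "v = 1 + L\<^sup>2 * v" if "V \<longlonglongrightarrow> v" for v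
  proof (rule LIMSEQ_unique)
    show "(\<lambda>j. V (Suc (Suc j))) \<longlonglongrightarrow> v" using that by (intro LIMSEQ_Suc)
    have "(\<lambda>j. 1 + (x (Suc j))\<^sup>2 * V (Suc j)) \<longlonglongrightarrow> 1 + L\<^sup>2 * v"
      using LIMSEQ_Suc[OF L] LIMSEQ_Suc[OF that] by (intro tendsto_intros)
    then show "(\<lambda>j. V (Suc (Suc j))) \<longlonglongrightarrow> 1 + L\<^sup>2 * v" by (simp add: V_Suc)
  qed
  show "filterlim V at_top sequentially" if "L = 1"
  proof (rule ccontr)
    assume "\<not> filterlim V at_top sequentially"
    then have "\<not> filterlim (\<lambda>j. V (Suc j)) at_top sequentially"
      using filterlim_sequentially_Suc[of V at_top] by simp
    then obtain B where "\<not> (\<exists>N. \<forall>j\<ge>N. B \<le> V (Suc j))"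
      by (auto simp: filterlim_at_top eventually_sequentially)
    then have ex: "\<exists>j\<ge>N. V (Suc j) < B" for N by (auto simp: not_le)
    have "V (Suc j) \<le> B" for j
    proof -
      obtain i where "j \<le> i" "V (Suc i) < B" using ex by blast
      then show ?thesis using V_mono[of "Suc j" "Suc i"] by simp
    qed
    from incseq_convergent[OF inc, of B] this obtain v where "(\<lambda>j. V (Suc j)) \<longlonglongrightarrow> v" by blast
    then have "V \<longlonglongrightarrow> v" by (rule LIMSEQ_imp_Suc)
    from conv[OF this] that show False by simp
  qed
  show "V \<longlonglongrightarrow> 1 / (1 - L\<^sup>2)" if "L < 1" "0 < L"
  proof -
    have L2: "L\<^sup>2 < 1" using that by (simp add: power_less_one_iff abs_square_less_1)
    have "V (Suc j) \<le> 1 / (1 - L\<^sup>2)" for j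
    proof (induction j)
      case 0
      then show ?case using L2 by (simp add: V_1)
    next
      case (Suc j)
      have "(x (Suc j))\<^sup>2 * V (Suc j) \<le> L\<^sup>2 * (1 / (1 - L\<^sup>2))"
        using Suc x_le_lim[OF L, of "Suc j"] bounds[of "Suc j"] V_ge_1[of "Suc j"]
        by (intro mult_mono power_mono) auto
      then show ?case using L2 by (simp add: V_Suc field_simps)
    qed
    from incseq_convergent[OF inc, of "1 / (1 - L\<^sup>2)"] this obtain v where "(\<lambda>j. V (Suc j)) \<longlonglongrightarrow> v" by blast
    then have v: "V \<longlonglongrightarrow> v" by (rule LIMSEQ_imp_Suc)
    from conv[OF this] have "v = 1 / (1 - L\<^sup>2)" using L2 by (simp add: field_simps)
    with v show ?thesis by simp
  qed
qed

lemma V_at_top_iff: "filterlim V at_top sequentially \<longleftrightarrow> x \<longlonglongrightarrow> 1"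
proof
  assume top: "filterlim V at_top sequentially"
  obtain L where L: "x \<longlonglongrightarrow> L" "0 < L" "L \<le> 1" by (rule x_convergent)
  have "\<not> L < 1"
    using V_limit(2)[OF L(1)] L(2) not_tendsto_and_filterlim_at_infinity[of sequentially V "1 / (1 - L\<^sup>2)"] top
    by (auto intro: filterlim_at_top_imp_at_infinity)
  then show "x \<longlonglongrightarrow> 1" using L by simp
qed (rule V_limit(1), auto)

lemma V_tendsto_iff:
  assumes "0 < \<delta>" "\<delta> < 1"
  shows "V \<longlonglongrightarrow> 1 / (1 - \<delta>\<^sup>2) \<longleftrightarrow> x \<longlonglongrightarrow> \<delta>"
proof
  assume V: "V \<longlonglongrightarrow> 1 / (1 - \<delta>\<^sup>2)"
  obtain L where L: "x \<longlonglongrightarrow> L" "0 < L" "L \<le> 1" by (rule x_convergent)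
  have "L \<noteq> 1"
    using V_limit(1)[OF L(1)] V not_tendsto_and_filterlim_at_infinity[of sequentially V "1 / (1 - \<delta>\<^sup>2)"]
    by (auto intro: filterlim_at_top_imp_at_infinity)
  then have "L < 1" using L by simp
  then have "1 / (1 - L\<^sup>2) = 1 / (1 - \<delta>\<^sup>2)"
    using V_limit(2)[OF L(1)] L(2) V LIMSEQ_unique by blast
  moreover have "L\<^sup>2 < 1" "\<delta>\<^sup>2 < 1" using \<open>L < 1\<close> L(2) assms by (auto simp: abs_square_less_1)
  ultimately have "L\<^sup>2 = \<delta>\<^sup>2" by (simp add: field_simps)
  then have "L = \<delta>" using L(2) assms by (simp add: power2_eq_iff_nonneg)
  then show "x \<longlonglongrightarrow> \<delta>" using L by simp
qed (use V_limit(2) assms in auto)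

text \<open>Rescaled by \<open>b\<close>, a function is excessive exactly if it is a concave function of \<open>A\<close>; the
  \<open>slope f j\<close> is its slope between \<open>j - 1\<close> and \<open>j\<close> (with value \<open>0\<close> at index \<open>0\<close>), and \<open>gen f j\<close> is
  the value at \<open>j\<close> of the inverse of \<open>ar_cov x\<close> applied to \<open>f\<close>.\<close>

definition gen :: "(nat \<Rightarrow> real) \<Rightarrow> nat \<Rightarrow> real" where
  "gen f j = (1 + (x j)\<^sup>2) * f j - x j * f (Suc j) - (if j = 1 then 0 else x (j - 1) * f (j - 1))"

definition slope :: "(nat \<Rightarrow> real) \<Rightarrow> nat \<Rightarrow> real" where
  "slope f j = (if j = 1 then f 1 else (f j - x (j - 1) * f (j - 1)) / b j)"

lemma slope_diff: "1 \<le> j \<Longrightarrow> gen f j = b j * (slope f j - slope f (Suc j))"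
proof -
  assume j: "1 \<le> j"
  have "b j * slope f j = f j - (if j = 1 then 0 else x (j - 1) * f (j - 1))"
    using b_pos[of j] by (auto simp: slope_def b_1)
  moreover have "b j * slope f (Suc j) = x j * f (Suc j) - (x j)\<^sup>2 * f j"
    using j b_pos[of j] bounds[of j] by (simp add: slope_def b_Suc field_simps power2_eq_square)
  ultimately show ?thesis by (simp add: gen_def algebra_simps)
qed

text \<open>The value \<open>0\<close> at index \<open>0\<close>, where \<open>A\<close> vanishes
  too, makes the first slope an ordinary difference quotient.\<close>

definition scaled :: "(nat \<Rightarrow> real) \<Rightarrow> nat \<Rightarrow> real" where
  "scaled f j = (if j = 0 then 0 else b j * f j)"

lemma scaled_Suc: "scaled f (Suc j) - scaled f j = slope f (Suc j) * (A (Suc j) - A j)"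
proof (cases "j = 0")
  case True
  then show ?thesis by (simp add: scaled_def slope_def A_Suc A_0 b_1)
next
  case False
  then have "b j = b (Suc j) * x j" using b_Suc[of j] bounds[of j] by simp
  then show ?thesis using False b_pos[of "Suc j"]
    by (simp add: scaled_def slope_def A_Suc power2_eq_square field_simps)
qed

definition concave_wrt :: "(nat \<Rightarrow> real) \<Rightarrow> bool" where
  "concave_wrt f \<longleftrightarrow> (\<forall>j\<ge>1. 0 \<le> f j) \<and> (\<forall>j\<ge>1. 0 \<le> gen f j)"

lemma slope_antimono:
  assumes "concave_wrt f" "1 \<le> i" "i \<le> j"
  shows "slope f j \<le> slope f i"
  using assms(3,2)
proof (induction j rule: dec_induct)
  case (step j)
  have j: "1 \<le> j" using step assms(2) by simp
  then have "0 \<le> gen f j" using assms(1) by (simp add: concave_wrt_def)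
  then have "0 \<le> b j * (slope f j - slope f (Suc j))" using slope_diff[OF j, of f] by simp
  then have "slope f (Suc j) \<le> slope f j" using b_pos[of j] by (simp add: zero_le_mult_iff)
  then show ?case using step by simp
qed simp

lemma scaled_le_slope:
  assumes "concave_wrt f" "i \<le> j"
  shows "scaled f j - scaled f i \<le> slope f (Suc i) * (A j - A i)"
    and "1 \<le> j \<Longrightarrow> slope f j * (A j - A i) \<le> scaled f j - scaled f i"
proof -
  show "scaled f j - scaled f i \<le> slope f (Suc i) * (A j - A i)"
    using assms(2)
  proof (induction j rule: dec_induct)
    case (step j)
    have "slope f (Suc j) * (A (Suc j) - A j) \<le> slope f (Suc i) * (A (Suc j) - A j)"
      using slope_antimono[OF assms(1), of "Suc i" "Suc j"] step A_strict_mono[of j "Suc j"]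
      by (intro mult_right_mono) auto
    then show ?case using step scaled_Suc[of f j] by (simp add: algebra_simps)
  qed simp
  show "slope f j * (A j - A i) \<le> scaled f j - scaled f i" if "1 \<le> j"
    using assms(2)
  proof (induction i rule: inc_induct)
    case (step i)
    have "slope f j * (A (Suc i) - A i) \<le> slope f (Suc i) * (A (Suc i) - A i)"
      using slope_antimono[OF assms(1), of "Suc i" "j"] step A_strict_mono[of i "Suc i"]
      by (intro mult_right_mono) auto
    then show ?case using step scaled_Suc[of f i] by (simp add: algebra_simps)
  qed simp
qed

text \<open>A concave function of the unbounded variable \<open>A\<close> that never becomes
  negative cannot have a negative slope anywhere: it would lie below a line that falls below
  zero.\<close>

lemma slope_nonneg:
  assumes f: "concave_wrt f" and i: "1 \<le> i"
  shows "0 \<le> slope f i"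
proof (rule ccontr)
  assume "\<not> 0 \<le> slope f i"
  then have neg: "slope f i < 0" by simp
  obtain n :: nat where n: "A i - scaled f i / slope f i < real n" using reals_Archimedean2 by blast
  define j where "j = max (Suc i) n"
  have ij: "i < j" "real n \<le> real j" by (auto simp: j_def)
  have "scaled f j - scaled f i \<le> slope f (Suc i) * (A j - A i)"
    by (rule scaled_le_slope(1)[OF f]) (use ij in simp)
  also have "\<dots> \<le> slope f i * (A j - A i)"
    using slope_antimono[OF f i, of "Suc i"] A_strict_mono[OF ij(1)] by (intro mult_right_mono) auto
  finally have le: "scaled f j - scaled f i \<le> slope f i * (A j - A i)" .
  have "0 \<le> scaled f i + slope f i * (A j - A i)"
  proof -
    have "0 \<le> scaled f j" using f b_pos[of j] by (auto simp: scaled_def concave_wrt_def)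
    then show ?thesis using le by simp
  qed
  moreover have "- (scaled f i / slope f i) < A j - A i" using n A_ge[of j] ij by linarith
  then have "slope f i * (A j - A i) < slope f i * - (scaled f i / slope f i)"
    using neg by (rule mult_strict_left_mono_neg)
  then have "slope f i * (A j - A i) < - scaled f i" using neg by simp
  ultimately show False by simp
qed

lemma scaled_mono:
  assumes "concave_wrt f" "i \<le> j"
  shows "scaled f i \<le> scaled f j"
proof (cases "1 \<le> j")
  case True
  have "0 \<le> slope f j * (A j - A i)"
    using slope_nonneg[OF assms(1) True] A_strict_mono[of i j] assms(2) by (cases "i = j") auto
  then show ?thesis using scaled_le_slope(2)[OF assms True] by simp
qed (use assms in \<open>simp add: Suc_le_eq\<close>)

lemma concave_three:
  assumes f: "concave_wrt f" and ijk: "i < j" "j < k"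
  shows "(scaled f k - scaled f j) / (A k - A j) \<le> (scaled f j - scaled f i) / (A j - A i)"
proof -
  have "scaled f k - scaled f j \<le> slope f (Suc j) * (A k - A j)"
    using scaled_le_slope(1)[OF f, of j k] ijk by simp
  also have "\<dots> \<le> slope f j * (A k - A j)"
    using slope_antimono[OF f, of j "Suc j"] A_strict_mono[OF ijk(2)] ijk by (intro mult_right_mono) auto
  finally have "(scaled f k - scaled f j) / (A k - A j) \<le> slope f j"
    using A_strict_mono[OF ijk(2)] by (simp add: divide_le_eq)
  also have "\<dots> \<le> (scaled f j - scaled f i) / (A j - A i)"
    using scaled_le_slope(2)[OF f, of i j] A_strict_mono[OF ijk(1)] ijk by (simp add: le_divide_eq)
  finally show ?thesis .
qed

text \<open>For \<open>j > 1\<close>, monotonicity of \<open>x\<close> bounds \<open>gen\<close>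
  from below by \<open>(1 - x j)\<^sup>2\<close>. The rescaled constant is \<open>b\<close> itself,
  the left factor of the rank one perturbation of the kernel.\<close>

lemma concave_one: "concave_wrt (\<lambda>_. 1)"
  unfolding concave_wrt_def
proof (intro conjI allI impI)
  fix j :: nat assume j: "1 \<le> j"
  show "0 \<le> gen (\<lambda>_. 1) j"
  proof (cases "j = 1")
    case True
    have "(x 1)\<^sup>2 + 1 - x 1 = (x 1 - 1/2)\<^sup>2 + 3/4" by (simp add: power2_eq_square algebra_simps)
    then show ?thesis using True by (simp add: gen_def algebra_simps)
  next
    case False
    then have "x (j - 1) \<le> x j" using mono j by (auto simp: mono_on_def)
    moreover have "0 \<le> (x j - 1)\<^sup>2" by simp
    then have "0 \<le> 1 + (x j)\<^sup>2 - 2 * x j" by (simp add: power2_diff)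
    ultimately show ?thesis using False by (simp add: gen_def)
  qed
qed simp

end

section \<open>Excessive functions are concave\<close>

lemma has_sum_Suc_sums:
  fixes f :: "nat \<Rightarrow> real"
  assumes "(f has_sum s) {1..}"
  shows "(\<lambda>l. f (Suc l)) sums s"
proof -
  have "Suc ` UNIV = {1..}" by (auto simp: image_iff Suc_le_eq gr0_conv_Suc)
  then have "(f has_sum s) (Suc ` UNIV)" using assms by simp
  then have "((f \<circ> Suc) has_sum s) UNIV"
    by (subst (asm) has_sum_reindex) auto
  from has_sum_imp_sums[OF this] show ?thesis by (simp add: o_def)
qed

locale transition =
  fixes p :: "real \<Rightarrow> nat \<Rightarrow> nat \<Rightarrow> real"
  assumes markov: "markov_transition p"
begin

lemma p_nonneg: "0 < t \<Longrightarrow> 1 \<le> j \<Longrightarrow> 1 \<le> k \<Longrightarrow> 0 \<le> p t j k"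
  using markov by (simp add: markov_transition_def)

lemma p_summable: "0 < t \<Longrightarrow> 1 \<le> j \<Longrightarrow> p t j summable_on {1..}"
  using markov by (simp add: markov_transition_def)

lemma p_infsum: "0 < t \<Longrightarrow> 1 \<le> j \<Longrightarrow> (\<Sum>\<^sub>\<infinity>k\<in>{1..}. p t j k) \<le> 1"
  using markov by (simp add: markov_transition_def)

lemma chapman_kolmogorov:
  "0 < s \<Longrightarrow> 0 < t \<Longrightarrow> 1 \<le> j \<Longrightarrow> 1 \<le> k \<Longrightarrow> ((\<lambda>l. p s j l * p t l k) has_sum p (s + t) j k) {1..}"
  using markov by (simp add: markov_transition_def)

lemma p_at_0: "1 \<le> j \<Longrightarrow> 1 \<le> k \<Longrightarrow> ((\<lambda>t. p t j k) \<longlongrightarrow> (if j = k then 1 else 0)) (at_right 0)"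
  using markov by (simp add: markov_transition_def)

lemma p_le_1:
  assumes "0 < t" "1 \<le> j" "1 \<le> k"
  shows "p t j k \<le> 1"
proof -
  have "sum (p t j) {k} \<le> (\<Sum>\<^sub>\<infinity>k\<in>{1..}. p t j k)"
    using assms p_nonneg by (intro finite_sum_le_infsum p_summable) auto
  then show ?thesis using p_infsum[OF assms(1,2)] by simp
qed

text \<open>From below, keep the term \<open>l = j\<close> of the Chapman-Kolmogorov sum; from
  above, bound \<open>p t l k\<close> by \<open>1\<close> in the other terms and use that the row of
  \<open>p s\<close> sums to at most \<open>1\<close>. This gives continuity in time, and with it
  measurability of the integrand of the potential.\<close>

lemma p_increment:
  assumes "0 < s" "0 < t" "1 \<le> j" "1 \<le> k"
  shows "\<bar>p (s + t) j k - p t j k\<bar> \<le> 1 - p s j j"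
proof -
  note ck = chapman_kolmogorov[OF assms]
  have jj: "0 \<le> p s j j" "p s j j \<le> 1" using p_nonneg p_le_1 assms by auto
  have jk: "0 \<le> p t j k" "p t j k \<le> 1" using p_nonneg p_le_1 assms by auto
  have "(\<Sum>l\<in>{j}. p s j l * p t l k) \<le> (\<Sum>\<^sub>\<infinity>l\<in>{1..}. p s j l * p t l k)"
    using ck p_nonneg assms by (intro finite_sum_le_infsum) (auto intro: has_sum_imp_summable)
  then have lower: "p s j j * p t j k \<le> p (s + t) j k" using ck by (simp add: infsumI)
  have hs: "((\<lambda>l. p s j l) has_sum (\<Sum>\<^sub>\<infinity>l\<in>{1..}. p s j l)) {1..}"
    using p_summable assms by simp
  have "((\<lambda>l. if l = j then p s j j * p t j k - p s j j else 0) has_sum (p s j j * p t j k - p s j j)) {j}"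
    by (auto intro: has_sum_finiteI)
  then have "((\<lambda>l. if l = j then p s j j * p t j k - p s j j else 0) has_sum (p s j j * p t j k - p s j j)) {1..}"
    using assms by (subst has_sum_cong_neutral[where T = "{j}" and g = "\<lambda>l. if l = j then p s j j * p t j k - p s j j else 0"]) auto
  from has_sum_add[OF hs this]
  have "p (s + t) j k \<le> (\<Sum>\<^sub>\<infinity>l\<in>{1..}. p s j l) + (p s j j * p t j k - p s j j)"
  proof (rule has_sum_mono[OF ck])
    fix l :: nat assume "l \<in> {1..}"
    then have "p s j l * p t l k \<le> p s j l" using p_nonneg p_le_1 assms by (intro mult_left_le) auto
    then show "p s j l * p t l k \<le> p s j l + (if l = j then p s j j * p t j k - p s j j else 0)" by auto
  qed
  moreover have "p s j j * p t j k \<le> p t j k" using jj jk by (intro mult_left_le_one_le) auto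
  ultimately have "p (s + t) j k - p t j k \<le> 1 - p s j j" using p_infsum[OF assms(1,3)] by simp
  moreover have "(1 - p s j j) * p t j k \<le> 1 - p s j j" using jj jk by (intro mult_left_le) auto
  then have "p t j k - p (s + t) j k \<le> 1 - p s j j" using lower by (simp add: algebra_simps)
  ultimately show ?thesis by simp
qed

lemma p_continuous:
  assumes "1 \<le> j" "1 \<le> k"
  shows "continuous_on {0<..} (\<lambda>t. p t j k)"
  unfolding continuous_on_iff
proof (intro ballI allI impI)
  fix t e :: real assume t: "t \<in> {0<..}" and e: "0 < e"
  have "\<forall>\<^sub>F s in at_right 0. dist (p s j j) 1 < e"
    using p_at_0[OF assms(1) assms(1)] e by (simp add: tendsto_iff)
  then obtain r where r: "0 < r" "\<And>s. 0 < s \<Longrightarrow> s < r \<Longrightarrow> dist (p s j j) 1 < e"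
    by (auto simp: eventually_at_right_field)
  have key: "\<bar>p t' j k - p u j k\<bar> < e" if "0 < u" "u < t'" "t' - u < r" for u t'
    using p_increment[of "t' - u" u j k] r(2)[of "t' - u"] that assms by (simp add: dist_real_def)
  show "\<exists>r>0. \<forall>u\<in>{0<..}. dist u t < r \<longrightarrow> dist (p u j k) (p t j k) < e"
  proof (intro exI[of _ r] conjI ballI impI r(1))
    fix u assume u: "u \<in> {0<..}" "dist u t < r"
    consider "u < t" | "u = t" | "t < u" by linarith
    then show "dist (p u j k) (p t j k) < e"
      using key[of u t] key[of t u] u t e by cases (auto simp: dist_real_def)
  qed
qed

text \<open>Extended by \<open>0\<close> to nonpositive times, so that integrals can run over the
  whole line and be translated.\<close>

definition q :: "nat \<Rightarrow> nat \<Rightarrow> real \<Rightarrow> real" where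
  "q j k t = indicator {0<..} t * p t j k"

lemma q_measurable: "1 \<le> j \<Longrightarrow> 1 \<le> k \<Longrightarrow> q j k \<in> borel_measurable borel"
  using borel_measurable_continuous_on_indicator[OF _ p_continuous, of j k] by (simp add: q_def[abs_def])

text \<open>The expected time spent at \<open>k\<close> up to time \<open>t\<close> when starting
  from \<open>j\<close>.\<close>

definition occ :: "real \<Rightarrow> nat \<Rightarrow> nat \<Rightarrow> real" where
  "occ t j k = enn2real (\<integral>\<^sup>+s. ennreal (q j k s) * indicator {..t} s \<partial>lborel)"

lemma occ_bounds:
  assumes "0 < t" "1 \<le> j" "1 \<le> k" and c: "0 \<le> c" and le: "\<And>s. 0 < s \<Longrightarrow> s \<le> t \<Longrightarrow> c \<le> p s j k \<and> p s j k \<le> c'"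
  shows "c * t \<le> occ t j k" "occ t j k \<le> c' * t" "(\<integral>\<^sup>+s. ennreal (q j k s) * indicator {..t} s \<partial>lborel) = ennreal (occ t j k)"
proof -
  let ?I = "\<integral>\<^sup>+s. ennreal (q j k s) * indicator {..t} s \<partial>lborel"
  have "c \<le> c'" using le[of t] assms(1) by simp
  have int: "(\<integral>\<^sup>+s. ennreal a * indicator {0<..t} s \<partial>lborel) = ennreal (a * t)" if "0 \<le> a" for a
    using assms(1) that by (simp add: nn_integral_cmult_indicator ennreal_mult')
  have up: "?I \<le> ennreal (c' * t)"
    unfolding int[OF order_trans[OF c \<open>c \<le> c'\<close>], symmetric]
    by (intro nn_integral_mono) (use le in \<open>auto simp: q_def indicator_def intro!: ennreal_leI\<close>)
  have lo: "ennreal (c * t) \<le> ?I"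
    unfolding int[OF c, symmetric]
    by (intro nn_integral_mono) (use le in \<open>auto simp: q_def indicator_def intro!: ennreal_leI\<close>)
  have fin: "?I < \<infinity>" using up by (rule le_less_trans) simp
  then show eq: "?I = ennreal (occ t j k)" by (simp add: occ_def)
  have o: "0 \<le> occ t j k" by (simp add: occ_def)
  show "c * t \<le> occ t j k" using lo o unfolding eq by simp
  have "0 \<le> c' * t" using assms(1) c \<open>c \<le> c'\<close> by simp
  then show "occ t j k \<le> c' * t" using up unfolding eq by simp
qed

lemma occ_at_0:
  assumes "1 \<le> j" "1 \<le> k"
  shows "((\<lambda>t. occ t j k / t) \<longlongrightarrow> (if j = k then 1 else 0)) (at_right 0)"
proof (rule tendstoI)
  fix e :: real assume e: "0 < e"
  define D :: real where "D = (if j = k then 1 else 0)"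
  have "\<forall>\<^sub>F s in at_right 0. dist (p s j k) D < e / 2"
    using p_at_0[OF assms] e half_gt_zero unfolding tendsto_iff D_def by blast
  then obtain r where r: "0 < r" "\<And>s. 0 < s \<Longrightarrow> s < r \<Longrightarrow> dist (p s j k) D < e / 2"
    by (auto simp: eventually_at_right_field)
  have "dist (occ t j k / t) D < e" if t: "0 < t" "t < r" for t
  proof -
    have "max 0 (D - e / 2) \<le> p s j k \<and> p s j k \<le> D + e / 2" if "0 < s" "s \<le> t" for s
    proof -
      have "\<bar>p s j k - D\<bar> < e / 2" using r(2)[of s] that t by (simp add: dist_real_def)
      then have "D - e / 2 \<le> p s j k" "p s j k \<le> D + e / 2" by linarith+
      then show ?thesis using p_nonneg[of s j k] that assms by simp
    qed
    from occ_bounds(1,2)[OF t(1) assms _ this]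
    have "max 0 (D - e / 2) * t \<le> occ t j k" "occ t j k \<le> (D + e / 2) * t" by auto
    then have "max 0 (D - e / 2) \<le> occ t j k / t" "occ t j k / t \<le> D + e / 2"
      by (simp_all only: pos_le_divide_eq[OF t(1)] pos_divide_le_eq[OF t(1)])
    then show ?thesis unfolding dist_real_def using e by linarith
  qed
  then show "\<forall>\<^sub>F t in at_right 0. dist (occ t j k / t) (if j = k then 1 else 0) < e"
    unfolding D_def[symmetric] using r(1) by (auto simp: eventually_at_right_field)
qed

text \<open>By the Chapman-Kolmogorov equation the sum is the integral of \<open>p s i k\<close>
  over times \<open>s > t\<close>, that is, the potential minus the occupation up to
  \<open>t\<close>. The computation stays in \<open>ennreal\<close> until finiteness is
  known.\<close>

lemma resolvent_sums:
  assumes K: "potential_density p K" and t: "0 < t" and jk: "1 \<le> i" "1 \<le> k"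
  shows "(\<lambda>l. p t i (Suc l) * K (Suc l) k) sums (K i k - occ t i k)"
proof -
  have Kq: "(\<integral>\<^sup>+s. ennreal (q j k s) \<partial>lborel) = ennreal (K j k)" "0 \<le> K j k" if "1 \<le> j" for j
  proof -
    have "(\<integral>\<^sup>+s\<in>{0<..}. ennreal (p s j k) \<partial>lborel) = ennreal (K j k)" "0 \<le> K j k"
      using K that jk by (auto simp: potential_density_def)
    moreover have "(\<integral>\<^sup>+s\<in>{0<..}. ennreal (p s j k) \<partial>lborel) = (\<integral>\<^sup>+s. ennreal (q j k s) \<partial>lborel)"
      by (intro nn_integral_cong) (auto simp: q_def indicator_def)
    ultimately show "(\<integral>\<^sup>+s. ennreal (q j k s) \<partial>lborel) = ennreal (K j k)" "0 \<le> K j k" by auto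
  qed
  have qm: "q j k \<in> borel_measurable borel" if "1 \<le> j" for j using q_measurable[OF that jk(2)] .
  have [measurable]: "q i k \<in> borel_measurable borel" by (rule qm[OF jk(1)])
  have occ: "(\<integral>\<^sup>+s. ennreal (q i k s) * indicator {..t} s \<partial>lborel) = ennreal (occ t i k)"
    using occ_bounds(3)[OF t jk, of 0 1] p_nonneg p_le_1 jk by auto
  have split: "ennreal (K i k) = ennreal (occ t i k) + (\<integral>\<^sup>+s. ennreal (q i k s) * indicator {t<..} s \<partial>lborel)"
    unfolding Kq(1)[OF jk(1), symmetric] occ[symmetric]
    by (subst nn_integral_add[symmetric]) (auto intro!: nn_integral_cong simp: indicator_def)
  have "(\<integral>\<^sup>+s. ennreal (q i k s) * indicator {t<..} s \<partial>lborel) = (\<integral>\<^sup>+s. ennreal (q i k (t + 1 * s)) * indicator {t<..} (t + 1 * s) \<partial>lborel)"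
    by (subst nn_integral_real_affine[where c = 1 and t = t]) auto
  also have "\<dots> = (\<integral>\<^sup>+s. (\<Sum>l. ennreal (p t i (Suc l)) * ennreal (q (Suc l) k s)) \<partial>lborel)"
  proof (intro nn_integral_cong)
    fix s :: real
    show "ennreal (q i k (t + 1 * s)) * indicator {t<..} (t + 1 * s) = (\<Sum>l. ennreal (p t i (Suc l)) * ennreal (q (Suc l) k s))"
    proof (cases "0 < s")
      case True
      have "(\<lambda>l. p t i (Suc l) * p s (Suc l) k) sums p (t + s) i k"
        using has_sum_Suc_sums[OF chapman_kolmogorov[OF t True jk]] .
      then have "(\<Sum>l. ennreal (p t i (Suc l) * p s (Suc l) k)) = ennreal (p (t + s) i k)"
        using p_nonneg t True jk by (intro suminf_ennreal_eq) auto
      then show ?thesis using True t p_nonneg jk by (simp add: q_def ennreal_mult)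
    qed (simp add: q_def)
  qed
  also have "\<dots> = (\<Sum>l. ennreal (p t i (Suc l)) * (\<integral>\<^sup>+s. ennreal (q (Suc l) k s) \<partial>lborel))"
    using qm by (subst nn_integral_suminf) (auto intro!: suminf_cong nn_integral_cmult)
  also have "\<dots> = (\<Sum>l. ennreal (p t i (Suc l) * K (Suc l) k))"
    using Kq p_nonneg t jk by (intro suminf_cong) (simp add: ennreal_mult)
  finally have eq: "ennreal (K i k) = ennreal (occ t i k) + (\<Sum>l. ennreal (p t i (Suc l) * K (Suc l) k))"
    using split by simp
  then have fin: "(\<Sum>l. ennreal (p t i (Suc l) * K (Suc l) k)) \<noteq> Orderings.top"
    by (metis ennreal_add_eq_top ennreal_neq_top)
  have nn: "0 \<le> p t i (Suc l) * K (Suc l) k" for l using Kq p_nonneg t jk by simp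
  have sm: "summable (\<lambda>l. p t i (Suc l) * K (Suc l) k)"
    using summable_suminf_not_top[OF nn fin] .
  have "ennreal (K i k) = ennreal (occ t i k + (\<Sum>l. p t i (Suc l) * K (Suc l) k))"
    using eq nn sm suminf_ennreal2[OF nn sm] by (simp add: occ_def suminf_nonneg)
  then have "K i k = occ t i k + (\<Sum>l. p t i (Suc l) * K (Suc l) k)"
    using Kq(2)[OF jk(1)] nn sm by (subst (asm) ennreal_inj) (auto simp: occ_def suminf_nonneg)
  then show ?thesis using sm by (simp add: sums_iff)
qed

text \<open>The full sum increases to \<open>f i\<close> as \<open>t\<close> decreases, so it is at
  most \<open>f i\<close>, and dropping nonnegative terms keeps the bound. Finite sums suffice later
  because the inverse of the potential is tridiagonal.\<close>

lemma excessive_finite_sum: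
  assumes f: "excessive p f" and t: "0 < t" and i: "1 \<le> i" and S: "finite S" "S \<subseteq> {1..}"
  shows "(\<Sum>k\<in>S. p t i k * f k) \<le> f i"
proof -
  have fn: "0 \<le> f k" if "1 \<le> k" for k using f that by (simp add: excessive_def)
  have "(\<Sum>k\<in>S. ennreal (p t i k * f k)) \<le> semigroup_apply p t f i"
    unfolding semigroup_apply_def infsum_finite[OF S(1), symmetric] using S
    by (intro infsum_mono_neutral) (auto intro: nonneg_summable_on_complete)
  also have "\<dots> \<le> ennreal (f i)"
  proof (rule tendsto_lowerbound)
    show "((\<lambda>s. semigroup_apply p s f i) \<longlongrightarrow> ennreal (f i)) (at_right 0)"
      using f i by (simp add: excessive_def)
    show "\<forall>\<^sub>F s in at_right 0. semigroup_apply p t f i \<le> semigroup_apply p s f i"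
      using f i t by (auto simp: excessive_def eventually_at_right_field intro!: exI[of _ t])
  qed simp
  finally have "ennreal (\<Sum>k\<in>S. p t i k * f k) \<le> ennreal (f i)"
    using S p_nonneg[OF t i] fn by (subst sum_ennreal[symmetric]) (auto intro!: mult_nonneg_nonneg)
  then show ?thesis using fn[OF i] by simp
qed

end

section \<open>The inverse of the potential as a derivative of the semigroup\<close>

context ar_weights
begin

text \<open>As a function of \<open>A\<close>, the rescaled row \<open>l\<close> is
  \<open>min (A l) (A n) / b l\<close>: linear up to \<open>l\<close>, then constant. Its single
  kink produces the Kronecker delta in \<open>gen_ar_cov\<close>.\<close>

lemma slope_ar_cov:
  assumes "1 \<le> l" "1 \<le> k"
  shows "slope (ar_cov x l) k = (if k \<le> l then 1 / b l else 0)"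
proof -
  obtain m where m: "k = Suc m" using assms(2) by (cases k) auto
  have sc: "scaled (ar_cov x l) n = A (min l n) / b l" for n
    using assms(1) b_pos[of n] by (cases "n = 0") (simp_all add: scaled_def A_0 ar_cov_eq)
  have Apos: "A m < A (Suc m)" by (rule A_strict_mono) simp
  have "slope (ar_cov x l) (Suc m) * (A (Suc m) - A m) = (A (min l (Suc m)) - A (min l m)) / b l"
    unfolding scaled_Suc[symmetric] sc by (simp add: diff_divide_distrib)
  also have "\<dots> = (if Suc m \<le> l then 1 / b l else 0) * (A (Suc m) - A m)"
    by (simp add: min_def)
  finally show ?thesis using Apos m by simp
qed

lemma gen_ar_cov:
  assumes "1 \<le> l" "1 \<le> j"
  shows "gen (ar_cov x l) j = (if l = j then 1 else 0)"
  using assms b_pos[of j] by (auto simp: slope_diff slope_ar_cov)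

lemma gen_linear:
  "gen (\<lambda>k. f k - g k) j = gen f j - gen g j"
  "gen (\<lambda>k. c * f k) j = c * gen f j"
  by (simp_all add: gen_def algebra_simps)

lemma gen_sums:
  assumes "\<And>k. 1 \<le> k \<Longrightarrow> (\<lambda>l. F l k) sums f k" "1 \<le> j"
  shows "(\<lambda>l. gen (F l) j) sums gen f j"
proof (cases "j = 1")
  case True
  then show ?thesis using assms unfolding gen_def by (auto intro!: sums_diff sums_mult)
next
  case False
  then show ?thesis using assms unfolding gen_def by (auto intro!: sums_diff sums_mult)
qed

lemma gen_tendsto:
  assumes "\<And>k. 1 \<le> k \<Longrightarrow> ((\<lambda>l. F l k) \<longlongrightarrow> f k) G" "1 \<le> j"
  shows "((\<lambda>l. gen (F l) j) \<longlongrightarrow> gen f j) G"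
proof (cases "j = 1")
  case True
  then show ?thesis using assms unfolding gen_def by (auto intro!: tendsto_intros)
next
  case False
  then show ?thesis using assms unfolding gen_def by (auto intro!: tendsto_intros)
qed

text \<open>Applying \<open>gen\<close> to the resolvent identity expresses \<open>p t i j\<close>
  as the Kronecker delta minus \<open>gen (occ t i) j\<close>. After division by \<open>t\<close>,
  the occupation tends to the delta again, so \<open>(\<delta> i j - p t i j) / t\<close> tends to
  the entries of the tridiagonal matrix, and \<open>gen f i\<close> is a limit of nonnegative
  sums.\<close>

lemma excessive_concave:
  assumes "markov_transition p" "potential_density p (ar_cov x)" "excessive p f"
  shows "concave_wrt f"
  unfolding concave_wrt_def
proof (intro conjI allI impI)
  interpret transition p using assms(1) by unfold_locales
  show "0 \<le> f j" if "1 \<le> j" for j using assms(3) that by (simp add: excessive_def)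
  fix i :: nat assume i: "1 \<le> i"
  define \<delta> :: "nat \<Rightarrow> nat \<Rightarrow> real" where "\<delta> j k = (if j = k then 1 else 0)" for j k
  have pt: "p t i j = \<delta> i j - gen (occ t i) j" if t: "0 < t" and j: "1 \<le> j" for t j
  proof -
    have "(\<lambda>l. gen (\<lambda>k. p t i (Suc l) * ar_cov x (Suc l) k) j) sums gen (\<lambda>k. ar_cov x i k - occ t i k) j"
      using resolvent_sums[OF assms(2) t i] j by (intro gen_sums) auto
    then have "(\<lambda>l. p t i (Suc l) * \<delta> (Suc l) j) sums (\<delta> i j - gen (occ t i) j)"
      using i j by (simp add: gen_linear gen_ar_cov \<delta>_def)
    moreover have "(\<lambda>l. p t i (Suc l) * \<delta> (Suc l) j) sums p t i j"
    proof -
      have "(\<lambda>l. p t i (Suc l) * \<delta> (Suc l) j) = (\<lambda>l. if l = j - 1 then p t i (Suc l) else 0)"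
        using j by (auto simp: \<delta>_def fun_eq_iff)
      then show ?thesis using sums_single[of "j - 1" "\<lambda>l. p t i (Suc l)"] j by simp
    qed
    ultimately show ?thesis by (rule sums_unique2[symmetric])
  qed
  have lim: "((\<lambda>t. (\<delta> i j - p t i j) / t) \<longlongrightarrow> gen (\<delta> i) j) (at_right 0)" if j: "1 \<le> j" for j
  proof -
    have "((\<lambda>t. gen (\<lambda>k. occ t i k / t) j) \<longlongrightarrow> gen (\<delta> i) j) (at_right 0)"
      using occ_at_0[OF i] j unfolding \<delta>_def by (intro gen_tendsto) auto
    moreover have "\<forall>\<^sub>F t in at_right 0. gen (\<lambda>k. occ t i k / t) j = (\<delta> i j - p t i j) / t"
      using eventually_at_right_less[of 0]
    proof eventually_elim
      case (elim t)
      have "gen (\<lambda>k. occ t i k / t) j = gen (occ t i) j / t"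
        using gen_linear(2)[of "inverse t" "occ t i" j] by (simp add: divide_inverse mult.commute)
      then show ?case using pt[OF elim j] by simp
    qed
    ultimately show ?thesis by (rule Lim_transform_eventually)
  qed
  \<comment> \<open>The generator has entries only at the neighbours of \<open>i\<close>; removing
    index \<open>0\<close> covers the boundary case \<open>i = 1\<close>.\<close>
  define S where "S = {i - 1, i, Suc i} - {0}"
  have "((\<lambda>t. \<Sum>j\<in>S. (\<delta> i j - p t i j) / t * f j) \<longlongrightarrow> (\<Sum>j\<in>S. gen (\<delta> i) j * f j)) (at_right 0)"
    by (intro tendsto_intros lim) (auto simp: S_def)
  moreover have "\<forall>\<^sub>F t in at_right 0. 0 \<le> (\<Sum>j\<in>S. (\<delta> i j - p t i j) / t * f j)"
    using eventually_at_right_less[of 0]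
  proof eventually_elim
    case (elim t)
    have "(\<Sum>j\<in>S. \<delta> i j * f j) = f i"
      using i by (simp add: \<delta>_def S_def if_distrib[of "\<lambda>c. c * _"] cong: if_cong)
    moreover have "(\<Sum>j\<in>S. p t i j * f j) \<le> f i"
      by (rule excessive_finite_sum[OF assms(3) elim i]) (auto simp: S_def)
    ultimately have "0 \<le> (\<Sum>j\<in>S. (\<delta> i j - p t i j) * f j)"
      by (simp add: left_diff_distrib sum_subtractf)
    then have "0 \<le> (\<Sum>j\<in>S. (\<delta> i j - p t i j) * f j) / t" using elim by simp
    then show ?case by (simp add: sum_divide_distrib)
  qed
  ultimately have "0 \<le> (\<Sum>j\<in>S. gen (\<delta> i) j * f j)"
    by (rule tendsto_lowerbound) simp
  also have "\<dots> = gen f i"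
  proof (cases "i = 1")
    case True
    then have "S = {1, 2}" by (auto simp: S_def)
    then show ?thesis using True by (simp add: gen_def \<delta>_def numeral_2_eq_2)
  next
    case False
    then obtain m where m: "i = Suc (Suc m)" using i by (metis One_nat_def Suc_le_D not0_implies_Suc)
    then have "S = {Suc m, Suc (Suc m), Suc (Suc (Suc m))}" by (auto simp: S_def)
    then show ?thesis using m by (simp add: gen_def \<delta>_def)
  qed
  finally show "0 \<le> gen f i" .
qed

end

section \<open>Finite restrictions of the kernel\<close>

context ar_weights
begin

text \<open>The kernel restricted to indices \<open>i 0 < i 1 < \<dots> < i (N - 1)\<close>. The inverse of \<open>min\<close> of
  the \<open>A (i k)\<close> is tridiagonal (second differences with respect to \<open>A\<close>), and the summand
  \<open>f\<close> is a rank one perturbation.\<close>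

definition pre :: "(nat \<Rightarrow> nat) \<Rightarrow> nat \<Rightarrow> nat" where "pre i r = (if r = 0 then 0 else i (r - 1))"

definition gap :: "(nat \<Rightarrow> nat) \<Rightarrow> nat \<Rightarrow> real" where "gap i r = A (i r) - A (pre i r)"

definition tri :: "nat \<Rightarrow> (nat \<Rightarrow> nat) \<Rightarrow> nat \<Rightarrow> nat \<Rightarrow> real" where
  "tri N i r s = (if r = s then 1 / gap i r + (if Suc r < N then 1 / gap i (Suc r) else 0)
     else if r = Suc s then - 1 / gap i r else if s = Suc r then - 1 / gap i s else 0)"

text \<open>The Sherman-Morrison formula: rescaled by \<open>b\<close>, the kernel is
  \<open>A (min (i r) (i s))\<close> plus the product of \<open>b (i r)\<close> and
  \<open>scaled f (i s)\<close>. The outer factors \<open>b\<close> undo the rescaling.\<close>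

definition pert_inverse :: "nat \<Rightarrow> (nat \<Rightarrow> nat) \<Rightarrow> (nat \<Rightarrow> real) \<Rightarrow> nat \<Rightarrow> nat \<Rightarrow> real" where
  "pert_inverse N i f r s = b (i r) * b (i s) * (tri N i r s -
     (\<Sum>t<N. tri N i r t * b (i t)) * (\<Sum>t<N. tri N i s t * scaled f (i t))
     / (1 + (\<Sum>t<N. scaled f (i t) * (\<Sum>u<N. tri N i t u * b (i u)))))"

context
  fixes N :: nat and i :: "nat \<Rightarrow> nat"
  assumes i_less: "\<And>r. Suc r < N \<Longrightarrow> i r < i (Suc r)" and i_pos: "\<And>r. r < N \<Longrightarrow> 1 \<le> i r"
begin

lemma i_mono: "r < s \<Longrightarrow> s < N \<Longrightarrow> i r < i s"
proof (induction s)
  case (Suc s)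
  then show ?case using i_less[of s] by (cases "r = s") auto
qed simp

lemma gap_pos: "r < N \<Longrightarrow> 0 < gap i r"
  using i_less[of "r - 1"] i_pos[of r] A_strict_mono[of "pre i r" "i r"] by (cases r) (auto simp: gap_def pre_def)

lemma tri_sym: "tri N i r s = tri N i s r"
  by (simp add: tri_def)

text \<open>The slope on the left of \<open>i r\<close> minus the slope on the right. The last index
  has no right slope, as if the function continued constantly; index \<open>0\<close> with value
  \<open>0\<close> acts as left neighbour of the first.\<close>

lemma tri_apply:
  assumes r: "r < N" and G0: "G 0 = 0"
  shows "(\<Sum>s<N. tri N i r s * G (i s)) = (G (i r) - G (pre i r)) / gap i r -
    (if Suc r < N then (G (i (Suc r)) - G (i r)) / gap i (Suc r) else 0)"
proof -
  define a where "a = (if r = 0 then 0 else - G (i (r - 1)) / gap i r)"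
  define c where "c = (if Suc r < N then - G (i (Suc r)) / gap i (Suc r) else 0)"
  have "(\<Sum>s<N. tri N i r s * G (i s)) = (\<Sum>s<N. (if s = r then tri N i r r * G (i r) else 0)
      + (if Suc s = r then - G (i s) / gap i r else 0) + (if s = Suc r then - G (i s) / gap i s else 0))"
    by (intro sum.cong) (auto simp: tri_def)
  also have "\<dots> = tri N i r r * G (i r) + a + c"
  proof -
    have "(\<Sum>s<N. if Suc s = r then - G (i s) / gap i r else 0) = a"
    proof (cases r)
      case (Suc m)
      then have "(\<Sum>s<N. if Suc s = r then - G (i s) / gap i r else 0) = (\<Sum>s<N. if s = m then - G (i m) / gap i r else 0)"
        by (intro sum.cong) auto
      then show ?thesis using Suc r by (simp add: a_def)
    qed (simp add: a_def)
    moreover have "(\<Sum>s<N. if s = Suc r then - G (i s) / gap i s else 0) = c"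
      by (simp add: c_def)
    moreover have "(\<Sum>s<N. if s = r then tri N i r r * G (i r) else 0) = tri N i r r * G (i r)"
      using r by simp
    ultimately show ?thesis by (simp add: sum.distrib)
  qed
  also have "\<dots> = (G (i r) - G (pre i r)) / gap i r - (if Suc r < N then (G (i (Suc r)) - G (i r)) / gap i (Suc r) else 0)"
    using G0 by (auto simp: tri_def a_def c_def pre_def diff_divide_distrib add_divide_distrib algebra_simps)
  finally show ?thesis .
qed

text \<open>As a function of \<open>A\<close>, the minimum with the level \<open>A (i t)\<close> has
  slope \<open>1\<close> before \<open>i t\<close> and \<open>0\<close> after it, so the slopes
  differ only at \<open>r = t\<close>.\<close>

lemma tri_min:
  assumes r: "r < N" and t: "t < N"
  shows "(\<Sum>s<N. tri N i r s * A (min (i s) (i t))) = (if r = t then 1 else 0)"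
proof -
  have lt: "s < t \<longleftrightarrow> i s < i t" if "s < N" for s
    using i_mono[of s t] i_mono[of t s] that t by (metis less_asym nat_neq_iff)
  have pr: "pre i r \<le> i t" if "r \<le> t"
    using lt[of "r - 1"] r that by (cases r) (auto simp: pre_def)
  have pr': "i t \<le> pre i r" if "t < r"
  proof -
    have "t < r - 1 \<or> t = r - 1" using that by linarith
    then show ?thesis using i_mono[of t "r - 1"] r that by (cases r) (auto simp: pre_def)
  qed
  consider "r < t" | "r = t" | "t < r" by linarith
  then show ?thesis
  proof cases
    case 1
    then have "i r \<le> i t" "i (Suc r) \<le> i t" "pre i r \<le> i t" "Suc r < N"
      using i_mono[of r t] i_mono[of "Suc r" t] t pr by (cases "Suc r = t"; auto)+
    then show ?thesis
      using 1 tri_apply[OF r, of "\<lambda>n. A (min n (i t))"] gap_pos[OF r] gap_pos[of "Suc r"]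
      by (auto simp: A_0 min_absorb1 gap_def[of i r] gap_def[of i "Suc r"] pre_def[of i "Suc r"])
  next
    case 2
    then have "Suc r < N \<Longrightarrow> i r \<le> i (Suc r)" using i_less[of r] by simp
    then show ?thesis
      using 2 pr tri_apply[OF r, of "\<lambda>n. A (min n (i t))"] gap_pos[OF r]
      by (auto simp: A_0 min_absorb1 min_absorb2 gap_def[of i t])
  next
    case 3
    then have "i t \<le> i r" "i t \<le> pre i r" "Suc r < N \<Longrightarrow> i t \<le> i (Suc r)"
      using i_mono[of t r] r pr' i_mono[of t "Suc r"] by auto
    then show ?thesis
      using 3 tri_apply[OF r, of "\<lambda>n. A (min n (i t))"] by (auto simp: A_0 min_absorb2)
  qed
qed

text \<open>Slopes of a concave function decrease, and the last one is nonnegative by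
  \<open>scaled_mono\<close>.\<close>

lemma tri_concave:
  assumes f: "concave_wrt f" and r: "r < N"
  shows "0 \<le> (\<Sum>s<N. tri N i r s * scaled f (i s))"
proof -
  have p: "pre i r < i r" using i_less[of "r - 1"] i_pos[of r] r by (cases r) (auto simp: pre_def)
  have "0 \<le> (scaled f (i r) - scaled f (pre i r)) / gap i r"
    using scaled_mono[OF f, of "pre i r" "i r"] p gap_pos[OF r] by simp
  moreover have "(scaled f (i (Suc r)) - scaled f (i r)) / gap i (Suc r) \<le> (scaled f (i r) - scaled f (pre i r)) / gap i r"
    if "Suc r < N"
    using concave_three[OF f p i_less[OF that]] by (simp add: gap_def pre_def[of i "Suc r"])
  ultimately show ?thesis
    using tri_apply[OF r, of "scaled f"] by (auto simp: scaled_def[of f 0])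
qed

text \<open>The correction is the product of two vectors divided by \<open>e \<ge> 1\<close>; the
  vectors are nonnegative by concavity of the constant \<open>1\<close> and of \<open>f\<close>.
  Being subtracted, it lowers every entry: the off-diagonal stays nonpositive, and the second claim
  gives bounds in which \<open>f\<close> does not occur.\<close>

lemma pert_inverse:
  assumes f: "concave_wrt f"
  shows "m_inverse N (pert_inverse N i f) (\<lambda>r s. ar_cov x (i r) (i s) + f (i s))"
    and "\<And>r s. r < N \<Longrightarrow> s < N \<Longrightarrow> pert_inverse N i f r s \<le> b (i r) * b (i s) * tri N i r s"
proof -
  define u where "u r = (\<Sum>t<N. tri N i r t * b (i t))" for r
  define F where "F t = scaled f (i t)" for t
  define w where "w s = (\<Sum>t<N. tri N i s t * F t)" for s
  define e where "e = 1 + (\<Sum>t<N. F t * u t)"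
  have pe: "pert_inverse N i f r s = b (i r) * b (i s) * (tri N i r s - u r * w s / e)" for r s
    by (simp add: pert_inverse_def u_def F_def w_def e_def)
  have b1: "b (i t) = scaled (\<lambda>_. 1) (i t)" if "t < N" for t using i_pos[OF that] by (simp add: scaled_def)
  have u: "0 \<le> u r" if "r < N" for r
    using tri_concave[OF concave_one that] by (simp add: u_def b1)
  have w: "0 \<le> w r" if "r < N" for r
    using tri_concave[OF f that] by (simp add: w_def F_def)
  have F: "0 \<le> F t" for t
    using scaled_mono[OF f, of 0 "i t"] by (simp add: F_def scaled_def[of f 0])
  have e: "1 \<le> e" using u F by (auto simp: e_def intro!: sum_nonneg)
  have ew: "(\<Sum>s<N. w s * b (i s)) = e - 1"
  proof -
    have "(\<Sum>s<N. w s * b (i s)) = (\<Sum>s<N. \<Sum>t<N. tri N i s t * F t * b (i s))"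
      by (simp add: w_def sum_distrib_right)
    also have "\<dots> = (\<Sum>t<N. \<Sum>s<N. tri N i s t * F t * b (i s))" by (rule sum.swap)
    also have "\<dots> = e - 1"
      by (simp add: e_def u_def sum_distrib_left tri_sym mult_ac)
    finally show ?thesis .
  qed
  have wA: "(\<Sum>s<N. w s * A (min (i s) (i r))) = F r" if "r < N" for r
  proof -
    have "(\<Sum>s<N. w s * A (min (i s) (i r))) = (\<Sum>s<N. \<Sum>t<N. tri N i s t * F t * A (min (i s) (i r)))"
      by (simp add: w_def sum_distrib_right)
    also have "\<dots> = (\<Sum>t<N. \<Sum>s<N. tri N i s t * F t * A (min (i s) (i r)))" by (rule sum.swap)
    also have "\<dots> = (\<Sum>t<N. F t * (\<Sum>s<N. tri N i t s * A (min (i s) (i r))))"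
      unfolding sum_distrib_left by (intro sum.cong refl) (simp add: tri_sym)
    also have "\<dots> = (\<Sum>t<N. if t = r then F r else 0)"
      by (intro sum.cong refl) (simp add: tri_min that)
    finally show ?thesis using that by simp
  qed
  have le: "pert_inverse N i f r s \<le> b (i r) * b (i s) * tri N i r s" if "r < N" "s < N" for r s
  proof -
    have "0 \<le> u r * w s / e" using u[OF that(1)] w[OF that(2)] e by simp
    then show ?thesis unfolding pe using b_pos by (intro mult_left_mono) (auto simp: less_imp_le)
  qed
  then show "\<And>r s. r < N \<Longrightarrow> s < N \<Longrightarrow> pert_inverse N i f r s \<le> b (i r) * b (i s) * tri N i r s" .
  show "m_inverse N (pert_inverse N i f) (\<lambda>r s. ar_cov x (i r) (i s) + f (i s))"
    unfolding m_inverse_def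
  proof (intro conjI allI impI)
    fix r s assume rs: "r < N" "s < N"
    have "0 < A (min (i r) (i s))" using A_strict_mono[of 0 "min (i r) (i s)"] i_pos[OF rs(1)] i_pos[OF rs(2)] by (simp add: A_0)
    then have "0 < ar_cov x (i r) (i s)" using i_pos rs b_pos by (simp add: ar_cov_eq)
    moreover have "0 \<le> f (i s)" using f i_pos[OF rs(2)] by (simp add: concave_wrt_def)
    ultimately show "0 < ar_cov x (i r) (i s) + f (i s)" by simp
  next
    fix r s assume rs: "r < N" "s < N" "r \<noteq> s"
    have "tri N i r s \<le> 0" using rs gap_pos[OF rs(1)] gap_pos[OF rs(2)] by (auto simp: tri_def)
    then have "b (i r) * b (i s) * tri N i r s \<le> 0" using b_pos by (intro mult_nonneg_nonpos) (auto simp: less_imp_le)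
    then show "pert_inverse N i f r s \<le> 0" using le[OF rs(1,2)] by simp
  next
    fix r t assume rt: "r < N" "t < N"
    have k: "b (i s) * (ar_cov x (i s) (i t) + f (i t)) = (A (min (i s) (i t)) + b (i s) * F t) / b (i t)" if "s < N" for s
      using i_pos[OF that] i_pos[OF rt(2)] b_pos[of "i s"] b_pos[of "i t"]
      by (simp add: ar_cov_eq F_def scaled_def field_simps)
    have "(\<Sum>s<N. pert_inverse N i f r s * (ar_cov x (i s) (i t) + f (i t)))
      = (\<Sum>s<N. b (i r) / b (i t) * ((tri N i r s - u r * w s / e) * (A (min (i s) (i t)) + b (i s) * F t)))"
    proof (intro sum.cong refl)
      fix s assume "s \<in> {..<N}"
      then have "pert_inverse N i f r s * (ar_cov x (i s) (i t) + f (i t))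
        = b (i r) * (tri N i r s - u r * w s / e) * ((A (min (i s) (i t)) + b (i s) * F t) / b (i t))"
        by (simp add: pe k[symmetric])
      then show "pert_inverse N i f r s * (ar_cov x (i s) (i t) + f (i t))
        = b (i r) / b (i t) * ((tri N i r s - u r * w s / e) * (A (min (i s) (i t)) + b (i s) * F t))" by simp
    qed
    also have "\<dots> = b (i r) / b (i t) * (\<Sum>s<N. (tri N i r s - u r * w s / e) * (A (min (i s) (i t)) + b (i s) * F t))"
      by (simp only: sum_distrib_left)
    also have "(\<Sum>s<N. (tri N i r s - u r * w s / e) * (A (min (i s) (i t)) + b (i s) * F t))
      = (\<Sum>s<N. tri N i r s * A (min (i s) (i t))) + (\<Sum>s<N. tri N i r s * b (i s)) * F t
        - u r / e * ((\<Sum>s<N. w s * A (min (i s) (i t))) + (\<Sum>s<N. w s * b (i s)) * F t)"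
    proof -
      have "(tri N i r s - u r * w s / e) * (A (min (i s) (i t)) + b (i s) * F t)
        = tri N i r s * A (min (i s) (i t)) + tri N i r s * b (i s) * F t
          - u r / e * (w s * A (min (i s) (i t)) + w s * b (i s) * F t)" for s
        by (simp add: algebra_simps)
      then show ?thesis
        by (simp only: sum_subtractf sum.distrib sum_distrib_left[symmetric] sum_distrib_right[symmetric])
    qed
    also have "\<dots> = (if r = t then 1 else 0)"
      unfolding tri_min[OF rt] wA[OF rt(2)] ew u_def[symmetric] using e by (simp add: field_simps)
    also have "b (i r) / b (i t) * (if r = t then 1 else 0) = (if r = t then 1 else 0)"
      using b_pos[of "i t"] by simp
    finally show "(\<Sum>s<N. pert_inverse N i f r s * (ar_cov x (i s) (i t) + f (i t))) = (if r = t then 1 else 0)" .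
  qed
qed

end

end

section \<open>Probability estimates\<close>

locale ar_permanental = ar_weights x + prob_space M
  for x :: "nat \<Rightarrow> real" and M :: "'a measure" +
  fixes f :: "nat \<Rightarrow> real" and \<alpha> :: real and Z :: "nat \<Rightarrow> 'a \<Rightarrow> real"
  assumes \<alpha>: "0 < \<alpha>" and perm: "permanental_sequence M \<alpha> (\<lambda>j k. ar_cov x j k + f k) Z"
    and conc: "concave_wrt f"
begin

lemma Z_measurable: "1 \<le> j \<Longrightarrow> Z j \<in> borel_measurable M"
  using perm by (simp add: permanental_sequence_def)

lemma Z_nonneg: "1 \<le> j \<Longrightarrow> \<omega> \<in> space M \<Longrightarrow> 0 \<le> Z j \<omega>"
  using perm by (simp add: permanental_sequence_def)

lemma Z_events: "1 \<le> j \<Longrightarrow> {\<omega> \<in> space M. Z j \<omega> \<le> c} \<in> events" "1 \<le> j \<Longrightarrow> {\<omega> \<in> space M. c < Z j \<omega>} \<in> events"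
  using Z_measurable[of j] by measurable

lemma perm_vector:
  assumes "inj_on i {..<N}" "\<And>r. r < N \<Longrightarrow> 1 \<le> i r"
  shows "permanental_vector M \<alpha> N (\<lambda>r s. ar_cov x (i r) (i s) + f (i s)) (\<lambda>r. Z (i r))"
  using assms perm unfolding permanental_vector_def permanental_sequence_def by auto

lemma marginal:
  assumes n: "1 \<le> n" and c: "0 \<le> c"
  shows "prob {\<omega> \<in> space M. c < Z n \<omega>} = gtail \<alpha> (inverse (V n + f n)) c"
proof -
  have f0: "0 \<le> f n" using conc n by (simp add: concave_wrt_def)
  have pos: "0 < V n + f n" using V_ge_1[OF n] f0 by simp
  have v: "permanental_vector M \<alpha> 1 (\<lambda>r s. ar_cov x n n + f n) (\<lambda>r. Z n)"
    using perm_vector[of "\<lambda>_. n" 1] n by (simp add: inj_on_def)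
  have "prob {\<omega> \<in> space M. Z n \<omega> \<le> c} = gexp \<alpha> (inverse (V n + f n)) (indicator {..c})"
  proof (rule gamma_marginal[OF Z_measurable[OF n] Z_nonneg[OF n] \<alpha> pos c])
    fix s :: real assume s: "0 < s"
    have "expectation (\<lambda>\<omega>. exp (- (\<Sum>i<1::nat. s * Z n \<omega>)))
        = Determinant.det (1\<^sub>m 1 + fmat 1 (\<lambda>r s. V n + f n) * mat_diag 1 (\<lambda>_. s)) powr - \<alpha>"
      using v s unfolding permanental_vector_def by (elim conjE allE[of _ "\<lambda>_. s"]) simp
    also have "Determinant.det (1\<^sub>m 1 + fmat 1 (\<lambda>r s. V n + f n) * mat_diag 1 (\<lambda>_. s)) = 1 + (V n + f n) * s"
      by (subst det_single) (auto simp: scalar_prod_def mat_diag_def)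
    finally show "expectation (\<lambda>\<omega>. exp (- (s * Z n \<omega>))) = (1 + (V n + f n) * s) powr - \<alpha>" by simp
  qed
  also have "\<dots> = 1 - gtail \<alpha> (inverse (V n + f n)) c"
    using \<alpha> pos by (intro gexp_atMost) auto
  finally have "prob {\<omega> \<in> space M. Z n \<omega> \<le> c} = 1 - gtail \<alpha> (inverse (V n + f n)) c" .
  moreover have "prob {\<omega> \<in> space M. c < Z n \<omega>} = 1 - prob {\<omega> \<in> space M. Z n \<omega> \<le> c}"
    using prob_compl[OF Z_events(1)[OF n, of c]] by (simp add: set_diff_eq not_le conj_commute cong: conj_cong)
  ultimately show ?thesis by simp
qed

text \<open>The diagonal of the exact inverse lies below that of the unperturbed one, so the latter
  may serve as rates in \<open>permanental_vector_lower\<close>.\<close>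

lemma joint_lower:
  assumes i: "\<And>r. Suc r < N \<Longrightarrow> i r < i (Suc r)" "\<And>r. r < N \<Longrightarrow> 1 \<le> i r" and c: "\<And>r. r < N \<Longrightarrow> 0 \<le> c r"
  shows "prob {\<omega> \<in> space M. \<forall>r<N. Z (i r) \<omega> \<le> c r} \<le> (\<Prod>r<N. 1 - gtail \<alpha> ((b (i r))\<^sup>2 * tri N i r r) (c r))"
proof -
  have im_less: "i r < i s" if "r < s" "s < N" for r s
    using i_mono[of N i r s] i that by blast
  have inj: "inj_on i {..<N}"
  proof (rule inj_onI)
    fix r s assume "r \<in> {..<N}" "s \<in> {..<N}" "i r = i s"
    then show "r = s" using im_less[of r s] im_less[of s r] by (cases r s rule: linorder_cases) auto
  qed
  have PI: "m_inverse N (pert_inverse N i f) (\<lambda>r s. ar_cov x (i r) (i s) + f (i s))"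
    using pert_inverse(1)[of N i f] i conc by blast
  have PI2: "pert_inverse N i f r s \<le> b (i r) * b (i s) * tri N i r s" if "r < N" "s < N" for r s
    using pert_inverse(2)[of N i f r s] i conc that by blast
  have d: "0 < (b (i r))\<^sup>2 * tri N i r r" if "r < N" for r
  proof -
    have "0 < gap i r" "Suc r < N \<Longrightarrow> 0 < gap i (Suc r)"
      using gap_pos[of N i r] gap_pos[of N i "Suc r"] i that by auto
    then have "0 < tri N i r r" by (auto simp: tri_def intro!: add_pos_pos)
    then show ?thesis using b_pos[of "i r"] by simp
  qed
  have "prob {\<omega> \<in> space M. \<forall>r<N. Z (i r) \<omega> \<le> c r} \<le> (\<Prod>r<N. gexp \<alpha> ((b (i r))\<^sup>2 * tri N i r r) (indicator {..c r}))"
  proof (rule permanental_vector_lower[OF _ \<alpha> PI d _ c])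
    show "permanental_vector M \<alpha> N (\<lambda>r s. ar_cov x (i r) (i s) + f (i s)) (\<lambda>r. Z (i r))"
      using inj i(2) by (rule perm_vector)
    show "pert_inverse N i f r r \<le> (b (i r))\<^sup>2 * tri N i r r" if "r < N" for r
      using PI2[OF that that] by (simp add: power2_eq_square)
  qed
  also have "\<dots> = (\<Prod>r<N. 1 - gtail \<alpha> ((b (i r))\<^sup>2 * tri N i r r) (c r))"
    using d \<alpha> by (intro prod.cong refl gexp_atMost) auto
  finally show ?thesis .
qed

text \<open>For half the square of a Brownian motion run for time \<open>g = A n - A j\<close>, the
  conditional Laplace transform at \<open>\<sigma>\<close> is \<open>exp\<close> of
  \<open>- \<sigma> / (1 + \<sigma> * g)\<close> times the starting value, up to a prefactor below
  \<open>1\<close>. The inequality keeps the exponential and bounds the prefactor by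
  \<open>1\<close>.\<close>

lemma conditional_upper:
  assumes j: "1 \<le> l" "l \<le> j" "j < n" and c: "0 \<le> c" and \<sigma>: "0 < \<sigma>"
  defines "E \<equiv> {\<omega> \<in> space M. (\<forall>i\<in>{l..<j}. (b i)\<^sup>2 * Z i \<omega> \<le> c) \<and> c < (b j)\<^sup>2 * Z j \<omega>}"
  shows "0 \<le> expectation (\<lambda>\<omega>. indicator E \<omega> *
    (exp (- (\<sigma> / (1 + \<sigma> * (A n - A j))) * ((b j)\<^sup>2 * Z j \<omega>)) - exp (- \<sigma> * ((b n)\<^sup>2 * Z n \<omega>))))"
proof -
  define m where "m = j - l"
  \<comment> \<open>Consecutive indices from \<open>l\<close> to \<open>j\<close>, then a jump:
    positions \<open>m\<close> and \<open>Suc m\<close> carry \<open>j\<close> and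
    \<open>n\<close>.\<close>
  define i where "i r = (if r \<le> m then l + r else n)" for r
  define N where "N = Suc (Suc m)"
  define T where "T = pert_inverse N i f"
  define g where "g = A n - A j"
  have im: "i m = j" "i (Suc m) = n" using j by (auto simp: i_def m_def)
  have i: "\<And>r. Suc r < N \<Longrightarrow> i r < i (Suc r)" "\<And>r. r < N \<Longrightarrow> 1 \<le> i r"
    using j by (auto simp: i_def N_def m_def)
  have im_less: "i r < i s" if "r < s" "s < N" for r s
    using i_mono[of N i r s] i that by blast
  have inj: "inj_on i {..<N}"
  proof (rule inj_onI)
    fix r s assume "r \<in> {..<N}" "s \<in> {..<N}" "i r = i s"
    then show "r = s" using im_less[of r s] im_less[of s r] by (cases r s rule: linorder_cases) auto
  qed
  have PI: "m_inverse N (pert_inverse N i f) (\<lambda>r s. ar_cov x (i r) (i s) + f (i s))"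
    using pert_inverse(1)[of N i f] i conc by blast
  have PI2: "pert_inverse N i f r s \<le> b (i r) * b (i s) * tri N i r s" if "r < N" "s < N" for r s
    using pert_inverse(2)[of N i f r s] i conc that by blast
  have mN: "m < N" "Suc m < N" by (simp_all add: N_def)
  have g: "0 < g" using A_strict_mono j by (simp add: g_def)
  have gap: "gap i (Suc m) = g" by (simp add: gap_def pre_def im g_def)
  have bj: "0 < b j" "0 < b n" using b_pos by auto
  have T: "m_inverse N T (\<lambda>r s. ar_cov x (i r) (i s) + f (i s))"
    unfolding T_def by (rule PI)
  have tri: "tri N i (Suc m) (Suc m) = 1 / g" "tri N i m (Suc m) = - 1 / g" "tri N i (Suc m) m = - 1 / g"
    by (simp_all add: tri_def N_def gap)
  have Tnn: "T (Suc m) (Suc m) \<le> (b n)\<^sup>2 / g"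
    using PI2[of "Suc m" "Suc m"] tri mN by (simp add: T_def im power2_eq_square)
  have Tmn: "T m (Suc m) \<le> - (b j * b n / g)"
    using PI2[of m "Suc m"] tri mN by (simp add: T_def im)
  have Tnm: "T (Suc m) m \<le> - (b j * b n / g)"
    using PI2[of "Suc m" m] tri mN by (simp add: T_def im mult.commute)
  have Tpos: "0 < T (Suc m) (Suc m)"
    using m_inverse_schur(1)[of "Suc m" T] T by (simp add: N_def)
  define s0 where "s0 = \<sigma> * (b n)\<^sup>2"
  define s1 where "s1 = \<sigma> / (1 + \<sigma> * g) * (b j)\<^sup>2"
  have s0: "0 < s0" and s1: "0 \<le> s1" using \<sigma> bj g by (auto simp: s0_def s1_def)
  \<comment> \<open>Equality holds for the unperturbed tridiagonal entries. The perturbation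
    enlarges the two off-diagonal entries in absolute value and lowers the pivot, and both move the
    right-hand side up.\<close>
  have s1_le: "s1 \<le> T m (Suc m) * T (Suc m) m * (s0 / (T (Suc m) (Suc m) * (T (Suc m) (Suc m) + s0)))"
  proof -
    have "s1 = (b j * b n / g) * (b j * b n / g) * (s0 / ((b n)\<^sup>2 / g * ((b n)\<^sup>2 / g + s0)))"
    proof -
      define B where "B = (b n)\<^sup>2"
      define P where "P = 1 + \<sigma> * g"
      have pos: "0 < B" "0 < P" using bj g \<sigma> by (auto simp: B_def P_def add_pos_pos)
      have "B / g + s0 = B * P / g" using g by (simp add: s0_def B_def P_def field_simps)
      then have "s0 / (B / g * (B / g + s0)) = \<sigma> * B / (B / g * (B * P / g))" by (simp add: s0_def B_def)
      also have "\<dots> = \<sigma> * g * g / (B * P)" using pos g by (simp add: field_simps)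
      finally have "(b j * b n / g) * (b j * b n / g) * (s0 / (B / g * (B / g + s0))) = (b j)\<^sup>2 * B / (g * g) * (\<sigma> * g * g / (B * P))"
        by (simp add: B_def power2_eq_square)
      also have "\<dots> = s1" using pos g by (simp add: s1_def P_def)
      finally show ?thesis by (simp add: B_def)
    qed
    also have "\<dots> \<le> T m (Suc m) * T (Suc m) m * (s0 / (T (Suc m) (Suc m) * (T (Suc m) (Suc m) + s0)))"
    proof (rule mult_mono)
      have "(b j * b n / g) * (b j * b n / g) \<le> (- T m (Suc m)) * (- T (Suc m) m)"
      proof -
        have "0 \<le> b j * b n / g" using bj g by simp
        then show ?thesis by (intro mult_mono) (use Tmn Tnm in linarith)+
      qed
      then show "(b j * b n / g) * (b j * b n / g) \<le> T m (Suc m) * T (Suc m) m" by simp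
      have "T (Suc m) (Suc m) * (T (Suc m) (Suc m) + s0) \<le> (b n)\<^sup>2 / g * ((b n)\<^sup>2 / g + s0)"
        using Tnn Tpos s0 by (intro mult_mono) auto
      then show "s0 / ((b n)\<^sup>2 / g * ((b n)\<^sup>2 / g + s0)) \<le> s0 / (T (Suc m) (Suc m) * (T (Suc m) (Suc m) + s0))"
        using Tpos s0 bj g by (intro divide_left_mono mult_pos_pos add_pos_pos divide_pos_pos) auto
      have "0 \<le> (b j * b n / g) * (b j * b n / g)" by (rule zero_le_square)
      then show "0 \<le> T m (Suc m) * T (Suc m) m"
        using \<open>(b j * b n / g) * (b j * b n / g) \<le> T m (Suc m) * T (Suc m) m\<close> by linarith
      show "0 \<le> s0 / ((b n)\<^sup>2 / g * ((b n)\<^sup>2 / g + s0))" using s0 g by simp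
    qed
    finally show ?thesis .
  qed
  have "0 \<le> expectation (\<lambda>\<omega>. indicator {\<omega>. (\<forall>r<m. Z (i r) \<omega> \<le> c / (b (i r))\<^sup>2) \<and> c / (b (i m))\<^sup>2 < Z (i m) \<omega>} \<omega> *
    (exp (- s1 * Z (i m) \<omega>) - exp (- s0 * Z (i (Suc m)) \<omega>)))"
  proof (rule permanental_vector_upper[OF _ _ \<alpha> _ refl s0 s1 s1_le])
    show "permanental_vector M \<alpha> (Suc (Suc m)) (\<lambda>r s. ar_cov x (i r) (i s) + f (i s)) (\<lambda>r. Z (i r))"
      using perm_vector[OF inj i(2)] by (simp add: N_def)
    show "permanental_vector M \<alpha> (Suc m) (\<lambda>r s. ar_cov x (i r) (i s) + f (i s)) (\<lambda>r. Z (i r))"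
      using i by (intro perm_vector inj_on_subset[OF inj]) (auto simp: N_def)
    show "m_inverse (Suc (Suc m)) T (\<lambda>r s. ar_cov x (i r) (i s) + f (i s))" using T by (simp add: N_def)
    show "0 \<le> c / (b (i r))\<^sup>2" for r using c by simp
  qed
  also have "\<dots> = expectation (\<lambda>\<omega>. indicator E \<omega> *
    (exp (- (\<sigma> / (1 + \<sigma> * (A n - A j))) * ((b j)\<^sup>2 * Z j \<omega>)) - exp (- \<sigma> * ((b n)\<^sup>2 * Z n \<omega>))))"
  proof (rule Bochner_Integration.integral_cong[OF refl])
    fix \<omega> assume \<omega>: "\<omega> \<in> space M"
    have sc: "Z t \<omega> \<le> c / (b t)\<^sup>2 \<longleftrightarrow> (b t)\<^sup>2 * Z t \<omega> \<le> c" for t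
      using b_pos[of t] by (simp add: pos_le_divide_eq mult.commute)
    have "(\<forall>r<m. Z (i r) \<omega> \<le> c / (b (i r))\<^sup>2) \<longleftrightarrow> (\<forall>t\<in>{l..<j}. (b t)\<^sup>2 * Z t \<omega> \<le> c)"
    proof
      assume H: "\<forall>r<m. Z (i r) \<omega> \<le> c / (b (i r))\<^sup>2"
      show "\<forall>t\<in>{l..<j}. (b t)\<^sup>2 * Z t \<omega> \<le> c"
      proof
        fix t assume "t \<in> {l..<j}"
        then have "t - l < m" "i (t - l) = t" by (auto simp: m_def i_def)
        then show "(b t)\<^sup>2 * Z t \<omega> \<le> c" using H sc by metis
      qed
    next
      assume H: "\<forall>t\<in>{l..<j}. (b t)\<^sup>2 * Z t \<omega> \<le> c"
      show "\<forall>r<m. Z (i r) \<omega> \<le> c / (b (i r))\<^sup>2"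
      proof (intro allI impI)
        fix r assume "r < m"
        then have "i r \<in> {l..<j}" by (auto simp: m_def i_def)
        then show "Z (i r) \<omega> \<le> c / (b (i r))\<^sup>2" using H sc by blast
      qed
    qed
    moreover have "c / (b (i m))\<^sup>2 < Z (i m) \<omega> \<longleftrightarrow> c < (b j)\<^sup>2 * Z j \<omega>"
      using sc[of j] by (simp add: im not_le[symmetric])
    ultimately have "indicat_real {\<omega>. (\<forall>r<m. Z (i r) \<omega> \<le> c / (b (i r))\<^sup>2) \<and> c / (b (i m))\<^sup>2 < Z (i m) \<omega>} \<omega> = indicator E \<omega>"
      using \<omega> by (simp add: E_def indicator_def)
    then show "indicat_real {\<omega>. (\<forall>r<m. Z (i r) \<omega> \<le> c / (b (i r))\<^sup>2) \<and> c / (b (i m))\<^sup>2 < Z (i m) \<omega>} \<omega> *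
        (exp (- s1 * Z (i m) \<omega>) - exp (- s0 * Z (i (Suc m)) \<omega>))
      = indicator E \<omega> * (exp (- (\<sigma> / (1 + \<sigma> * (A n - A j))) * ((b j)\<^sup>2 * Z j \<omega>)) - exp (- \<sigma> * ((b n)\<^sup>2 * Z n \<omega>)))"
      by (simp add: im s0_def s1_def g_def mult.assoc)
  qed
  finally show ?thesis .
qed

text \<open>Ottaviani's inequality: by the previous lemma and Markov's inequality, after the first
  exceedance of \<open>c\<close> the value at \<open>n\<close> is below \<open>c'\<close> with conditional probability at most \<open>1 / 2\<close>.\<close>

lemma block_max:
  assumes l: "1 \<le> l" "l \<le> n" and c: "0 \<le> c" "c' < c" and \<sigma>: "0 < \<sigma>" and G: "A n - A l \<le> G"
    and half: "\<sigma> * c' - \<sigma> * c / (1 + \<sigma> * G) \<le> - ln 2"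
  shows "prob {\<omega> \<in> space M. \<exists>j\<in>{l..n}. c < (b j)\<^sup>2 * Z j \<omega>} \<le> 2 * prob {\<omega> \<in> space M. c' < (b n)\<^sup>2 * Z n \<omega>}"
proof -
  define E where "E j = {\<omega> \<in> space M. (\<forall>i\<in>{l..<j}. (b i)\<^sup>2 * Z i \<omega> \<le> c) \<and> c < (b j)\<^sup>2 * Z j \<omega>}" for j
  define H where "H = {\<omega> \<in> space M. c' < (b n)\<^sup>2 * Z n \<omega>}"
  have [measurable]: "Z i \<in> borel_measurable M" if "i \<in> {l..n}" for i using Z_measurable that l by simp
  have nm: "Z n \<in> borel_measurable M" using Z_measurable l by simp
  have Em: "E j \<in> events" if "j \<in> {l..n}" for j
  proof -
    have "{\<omega> \<in> space M. (b i)\<^sup>2 * Z i \<omega> \<le> c} \<in> events" if "i \<in> {l..n}" for i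
      using Z_measurable[of i] that l by measurable
    moreover have "{\<omega> \<in> space M. c < (b j)\<^sup>2 * Z j \<omega>} \<in> events" using Z_measurable[of j] that l by measurable
    ultimately show ?thesis unfolding E_def using that
      by (intro sets.sets_Collect_conj sets.sets_Collect_finite_All) auto
  qed
  have Hm: "H \<in> events" unfolding H_def using nm by measurable
  have step: "prob (E j) \<le> 2 * prob (E j \<inter> H)" if j: "j \<in> {l..n}" for j
  proof (cases "j = n")
    case True
    then have "E j \<subseteq> H" using c by (auto simp: E_def H_def)
    then show ?thesis by (simp add: Int_absorb2)
  next
    case False
    then have jn: "1 \<le> l" "l \<le> j" "j < n" using j l by auto
    define \<sigma>' where "\<sigma>' = \<sigma> / (1 + \<sigma> * (A n - A j))"
    have Aj: "0 \<le> A n - A j" "A n - A j \<le> G"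
      using A_strict_mono[OF jn(3)] G A_strict_mono[of l j] jn(2) by (cases "l = j"; simp)+
    have jm: "Z j \<in> borel_measurable M" using Z_measurable jn by simp
    have \<sigma>'0: "0 \<le> \<sigma>'" using \<sigma> Aj by (simp add: \<sigma>'_def)
    have int: "integrable M (\<lambda>\<omega>. indicat_real (E j) \<omega> * exp (- t * ((b i)\<^sup>2 * Z i \<omega>)))" if "0 \<le> t" "i \<in> {l..n}" for t i
    proof (rule integrable_const_bound[where B = 1])
      show "AE \<omega> in M. norm (indicat_real (E j) \<omega> * exp (- t * ((b i)\<^sup>2 * Z i \<omega>))) \<le> 1"
        using Z_nonneg[of i] that l by (intro AE_I2) (auto simp: indicator_def)
      show "(\<lambda>\<omega>. indicat_real (E j) \<omega> * exp (- t * ((b i)\<^sup>2 * Z i \<omega>))) \<in> borel_measurable M"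
        using Em[OF j] Z_measurable[of i] that l by measurable
    qed
    have "0 \<le> expectation (\<lambda>\<omega>. indicat_real (E j) \<omega> * (exp (- \<sigma>' * ((b j)\<^sup>2 * Z j \<omega>)) - exp (- \<sigma> * ((b n)\<^sup>2 * Z n \<omega>))))"
      using conditional_upper[OF jn c(1) \<sigma>] by (simp only: E_def \<sigma>'_def)
    also have "\<dots> = expectation (\<lambda>\<omega>. indicat_real (E j) \<omega> * exp (- \<sigma>' * ((b j)\<^sup>2 * Z j \<omega>))) -
        expectation (\<lambda>\<omega>. indicat_real (E j) \<omega> * exp (- \<sigma> * ((b n)\<^sup>2 * Z n \<omega>)))"
      unfolding right_diff_distrib using int[OF \<sigma>'0 j] int[of \<sigma> n] \<sigma> l
      by (intro Bochner_Integration.integral_diff) auto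
    finally have 1: "expectation (\<lambda>\<omega>. indicat_real (E j) \<omega> * exp (- \<sigma> * ((b n)\<^sup>2 * Z n \<omega>)))
        \<le> expectation (\<lambda>\<omega>. indicat_real (E j) \<omega> * exp (- \<sigma>' * ((b j)\<^sup>2 * Z j \<omega>)))" by simp
    have 2: "expectation (\<lambda>\<omega>. indicat_real (E j) \<omega> * exp (- \<sigma>' * ((b j)\<^sup>2 * Z j \<omega>))) \<le> exp (- \<sigma>' * c) * prob (E j)"
    proof -
      have "expectation (\<lambda>\<omega>. indicat_real (E j) \<omega> * exp (- \<sigma>' * ((b j)\<^sup>2 * Z j \<omega>))) \<le> expectation (\<lambda>\<omega>. exp (- \<sigma>' * c) * indicat_real (E j) \<omega>)"
      proof (intro integral_mono int \<sigma>'0 j)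
        show "integrable M (\<lambda>\<omega>. exp (- \<sigma>' * c) * indicat_real (E j) \<omega>)"
          using Em[OF j] by (intro integrable_mult_right integrable_real_indicator) (auto simp: emeasure_eq_measure)
        fix \<omega>
        show "indicat_real (E j) \<omega> * exp (- \<sigma>' * ((b j)\<^sup>2 * Z j \<omega>)) \<le> exp (- \<sigma>' * c) * indicat_real (E j) \<omega>"
        proof (cases "\<omega> \<in> E j")
          case True
          then have "\<sigma>' * c \<le> \<sigma>' * ((b j)\<^sup>2 * Z j \<omega>)" using \<sigma>'0 by (intro mult_left_mono) (auto simp: E_def)
          then show ?thesis using True by simp
        qed simp
      qed
      also have "\<dots> = exp (- \<sigma>' * c) * prob (E j)" using Em[OF j] by simp
      finally show ?thesis .
    qed
    have 3: "exp (- \<sigma> * c') * prob (E j - H) \<le> expectation (\<lambda>\<omega>. indicat_real (E j) \<omega> * exp (- \<sigma> * ((b n)\<^sup>2 * Z n \<omega>)))"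
    proof -
      have "exp (- \<sigma> * c') * prob (E j - H) = expectation (\<lambda>\<omega>. exp (- \<sigma> * c') * indicat_real (E j - H) \<omega>)"
        using Em[OF j] Hm by simp
      also have "\<dots> \<le> expectation (\<lambda>\<omega>. indicat_real (E j) \<omega> * exp (- \<sigma> * ((b n)\<^sup>2 * Z n \<omega>)))"
      proof (rule integral_mono)
        show "integrable M (\<lambda>\<omega>. exp (- \<sigma> * c') * indicat_real (E j - H) \<omega>)"
          using Em[OF j] Hm by (intro integrable_mult_right integrable_real_indicator) (auto simp: emeasure_eq_measure)
        show "integrable M (\<lambda>\<omega>. indicat_real (E j) \<omega> * exp (- \<sigma> * ((b n)\<^sup>2 * Z n \<omega>)))"
          using \<sigma> l by (intro int) auto
        fix \<omega> assume \<omega>: "\<omega> \<in> space M"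
        show "exp (- \<sigma> * c') * indicat_real (E j - H) \<omega> \<le> indicat_real (E j) \<omega> * exp (- \<sigma> * ((b n)\<^sup>2 * Z n \<omega>))"
        proof (cases "\<omega> \<in> E j - H")
          case True
          then have "\<sigma> * ((b n)\<^sup>2 * Z n \<omega>) \<le> \<sigma> * c'" using \<sigma> \<omega> by (intro mult_left_mono) (auto simp: H_def)
          then show ?thesis using True by simp
        qed simp
      qed
      finally show ?thesis .
    qed
    \<comment> \<open>The values at \<open>n\<close> are at most \<open>c'\<close> off
      \<open>H\<close>, those at \<open>j\<close> exceed \<open>c\<close> on \<open>E j\<close>, and
      \<open>conditional_upper\<close> links the two. What remains is a factor
      \<open>exp (\<sigma> * c' - \<sigma>' * c)\<close>, and \<open>half\<close> makes it at most
      \<open>1 / 2\<close>.\<close>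
    have "exp (- \<sigma> * c') * prob (E j - H) \<le> exp (- \<sigma>' * c) * prob (E j)" using 1 2 3 by linarith
    then have "exp (\<sigma> * c') * (exp (- \<sigma> * c') * prob (E j - H)) \<le> exp (\<sigma> * c') * (exp (- \<sigma>' * c) * prob (E j))"
      by (intro mult_left_mono) auto
    then have "prob (E j - H) \<le> exp (\<sigma> * c' - \<sigma>' * c) * prob (E j)"
      by (simp add: exp_diff exp_minus field_simps)
    also have "\<dots> \<le> (1 / 2) * prob (E j)"
    proof (rule mult_right_mono)
      have "\<sigma> * c / (1 + \<sigma> * G) \<le> \<sigma>' * c"
        unfolding \<sigma>'_def times_divide_eq_left using \<sigma> c Aj
        by (intro divide_left_mono mult_nonneg_nonneg mult_pos_pos add_pos_nonneg add_left_mono mult_left_mono) auto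
      then have "\<sigma> * c' - \<sigma>' * c \<le> - ln 2" using half by linarith
      then have "exp (\<sigma> * c' - \<sigma>' * c) \<le> exp (- ln 2)" by simp
      then show "exp (\<sigma> * c' - \<sigma>' * c) \<le> 1 / 2" by (simp add: exp_minus)
    qed simp
    finally have "prob (E j - H) \<le> (1 / 2) * prob (E j)" .
    moreover have "prob (E j) = prob (E j \<inter> H) + prob (E j - H)"
      using Em[OF j] Hm by (simp add: finite_measure_Diff' finite_measure_mono)
    ultimately show ?thesis by simp
  qed
  have disj: "disjoint_family_on E {l..n}"
    unfolding disjoint_family_on_def
  proof (intro ballI impI)
    fix i j assume "i \<in> {l..n}" "j \<in> {l..n}" "i \<noteq> j"
    then consider "i \<in> {l..<j}" | "j \<in> {l..<i}" by fastforce
    then show "E i \<inter> E j = {}" by cases (force simp: E_def)+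
  qed
  have union: "{\<omega> \<in> space M. \<exists>j\<in>{l..n}. c < (b j)\<^sup>2 * Z j \<omega>} = (\<Union>j\<in>{l..n}. E j)"
  proof (intro equalityI subsetI)
    fix \<omega>
    define Q where "Q j \<longleftrightarrow> j \<in> {l..n} \<and> c < (b j)\<^sup>2 * Z j \<omega>" for j
    assume "\<omega> \<in> {\<omega> \<in> space M. \<exists>j\<in>{l..n}. c < (b j)\<^sup>2 * Z j \<omega>}"
    then have \<omega>: "\<omega> \<in> space M" and ex: "\<exists>j. Q j" by (auto simp: Q_def)
    define j where "j = (LEAST j. Q j)"
    have Qj: "Q j" unfolding j_def using ex by (rule LeastI_ex)
    have "\<not> Q i" if "i < j" for i using not_less_Least that unfolding j_def .
    then have "(b i)\<^sup>2 * Z i \<omega> \<le> c" if "i \<in> {l..<j}" for i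
      using that Qj by (auto simp: Q_def not_less)
    then have "\<omega> \<in> E j" using \<omega> Qj by (simp add: E_def Q_def)
    then show "\<omega> \<in> (\<Union>j\<in>{l..n}. E j)" using Qj by (auto simp: Q_def)
  qed (auto simp: E_def)
  have "prob (\<Union>j\<in>{l..n}. E j) = (\<Sum>j\<in>{l..n}. prob (E j))"
    using Em disj by (intro finite_measure_finite_Union) auto
  also have "\<dots> \<le> (\<Sum>j\<in>{l..n}. 2 * prob (E j \<inter> H))" by (intro sum_mono step)
  also have "\<dots> = 2 * (\<Sum>j\<in>{l..n}. prob (E j \<inter> H))" by (simp add: sum_distrib_left)
  also have "(\<Sum>j\<in>{l..n}. prob (E j \<inter> H)) = prob (\<Union>j\<in>{l..n}. E j \<inter> H)"
    using Em Hm disj by (intro finite_measure_finite_Union[symmetric]) (auto simp: disjoint_family_on_def)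
  also have "\<dots> \<le> prob H" using Hm by (intro finite_measure_mono) auto
  finally show ?thesis unfolding union H_def by simp
qed

end

section \<open>The law of the iterated logarithm\<close>

context ar_permanental
begin

lemma ev_A_index:
  assumes "\<forall>\<^sub>F n in sequentially. P n" "1 < (\<theta>::real)"
  shows "\<forall>\<^sub>F k in sequentially. \<forall>n. \<theta> ^ k \<le> A n \<longrightarrow> P n"
proof -
  obtain N where N: "\<And>n. N \<le> n \<Longrightarrow> P n" using assms(1) by (auto simp: eventually_sequentially)
  obtain K where K: "A N < \<theta> ^ K" using real_arch_pow[OF assms(2)] by blast
  have "\<forall>\<^sub>F k in sequentially. A N < \<theta> ^ k"
    using eventually_ge_at_top[of K]
  proof eventually_elim
    case (elim k)
    then have "\<theta> ^ K \<le> \<theta> ^ k" using assms(2) by (intro power_increasing) auto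
    then show ?case using K by simp
  qed
  then show ?thesis
  proof eventually_elim
    case (elim k)
    show ?case
    proof (intro allI impI)
      fix n assume "\<theta> ^ k \<le> A n"
      then have "A N < A n" using elim by simp
      then have "N \<le> n" using A_strict_mono[of n N] by (cases "N \<le> n") auto
      then show "P n" by (rule N)
    qed
  qed
qed

text \<open>The scale of the rescaled marginal is \<open>(b n)\<^sup>2 * (V n + f n)\<close>,
  written here so that the small quotient \<open>f n / V n\<close> appears.\<close>

lemma scaled_marginal:
  assumes n: "1 \<le> n" and c: "0 \<le> c" and \<epsilon>: "0 < \<epsilon>" "\<epsilon> < 1"
  shows "prob {\<omega> \<in> space M. c < (b n)\<^sup>2 * Z n \<omega>} \<le> \<epsilon> powr - \<alpha> * exp (- (1 - \<epsilon>) * (c / (A n * (1 + f n / V n))))"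
proof -
  have f0: "0 \<le> f n" using conc n by (simp add: concave_wrt_def)
  have V: "0 < V n" using V_ge_1[OF n] by simp
  have "{\<omega> \<in> space M. c < (b n)\<^sup>2 * Z n \<omega>} = {\<omega> \<in> space M. c / (b n)\<^sup>2 < Z n \<omega>}"
    using b_pos[of n] by (simp add: pos_divide_less_eq mult.commute)
  then have "prob {\<omega> \<in> space M. c < (b n)\<^sup>2 * Z n \<omega>} = gtail \<alpha> (inverse (V n + f n)) (c / (b n)\<^sup>2)"
    using marginal[OF n, of "c / (b n)\<^sup>2"] c by simp
  also have "\<dots> \<le> \<epsilon> powr - \<alpha> * exp (- (1 - \<epsilon>) * (inverse (V n + f n) * (c / (b n)\<^sup>2)))"
    using \<alpha> V f0 \<epsilon> by (intro gtail_upper) auto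
  also have "inverse (V n + f n) * (c / (b n)\<^sup>2) = c / (A n * (1 + f n / V n))"
  proof -
    have "A n * (1 + f n / V n) = (b n)\<^sup>2 * (V n + f n)"
      using V V_b[OF n] by (simp add: field_simps flip: V_b[OF n])
    then show ?thesis by (simp add: divide_inverse)
  qed
  finally show ?thesis .
qed

text \<open>First Borel-Cantelli lemma over the blocks
  \<open>\<theta> ^ k \<le> A j < \<theta> ^ Suc k\<close>: on each block \<open>block_max\<close>
  reduces the maximum to the value at the last index, whose law is an explicit gamma law.\<close>

lemma AE_upper:
  assumes fV: "(\<lambda>j. f j / V j) \<longlonglongrightarrow> 0" and \<eta>: "0 < \<eta>" "\<eta> \<le> 1 / 8"
  shows "AE \<omega> in M. \<forall>\<^sub>F j in sequentially. (b j)\<^sup>2 * Z j \<omega> \<le> (1 + 8 * \<eta>) * (A j * LL j)"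
proof -
  define \<theta> where "\<theta> = 1 + \<eta>"
  have \<theta>: "1 < \<theta>" using \<eta> by (simp add: \<theta>_def)
  define l where "l k = ln (real k * ln \<theta>)" for k
  define c where "c k = (1 + 8 * \<eta>) * (\<theta> ^ k * l k)" for k
  \<comment> \<open>Four losses each cost a factor of about \<open>1 - \<eta>\<close>: the lowered
    level in \<open>block_max\<close>, \<open>gtail_upper\<close> with
    \<open>\<epsilon> = \<eta>\<close>, the growth of \<open>A\<close> within a block, and
    \<open>f n / V n \<le> \<eta>\<close>. The surplus \<open>8 * \<eta>\<close> outweighs them, and
    the exponent of the block probabilities stays above \<open>1\<close>.\<close>
  define \<rho> where "\<rho> = (1 - \<eta>)\<^sup>2 * (1 + 8 * \<eta>) / (1 + \<eta>)\<^sup>2"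
  have \<rho>: "1 < \<rho>"
  proof -
    have "(1 - \<eta>)\<^sup>2 * (1 + 8 * \<eta>) - (1 + \<eta>)\<^sup>2 = 4 * \<eta> * (1 - 4 * \<eta> + 2 * \<eta>\<^sup>2)"
      by (simp add: power2_eq_square algebra_simps)
    moreover have "0 < 4 * \<eta> * (1 - 4 * \<eta> + 2 * \<eta>\<^sup>2)"
      using \<eta> by (intro mult_pos_pos add_pos_nonneg) auto
    ultimately show ?thesis using \<eta> by (simp add: \<rho>_def less_divide_eq)
  qed
  define B where "B k = {\<omega> \<in> space M. \<exists>j. 1 \<le> j \<and> \<theta> ^ k \<le> A j \<and> A j < \<theta> ^ Suc k \<and> c k < (b j)\<^sup>2 * Z j \<omega>}" for k
  have Bm: "B k \<in> events" for k
  proof -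
    have "{\<omega> \<in> space M. 1 \<le> j \<and> \<theta> ^ k \<le> A j \<and> A j < \<theta> ^ Suc k \<and> c k < (b j)\<^sup>2 * Z j \<omega>} \<in> events" for j
      using Z_measurable[of j] by (cases "1 \<le> j") auto
    then show ?thesis unfolding B_def by (rule sets.sets_Collect_countable_Ex)
  qed
  have l_top: "filterlim l at_top sequentially"
    unfolding l_def[abs_def] using \<theta>
    by (intro filterlim_compose[OF ln_at_top] filterlim_at_top_mult_tendsto_pos[OF tendsto_const] filterlim_real_sequentially) auto
  have ev1: "\<forall>\<^sub>F k in sequentially. \<forall>n. \<theta> ^ k \<le> A n \<longrightarrow> f n / V n \<le> \<eta>"
  proof (rule ev_A_index[OF _ \<theta>])
    show "\<forall>\<^sub>F n in sequentially. f n / V n \<le> \<eta>"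
      using order_tendstoD(2)[OF fV \<eta>(1)] by eventually_elim simp
  qed
  have ev2: "\<forall>\<^sub>F k in sequentially. max 1 (ln 2 * (1 + \<eta>) / \<eta>\<^sup>2) < l k"
    using l_top unfolding filterlim_at_top_dense by blast
  have bound: "\<forall>\<^sub>F k in sequentially. prob (B k) \<le> 2 * \<eta> powr - \<alpha> * (real k * ln \<theta>) powr - \<rho>"
    using ev1 ev2 eventually_gt_at_top[of 0]
  proof eventually_elim
    case (elim k)
    define J where "J = {j. 1 \<le> j \<and> \<theta> ^ k \<le> A j \<and> A j < \<theta> ^ Suc k}"
    obtain N :: nat where N: "\<theta> ^ Suc k < real N" using reals_Archimedean2 by blast
    have "j \<le> N" if "j \<in> J" for j
    proof -
      have "real j < real N" using A_ge[of j] that N by (simp add: J_def)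
      then show ?thesis by simp
    qed
    then have fin: "finite J" by (intro finite_subset[of J "{..N}"]) auto
    have lk: "1 < l k" "ln 2 * (1 + \<eta>) / \<eta>\<^sup>2 < l k" using elim(2) by auto
    show ?case
    proof (cases "J = {}")
      case True
      then have "B k = {}" by (auto simp: B_def J_def)
      then show ?thesis by simp
    next
      case False
      define m where "m = Min J"
      define n where "n = Max J"
      have mn: "m \<in> J" "n \<in> J" using fin False by (auto simp: m_def n_def)
      have mln: "m \<le> n" using fin mn by (simp add: m_def)
      have n1: "1 \<le> n" "1 \<le> m" using mn by (auto simp: J_def)
      \<comment> \<open>The length of the block in the scale \<open>A\<close>. With
        \<open>\<sigma> = \<eta> / G\<close> the denominator in \<open>block_max\<close> is
        \<open>1 + \<eta>\<close>, and the exponent is at most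
        \<open>- \<eta>\<^sup>2 * l k / (1 + \<eta>)\<close>; this is where the threshold in
        \<open>ev2\<close> comes from.\<close>
      define G where "G = \<theta> ^ k * \<eta>"
      have G: "0 < G" using \<theta> \<eta> by (simp add: G_def)
      have "\<theta> ^ Suc k - \<theta> ^ k = G" by (simp add: G_def \<theta>_def algebra_simps)
      then have gapG: "A n - A m \<le> G" using mn by (simp add: J_def)
      have ck: "0 < c k" using lk \<theta> \<eta> by (simp add: c_def)
      have "B k \<subseteq> {\<omega> \<in> space M. \<exists>j\<in>{m..n}. c k < (b j)\<^sup>2 * Z j \<omega>}"
      proof
        fix \<omega> assume "\<omega> \<in> B k"
        then obtain j where "\<omega> \<in> space M" "j \<in> J" "c k < (b j)\<^sup>2 * Z j \<omega>" by (auto simp: B_def J_def)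
        moreover from this have "j \<in> {m..n}" using fin by (simp add: m_def n_def)
        ultimately show "\<omega> \<in> {\<omega> \<in> space M. \<exists>j\<in>{m..n}. c k < (b j)\<^sup>2 * Z j \<omega>}" by blast
      qed
      then have "prob (B k) \<le> prob {\<omega> \<in> space M. \<exists>j\<in>{m..n}. c k < (b j)\<^sup>2 * Z j \<omega>}"
      proof (rule finite_measure_mono)
        have "{\<omega> \<in> space M. c k < (b j)\<^sup>2 * Z j \<omega>} \<in> events" if "j \<in> {m..n}" for j
          using Z_measurable[of j] that n1 by auto
        then show "{\<omega> \<in> space M. \<exists>j\<in>{m..n}. c k < (b j)\<^sup>2 * Z j \<omega>} \<in> events"
          by (intro sets.sets_Collect_finite_Ex) auto
      qed
      also have "\<dots> \<le> 2 * prob {\<omega> \<in> space M. (1 - \<eta>) * c k < (b n)\<^sup>2 * Z n \<omega>}"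
      proof (rule block_max[OF n1(2) mln less_imp_le[OF ck] _ _ gapG])
        show "(1 - \<eta>) * c k < c k" using ck \<eta> by simp
        show "0 < \<eta> / G" using \<eta> G by simp
        have "\<eta> / G * ((1 - \<eta>) * c k) - \<eta> / G * c k / (1 + \<eta> / G * G) = - (\<eta> ^ 3 / (1 + \<eta>) * (c k / G))"
        proof -
          have "1 + \<eta> \<noteq> 0" using \<eta> by simp
          then have "(1 - \<eta>) - 1 / (1 + \<eta>) = - (\<eta>\<^sup>2 / (1 + \<eta>))"
            by (simp add: field_simps power2_eq_square)
          then have "\<eta> * (c k / G) * ((1 - \<eta>) - 1 / (1 + \<eta>)) = \<eta> * (c k / G) * - (\<eta>\<^sup>2 / (1 + \<eta>))"
            by simp
          also have "\<dots> = - (\<eta> ^ 3 / (1 + \<eta>) * (c k / G))"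
            by (simp add: power3_eq_cube power2_eq_square divide_inverse mult_ac)
          finally show ?thesis using G by (simp add: divide_inverse algebra_simps)
        qed
        also have "\<dots> \<le> - ln 2"
        proof -
          have "c k / G = (1 + 8 * \<eta>) * l k / \<eta>" using \<theta> by (simp add: c_def G_def)
          moreover have "l k / \<eta> \<le> (1 + 8 * \<eta>) * l k / \<eta>"
            using \<eta> lk by (intro divide_right_mono) auto
          ultimately have "\<eta> ^ 3 / (1 + \<eta>) * (l k / \<eta>) \<le> \<eta> ^ 3 / (1 + \<eta>) * (c k / G)"
            using \<eta> by (intro mult_left_mono) auto
          moreover have "\<eta> ^ 3 / (1 + \<eta>) * (l k / \<eta>) = \<eta>\<^sup>2 * l k / (1 + \<eta>)"
            using \<eta> by (simp add: power3_eq_cube power2_eq_square)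
          moreover have "ln 2 \<le> \<eta>\<^sup>2 * l k / (1 + \<eta>)"
            using lk(2) \<eta> by (simp add: field_simps)
          ultimately show ?thesis by simp
        qed
        finally show "\<eta> / G * ((1 - \<eta>) * c k) - \<eta> / G * c k / (1 + \<eta> / G * G) \<le> - ln 2" .
      qed
      also have "prob {\<omega> \<in> space M. (1 - \<eta>) * c k < (b n)\<^sup>2 * Z n \<omega>}
          \<le> \<eta> powr - \<alpha> * exp (- (1 - \<eta>) * ((1 - \<eta>) * c k / (A n * (1 + f n / V n))))"
        using n1 ck \<eta> by (intro scaled_marginal) auto
      also have "\<dots> \<le> \<eta> powr - \<alpha> * exp (- \<rho> * l k)"
      proof -
        have fn: "f n / V n \<le> \<eta>" "0 \<le> f n / V n"
          using elim(1) mn conc n1 V_ge_1[of n] by (auto simp: J_def concave_wrt_def)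
        have "A n * (1 + f n / V n) \<le> \<theta> ^ Suc k * (1 + \<eta>)"
          using mn fn \<theta> A_pos[OF n1(1)] by (intro mult_mono) (auto simp: J_def)
        moreover have "0 < A n * (1 + f n / V n)" using fn A_pos[OF n1(1)] by (simp add: add_pos_nonneg)
        ultimately have "(1 - \<eta>) * c k / (\<theta> ^ Suc k * (1 + \<eta>)) \<le> (1 - \<eta>) * c k / (A n * (1 + f n / V n))"
          using ck \<eta> \<theta> by (intro divide_left_mono mult_pos_pos[where b = "A n * (1 + f n / V n)"]) (auto intro!: mult_pos_pos add_pos_pos)
        then have "(1 - \<eta>) * ((1 - \<eta>) * c k / (\<theta> ^ Suc k * (1 + \<eta>))) \<le> (1 - \<eta>) * ((1 - \<eta>) * c k / (A n * (1 + f n / V n)))"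
          using \<eta> by (intro mult_left_mono) auto
        moreover have "(1 - \<eta>) * ((1 - \<eta>) * c k / (\<theta> ^ Suc k * (1 + \<eta>))) = \<rho> * l k"
          using \<theta> \<eta> by (simp add: \<rho>_def c_def \<theta>_def power2_eq_square)
        ultimately have le: "\<rho> * l k \<le> (1 - \<eta>) * ((1 - \<eta>) * c k / (A n * (1 + f n / V n)))" by linarith
        have "exp (- (1 - \<eta>) * ((1 - \<eta>) * c k / (A n * (1 + f n / V n)))) \<le> exp (- \<rho> * l k)"
          unfolding mult_minus_left exp_le_cancel_iff using le by linarith
        then show ?thesis by (intro mult_left_mono) auto
      qed
      also have "exp (- \<rho> * l k) = (real k * ln \<theta>) powr - \<rho>"
        using elim(3) \<theta> by (simp add: powr_def l_def)
      finally show ?thesis by simp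
    qed
  qed
  have "summable (\<lambda>k. 2 * \<eta> powr - \<alpha> * (real k * ln \<theta>) powr - \<rho>)"
    using \<rho> by (simp add: powr_mult summable_mult2 summable_mult summable_real_powr_iff flip: mult.assoc)
  then have "summable (\<lambda>k. prob (B k))"
    by (rule summable_comparison_test_ev[rotated]) (use bound in \<open>simp\<close>)
  then have "AE \<omega> in M. \<forall>\<^sub>F k in sequentially. \<omega> \<in> space M - B k"
    using Bm by (intro borel_cantelli_AE1) (auto simp: emeasure_eq_measure)
  then show ?thesis
  proof eventually_elim
    case (elim \<omega>)
    have ev: "\<forall>\<^sub>F k in sequentially. \<omega> \<in> space M - B k \<and> 1 < l k \<and> 0 < k"
      using elim ev2 eventually_gt_at_top[of 0] by eventually_elim auto
    then obtain K where K: "\<And>k. K \<le> k \<Longrightarrow> \<omega> \<in> space M - B k \<and> 1 < l k \<and> 0 < k" by (auto simp: eventually_sequentially)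
    have "\<forall>\<^sub>F j in sequentially. \<theta> ^ K \<le> A j" using A_at_top by (simp add: filterlim_at_top)
    then show ?case using eventually_ge_at_top[of 1]
    proof eventually_elim
      case (elim j)
      define k where "k = nat \<lfloor>log \<theta> (A j)\<rfloor>"
      have A1: "1 \<le> A j" using A_ge[of j] elim(2) by simp
      have lg: "0 \<le> log \<theta> (A j)" using A1 \<theta> by simp
      then have "real k \<le> log \<theta> (A j)" "log \<theta> (A j) < real (Suc k)"
        by (auto simp: k_def) linarith+
      then have k: "\<theta> ^ k \<le> A j" "A j < \<theta> ^ Suc k"
        using \<theta> A1 le_log_of_power[of \<theta> k] by (auto simp: le_log_iff log_less_iff powr_realpow simp del: power_Suc of_nat_Suc)
      have "\<theta> ^ K < \<theta> ^ Suc k" using elim(1) k(2) by simp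
      then have "K < Suc k" using \<theta> by (simp only: power_strict_increasing_iff)
      then have Kk: "\<omega> \<in> space M - B k" "1 < l k" "0 < k" using K[of k] by auto
      have "(b j)\<^sup>2 * Z j \<omega> \<le> c k" using Kk(1) k elim(2) by (auto simp: B_def not_less)
      also have "c k \<le> (1 + 8 * \<eta>) * (A j * LL j)"
      proof -
        have "0 < real k * ln \<theta>" using Kk \<theta> by simp
        moreover have "real k * ln \<theta> \<le> ln (A j)"
        proof -
          have "real k * ln \<theta> = ln (\<theta> ^ k)" using \<theta> by (simp add: ln_realpow)
          also have "\<dots> \<le> ln (A j)" using k \<theta> by (subst ln_le_cancel_iff) (use A1 in auto)
          finally show ?thesis .
        qed
        ultimately have "l k \<le> LL j" by (simp add: l_def LL_def)
        then have "\<theta> ^ k * l k \<le> A j * LL j" using k Kk \<theta> A1 by (intro mult_mono) auto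
        then show ?thesis unfolding c_def using \<eta> by (intro mult_left_mono) auto
      qed
      finally show ?case .
    qed
  qed
qed

text \<open>A substitute for the second Borel-Cantelli lemma: \<open>joint_lower\<close> bounds the
  probability of no exceedance along a subsequence by a product, as if the coordinates were
  independent, and the tails have a divergent sum. The subsequence is so sparse that
  \<open>tri N i r r\<close> is close to \<open>1 / A (i r)\<close>.\<close>

lemma AE_lower:
  assumes \<epsilon>: "0 < \<epsilon>" "\<epsilon> < 1"
  shows "AE \<omega> in M. \<exists>\<^sub>F j in sequentially. (1 - \<epsilon>) * (V j * LL j) < Z j \<omega>"
proof -
  define C where "C = 1 + 1 / (x 1)\<^sup>2"
  \<comment> \<open>Since \<open>C * \<theta> ^ k = q * \<theta> ^ Suc k\<close>, each selected
    value of \<open>A\<close> is at most \<open>q\<close> times the next, including the overshoot by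
    \<open>C\<close> in \<open>nn_upper\<close>. The rates then exceed their ideal values by a
    factor of at most \<open>(1 + q) / (1 - q) \<le> 1 / (1 - \<epsilon>\<^sup>2)\<close>, which
    cancels the product of \<open>1 + \<epsilon>\<close> from \<open>gtail_lower\<close> and
    \<open>1 - \<epsilon>\<close> from the level.\<close>
  define q where "q = \<epsilon>\<^sup>2 / 2"
  define \<theta> where "\<theta> = C / q"
  have x1: "0 < x 1" using bounds[of 1] by simp
  have C: "1 \<le> C" using x1 by (simp add: C_def)
  have q: "0 < q" "q < 1 / 2" using \<epsilon> by (auto simp: q_def abs_square_less_1)
  have \<theta>: "C < \<theta>" "1 < \<theta>" using C q by (auto simp: \<theta>_def less_divide_eq field_simps intro: less_le_trans)
  define nn where "nn k = (LEAST n. 1 \<le> n \<and> \<theta> ^ k \<le> A n)" for k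
  have ex: "\<exists>n. 1 \<le> n \<and> \<theta> ^ k \<le> A n" for k
  proof -
    obtain n :: nat where "\<theta> ^ k \<le> real n" using real_arch_simple by blast
    then show ?thesis using A_ge[of "Suc n"] by (intro exI[of _ "Suc n"]) auto
  qed
  have nn: "1 \<le> nn k" "\<theta> ^ k \<le> A (nn k)" for k
    using LeastI_ex[OF ex[of k]] by (auto simp: nn_def)
  have nn_upper: "A (nn k) \<le> C * \<theta> ^ k" for k
  proof (cases "nn k = 1")
    case True
    have "1 * 1 \<le> C * \<theta> ^ k" using C \<theta> by (intro mult_mono one_le_power) auto
    then show ?thesis using True by (simp add: A_Suc A_0 b_1)
  next
    case False
    then obtain n where n: "nn k = Suc n" "1 \<le> n" using nn(1)[of k] by (cases "nn k") auto
    have "\<not> (1 \<le> n \<and> \<theta> ^ k \<le> A n)" using not_less_Least[of n "\<lambda>n. 1 \<le> n \<and> \<theta> ^ k \<le> A n"] n(1) by (simp add: nn_def)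
    then have "A n \<le> \<theta> ^ k" using n(2) by simp
    then have "C * A n \<le> C * \<theta> ^ k" using C by (intro mult_left_mono) auto
    then show ?thesis using A_ratio[OF n(2)] n(1) by (simp add: C_def)
  qed
  have nn_less: "nn k < nn (Suc k)" for k
  proof (rule ccontr)
    assume "\<not> nn k < nn (Suc k)"
    then have "A (nn (Suc k)) \<le> A (nn k)" using A_strict_mono[of "nn (Suc k)" "nn k"] by (cases "nn (Suc k) = nn k") auto
    also have "\<dots> \<le> C * \<theta> ^ k" by (rule nn_upper)
    also have "\<dots> < \<theta> * \<theta> ^ k" using \<theta> by (intro mult_strict_right_mono) auto
    finally show False using nn(2)[of "Suc k"] by simp
  qed
  have nn_ge: "k \<le> nn k" for k
    using strict_mono_imp_increasing[of nn k] nn_less by (simp add: strict_mono_Suc_iff)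
  obtain \<kappa> where \<kappa>: "0 < \<kappa>" "\<And>d c. 0 < d \<Longrightarrow> 1 \<le> d * c \<Longrightarrow> \<kappa> * exp (- (1 + \<epsilon>) * (d * c)) \<le> gtail \<alpha> d c"
    using gtail_lower[OF \<alpha> \<epsilon>(1)] by blast
  define c where "c k = (1 - \<epsilon>) * (V (nn k) * LL (nn k))" for k
  \<comment> \<open>An upper bound for \<open>ln (A (nn k))\<close>, linear in \<open>k\<close>, so
    that its reciprocals have a divergent sum.\<close>
  define w where "w k = ln C + real k * ln \<theta>" for k
  have LLnn: "filterlim (\<lambda>k. LL (nn k)) at_top sequentially"
    by (rule filterlim_compose[OF LL_at_top]) (rule filterlim_at_top_mono[OF filterlim_ident], simp add: nn_ge)
  have "\<forall>\<^sub>F k in sequentially. max 1 (1 / (1 - \<epsilon>)) < LL (nn k)" using LLnn unfolding filterlim_at_top_dense by blast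
  \<comment> \<open>The bound by \<open>1 / (1 - \<epsilon>)\<close> puts
    \<open>d * c (K + r)\<close> into the range \<open>\<ge> 1\<close> of
    \<open>gtail_lower\<close>.\<close>
  then obtain K0 where K0: "\<And>k. K0 \<le> k \<Longrightarrow> 1 < LL (nn k) \<and> 1 / (1 - \<epsilon>) < LL (nn k)"
    by (auto simp: eventually_sequentially)
  have main: "prob {\<omega> \<in> space M. \<forall>r<N. Z (nn (K + r)) \<omega> \<le> c (K + r)} \<le> exp (- (\<Sum>r<N. \<kappa> / w (K + r)))"
    if K: "K0 \<le> K" "1 \<le> K" for K N
  proof -
    define i where "i r = nn (K + r)" for r
    have i: "\<And>r. Suc r < N \<Longrightarrow> i r < i (Suc r)" "\<And>r. r < N \<Longrightarrow> 1 \<le> i r"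
      using nn_less nn(1) by (auto simp: i_def)
    have LLp: "1 < LL (i r)" "1 / (1 - \<epsilon>) < LL (i r)" for r using K0[of "K + r"] K by (auto simp: i_def)
    have Vp: "1 \<le> V (i r)" for r using V_ge_1[OF nn(1)] by (simp add: i_def)
    have "prob {\<omega> \<in> space M. \<forall>r<N. Z (i r) \<omega> \<le> c (K + r)} \<le> (\<Prod>r<N. 1 - gtail \<alpha> ((b (i r))\<^sup>2 * tri N i r r) (c (K + r)))"
    proof (rule joint_lower[where N = N and i = i and c = "\<lambda>r. c (K + r)"])
      fix r
      show "0 \<le> c (K + r)" unfolding c_def i_def[symmetric] using LLp[of r] Vp[of r] \<epsilon> by simp
    qed (use i in auto)
    also have "\<dots> \<le> (\<Prod>r<N. exp (- (\<kappa> / w (K + r))))"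
    proof (rule prod_mono, intro conjI)
      fix r assume "r \<in> {..<N}"
      then have r: "r < N" by simp
      define a where "a = A (i r)"
      have a: "0 < a" "\<theta> ^ (K + r) \<le> a" "a \<le> C * \<theta> ^ (K + r)"
        using A_pos[OF nn(1)] nn nn_upper by (auto simp: a_def i_def)
      have gap0: "a * (1 - q) \<le> gap i r" "gap i r \<le> a"
      proof -
        have "A (pre i r) \<le> q * a" "0 \<le> A (pre i r)"
        proof -
          show "0 \<le> A (pre i r)" using A_ge[of "pre i r"] by linarith
          show "A (pre i r) \<le> q * a"
          proof (cases r)
            case 0
            then show ?thesis using a q by (simp add: pre_def A_0)
          next
            case (Suc s)
            then have "A (pre i r) \<le> C * \<theta> ^ (K + s)" using nn_upper by (simp add: pre_def i_def)
            also have "\<dots> = q * \<theta> ^ (K + r)" using Suc q by (simp add: \<theta>_def)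
            also have "\<dots> \<le> q * a" using a q by (intro mult_left_mono) auto
            finally show ?thesis .
          qed
        qed
        then show "a * (1 - q) \<le> gap i r" "gap i r \<le> a" by (auto simp: gap_def a_def algebra_simps)
      qed
      have gapp: "0 < gap i r" using gap0(1) a q by (intro less_le_trans[OF _ gap0(1)] mult_pos_pos) auto
      have gap1: "a * (1 - q) / q \<le> gap i (Suc r)"
      proof -
        have "a / q \<le> \<theta> * \<theta> ^ (K + r)"
          using a(3) q by (simp add: \<theta>_def divide_right_mono)
        also have "\<dots> \<le> A (i (Suc r))" using nn(2)[of "K + Suc r"] by (simp add: i_def)
        finally show ?thesis using q by (simp add: gap_def pre_def a_def field_simps)
      qed
      have aq: "0 < a * (1 - q)" using a q by simp
      have tri_le: "a * tri N i r r \<le> 1 / (1 - \<epsilon>\<^sup>2)" and tri_ge: "1 \<le> a * tri N i r r"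
      proof -
        have g1: "1 / gap i r \<le> 1 / (a * (1 - q))" using gap0(1) aq by (intro divide_left_mono) (auto simp: gapp)
        have g2: "0 \<le> 1 / gap i (Suc r)" "1 / gap i (Suc r) \<le> q / (a * (1 - q))"
        proof -
          have "0 < a * (1 - q) / q" using aq q by simp
          then show "0 \<le> 1 / gap i (Suc r)" "1 / gap i (Suc r) \<le> q / (a * (1 - q))"
            using gap1 le_imp_inverse_le[OF gap1] by (auto simp: inverse_eq_divide)
        qed
        define e where "e = (if Suc r < N then 1 / gap i (Suc r) else 0)"
        have tri: "tri N i r r = 1 / gap i r + e" by (simp add: tri_def e_def)
        have e: "0 \<le> e \<and> e \<le> q / (a * (1 - q))"
        proof (cases "Suc r < N")
          case True
          then show ?thesis unfolding e_def if_P[OF True] using g2 by blast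
        next
          case False
          have "0 \<le> q / (a * (1 - q))" using aq q by simp
          then show ?thesis unfolding e_def if_not_P[OF False] by blast
        qed
        have "tri N i r r \<le> 1 / (a * (1 - q)) + q / (a * (1 - q))" unfolding tri using g1 e by linarith
        then have "a * tri N i r r \<le> a * (1 / (a * (1 - q)) + q / (a * (1 - q)))" using a by (intro mult_left_mono) auto
        also have "\<dots> = (1 + q) / (1 - q)" using a q by (simp add: field_simps)
        also have "\<dots> \<le> 1 / (1 - \<epsilon>\<^sup>2)"
        proof -
          have "(1 + q) * (1 - 2 * q) \<le> 1 - q" by (simp add: algebra_simps)
          then show ?thesis using q \<epsilon> by (simp add: q_def field_simps)
        qed
        finally show "a * tri N i r r \<le> 1 / (1 - \<epsilon>\<^sup>2)" .
        have "1 = a * (1 / a)" using a by simp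
        also have "\<dots> \<le> a * tri N i r r"
        proof (rule mult_left_mono)
          have "1 / a \<le> 1 / gap i r" using gap0(2) gapp a by (intro divide_left_mono) auto
          then show "1 / a \<le> tri N i r r" unfolding tri using e by linarith
        qed (use a in simp)
        finally show "1 \<le> a * tri N i r r" .
      qed
      define d where "d = (b (i r))\<^sup>2 * tri N i r r"
      have bp: "0 < (b (i r))\<^sup>2" using b_pos[of "i r"] by simp
      have "0 < a * tri N i r r" using tri_ge by linarith
      then have tp: "0 < tri N i r r" using a by (simp add: zero_less_mult_iff)
      have d: "0 < d" using bp tp by (simp add: d_def)
      have dc: "d * c (K + r) = (1 - \<epsilon>) * (a * tri N i r r) * LL (i r)"
      proof -
        have "(b (i r))\<^sup>2 * V (i r) = a" using V_b[of "i r"] i(2)[OF r] by (simp add: a_def mult.commute)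
        moreover have "d * c (K + r) = (1 - \<epsilon>) * (((b (i r))\<^sup>2 * V (i r)) * tri N i r r) * LL (i r)"
          unfolding d_def c_def i_def[symmetric] by (simp only: mult_ac)
        ultimately show ?thesis by simp
      qed
      have dc1: "1 \<le> d * c (K + r)"
      proof -
        have "1 \<le> (1 - \<epsilon>) * LL (i r)" using LLp(2)[of r] \<epsilon> by (simp add: field_simps)
        also have "\<dots> = (1 - \<epsilon>) * 1 * LL (i r)" by simp
        also have "\<dots> \<le> (1 - \<epsilon>) * (a * tri N i r r) * LL (i r)"
          using tri_ge LLp(1)[of r] \<epsilon> by (intro mult_right_mono mult_left_mono) auto
        finally show ?thesis by (simp add: dc)
      qed
      have "(1 + \<epsilon>) * (d * c (K + r)) \<le> LL (i r)"
      proof -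
        have e2: "0 < 1 - \<epsilon>\<^sup>2" using \<epsilon> by (simp add: abs_square_less_1)
        have "(1 + \<epsilon>) * (d * c (K + r)) = (1 - \<epsilon>\<^sup>2) * (a * tri N i r r) * LL (i r)"
          unfolding dc by (simp add: power2_eq_square algebra_simps)
        also have "\<dots> \<le> (1 - \<epsilon>\<^sup>2) * (1 / (1 - \<epsilon>\<^sup>2)) * LL (i r)"
          using tri_le LLp(1)[of r] e2 by (intro mult_right_mono mult_left_mono) auto
        finally show ?thesis using e2 by simp
      qed
      then have "- LL (i r) \<le> - (1 + \<epsilon>) * (d * c (K + r))" unfolding mult_minus_left by linarith
      then have "\<kappa> * exp (- LL (i r)) \<le> \<kappa> * exp (- (1 + \<epsilon>) * (d * c (K + r)))"
        by (simp only: mult_le_cancel_left_pos[OF \<kappa>(1)] exp_le_cancel_iff)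
      also have "\<dots> \<le> gtail \<alpha> d (c (K + r))" using d dc1 by (rule \<kappa>(2))
      finally have "\<kappa> * exp (- LL (i r)) \<le> gtail \<alpha> d (c (K + r))" .
      moreover have "\<kappa> / w (K + r) \<le> \<kappa> * exp (- LL (i r))"
      proof -
        have "0 < K + r" using K by simp
        have lnA: "0 < ln a"
        proof -
          have "1 < \<theta> ^ (K + r)" using \<theta> \<open>0 < K + r\<close> by (intro one_less_power) auto
          then have "1 < a" using a(2) by linarith
          then show ?thesis by simp
        qed
        have "exp (- LL (i r)) = 1 / ln a" using lnA by (simp add: LL_def a_def exp_minus inverse_eq_divide)
        moreover have "ln a \<le> w (K + r)"
        proof -
          have "ln a \<le> ln (C * \<theta> ^ (K + r))" using a C \<theta> by (subst ln_le_cancel_iff) auto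
          also have "\<dots> = w (K + r)" using C \<theta> by (simp add: w_def ln_mult ln_realpow)
          finally show ?thesis .
        qed
        ultimately show ?thesis using \<kappa>(1) lnA by (simp add: divide_left_mono)
      qed
      moreover have "1 - gtail \<alpha> d (c (K + r)) \<le> exp (- gtail \<alpha> d (c (K + r)))"
        using exp_ge_add_one_self[of "- gtail \<alpha> d (c (K + r))"] by simp
      ultimately show "1 - gtail \<alpha> ((b (i r))\<^sup>2 * tri N i r r) (c (K + r)) \<le> exp (- (\<kappa> / w (K + r)))"
        unfolding d_def[symmetric] by (smt (verit) exp_le_cancel_iff)
      show "0 \<le> 1 - gtail \<alpha> ((b (i r))\<^sup>2 * tri N i r r) (c (K + r))"
        unfolding d_def[symmetric] using gtail_le_1[OF \<alpha> d] by simp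
    qed
    also have "\<dots> = exp (- (\<Sum>r<N. \<kappa> / w (K + r)))" by (simp add: exp_sum sum_negf[symmetric])
    finally show ?thesis by (simp add: i_def)
  qed
  have div: "filterlim (\<lambda>N. \<Sum>r<N. \<kappa> / w (K + r)) at_top sequentially" if "1 \<le> K" for K
  proof -
    have lnp: "0 < ln \<theta>" "0 \<le> ln C" using \<theta> C by auto
    define D where "D = ln C + real K * ln \<theta>"
    have D: "0 < D" using lnp that by (simp add: D_def add_nonneg_pos)
    have "filterlim (\<lambda>N. (\<kappa> / D) * harm N) at_top sequentially"
      using \<kappa>(1) D by (intro filterlim_tendsto_pos_mult_at_top[OF tendsto_const] harm_at_top) auto
    then show ?thesis
    proof (rule filterlim_at_top_mono, intro always_eventually allI)
      fix N
      have "(\<kappa> / D) * harm N = (\<Sum>r<N. (\<kappa> / D) * inverse (real (Suc r)))"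
        by (simp add: harm_def sum_distrib_left sum.atLeast1_atMost_eq)
      also have "\<dots> \<le> (\<Sum>r<N. \<kappa> / w (K + r))"
      proof (rule sum_mono)
        fix r
        have "real r * ln \<theta> \<le> real r * D"
        proof (rule mult_left_mono)
          have "1 * ln \<theta> \<le> real K * ln \<theta>" using lnp that by (intro mult_right_mono) auto
          then show "ln \<theta> \<le> D" using lnp unfolding D_def by linarith
        qed simp
        then have "w (K + r) \<le> D * real (Suc r)"
          by (simp add: w_def D_def algebra_simps)
        moreover have "0 < w (K + r)" using lnp that by (simp add: w_def add_nonneg_pos)
        ultimately have "\<kappa> / (D * real (Suc r)) \<le> \<kappa> / w (K + r)" using \<kappa>(1) D by (intro divide_left_mono) auto
        then show "(\<kappa> / D) * inverse (real (Suc r)) \<le> \<kappa> / w (K + r)" by (simp add: divide_inverse mult.assoc)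
      qed
      finally show "(\<kappa> / D) * harm N \<le> (\<Sum>r<N. \<kappa> / w (K + r))" .
    qed
  qed
  have io: "AE \<omega> in M. \<exists>r. c (K + r) < Z (nn (K + r)) \<omega>" if K: "K0 \<le> K" "1 \<le> K" for K
  proof -
    define S where "S = {\<omega> \<in> space M. \<forall>r. Z (nn (K + r)) \<omega> \<le> c (K + r)}"
    have Sm: "S \<in> events" unfolding S_def
      by (intro sets.sets_Collect_countable_All Z_events nn)
    have "prob S \<le> exp (- (\<Sum>r<N. \<kappa> / w (K + r)))" for N
    proof -
      have "{\<omega> \<in> space M. \<forall>r\<in>{..<N}. Z (nn (K + r)) \<omega> \<le> c (K + r)} \<in> events"
        by (intro sets.sets_Collect_finite_All Z_events nn finite_lessThan)
      then have "{\<omega> \<in> space M. \<forall>r<N. Z (nn (K + r)) \<omega> \<le> c (K + r)} \<in> events"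
        by (simp only: Ball_def lessThan_iff)
      moreover have "S \<subseteq> {\<omega> \<in> space M. \<forall>r<N. Z (nn (K + r)) \<omega> \<le> c (K + r)}"
        unfolding S_def by blast
      ultimately have "prob S \<le> prob {\<omega> \<in> space M. \<forall>r<N. Z (nn (K + r)) \<omega> \<le> c (K + r)}"
        by (rule finite_measure_mono[rotated])
      then show ?thesis using main[OF K, of N] by linarith
    qed
    moreover have "(\<lambda>N. exp (- (\<Sum>r<N. \<kappa> / w (K + r)))) \<longlonglongrightarrow> 0"
      by (intro filterlim_compose[OF exp_at_bot] filterlim_uminus_at_bot_at_top[THEN filterlim_compose] div K)
    ultimately have "prob S \<le> 0" by (intro LIMSEQ_le_const) auto
    then have "prob S = 0" by (simp add: measure_le_0_iff)
    then have "S \<in> null_sets M" using Sm by (simp add: null_sets_def emeasure_eq_measure)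
    moreover have "{\<omega> \<in> space M. \<not> (\<exists>r. c (K + r) < Z (nn (K + r)) \<omega>)} \<subseteq> S"
      unfolding S_def by (simp add: not_less)
    ultimately show ?thesis by (rule AE_I')
  qed
  have "AE \<omega> in M. \<forall>K. max K0 1 \<le> K \<longrightarrow> (\<exists>r. c (K + r) < Z (nn (K + r)) \<omega>)"
    unfolding AE_all_countable using io by auto
  then show ?thesis
  proof eventually_elim
    case (elim \<omega>)
    show ?case unfolding frequently_sequentially
    proof
      fix n
      obtain r where "c (max n (max K0 1) + r) < Z (nn (max n (max K0 1) + r)) \<omega>"
        using elim by (metis max.cobounded2)
      moreover have "n \<le> nn (max n (max K0 1) + r)" using nn_ge[of "max n (max K0 1) + r"] by simp
      ultimately show "\<exists>m\<ge>n. (1 - \<epsilon>) * (V m * LL m) < Z m \<omega>" by (auto simp: c_def)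
    qed
  qed
qed

theorem law_of_iterated_logarithm:
  assumes fV: "(\<lambda>j. f j / V j) \<longlonglongrightarrow> 0"
  shows "AE \<omega> in M. limsup (\<lambda>j. ereal (Z j \<omega> / (V j * LL j))) = 1"
proof -
  \<comment> \<open>Countably many accuracies keep the exceptional set null; the shift by
    \<open>8\<close> meets the bound \<open>1 / 8\<close> of \<open>AE_upper\<close>.\<close>
  define \<eta> where "\<eta> m = 1 / real (m + 8)" for m :: nat
  have \<eta>: "0 < \<eta> m" "\<eta> m \<le> 1 / 8" "\<eta> m < 1" for m by (auto simp: \<eta>_def)
  have \<eta>0: "\<eta> \<longlonglongrightarrow> 0" unfolding \<eta>_def[abs_def] by real_asymp
  have "AE \<omega> in M. \<forall>m. \<forall>\<^sub>F j in sequentially. (b j)\<^sup>2 * Z j \<omega> \<le> (1 + 8 * \<eta> m) * (A j * LL j)"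
    unfolding AE_all_countable using AE_upper[OF fV] \<eta> by auto
  moreover have "AE \<omega> in M. \<forall>m. \<exists>\<^sub>F j in sequentially. (1 - \<eta> m) * (V j * LL j) < Z j \<omega>"
    unfolding AE_all_countable using AE_lower \<eta> by auto
  ultimately have AE: "AE \<omega> in M. (\<forall>m. \<forall>\<^sub>F j in sequentially. (b j)\<^sup>2 * Z j \<omega> \<le> (1 + 8 * \<eta> m) * (A j * LL j)) \<and>
      (\<forall>m. \<exists>\<^sub>F j in sequentially. (1 - \<eta> m) * (V j * LL j) < Z j \<omega>)"
    by eventually_elim simp
  have pos: "\<forall>\<^sub>F j in sequentially. 1 \<le> j \<and> 0 < V j * LL j"
    using filterlim_at_top_dense[THEN iffD1, OF LL_at_top, rule_format, of 0] eventually_ge_at_top[of 1]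
  proof eventually_elim
    case (elim j)
    then show ?case using V_ge_1[of j] by simp
  qed
  show ?thesis using AE
  proof eventually_elim
    case (elim \<omega>)
    let ?u = "\<lambda>j. ereal (Z j \<omega> / (V j * LL j))"
    show ?case
    proof (rule antisym)
      have "limsup ?u \<le> ereal (1 + 8 * \<eta> m)" for m
      proof (rule Limsup_bounded)
        show "\<forall>\<^sub>F j in sequentially. ?u j \<le> ereal (1 + 8 * \<eta> m)"
          using pos elim[THEN conjunct1, rule_format, of m]
        proof eventually_elim
          case (elim j)
          have "(b j)\<^sup>2 * Z j \<omega> \<le> (b j)\<^sup>2 * ((1 + 8 * \<eta> m) * (V j * LL j))"
            using elim V_b[of j] by (simp add: mult_ac) (metis (no_types, opaque_lifting) mult.assoc mult.commute)
          then have "Z j \<omega> \<le> (1 + 8 * \<eta> m) * (V j * LL j)" using b_pos[of j] by simp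
          then show ?case using elim by (simp add: pos_divide_le_eq)
        qed
      qed
      moreover have "(\<lambda>m. ereal (1 + 8 * \<eta> m)) \<longlonglongrightarrow> ereal (1 + 8 * 0)"
        using \<eta>0 by (intro tendsto_intros)
      ultimately have "limsup ?u \<le> ereal (1 + 8 * 0)" by (intro LIMSEQ_le_const) blast+
      then show "limsup ?u \<le> 1" by (simp add: one_ereal_def)
    next
      have "ereal (1 - \<eta> m) \<le> limsup ?u" for m
      proof (rule ccontr)
        assume "\<not> ereal (1 - \<eta> m) \<le> limsup ?u"
        then have "\<forall>\<^sub>F j in sequentially. ?u j < ereal (1 - \<eta> m)" by (intro Limsup_lessD) simp
        then have "\<forall>\<^sub>F j in sequentially. \<not> (1 - \<eta> m) * (V j * LL j) < Z j \<omega>"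
          using pos by eventually_elim (auto simp: pos_divide_less_eq)
        then show False using elim[THEN conjunct2, rule_format, of m] by (simp add: frequently_def)
      qed
      moreover have "(\<lambda>m. ereal (1 - \<eta> m)) \<longlonglongrightarrow> ereal (1 - 0)"
        using \<eta>0 by (intro tendsto_intros)
      ultimately have "ereal (1 - 0) \<le> limsup ?u" by (intro LIMSEQ_le_const2) blast+
      then show "1 \<le> limsup ?u" by (simp add: one_ereal_def)
    qed
  qed
qed

end

section \<open>Potentials of sequences in the two spaces\<close>

context ar_weights
begin

text \<open>Since \<open>b\<close> increases, replacing the larger index in the denominator
  \<open>b j * b k\<close> by the smaller one increases the quotient; the other bound is
  monotonicity of \<open>V\<close>.\<close>

lemma ar_cov_le_V:
  assumes "1 \<le> j" "1 \<le> k"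
  shows "0 \<le> ar_cov x j k" "ar_cov x j k \<le> V j" "ar_cov x j k \<le> V k"
proof -
  have le: "0 \<le> ar_cov x j k \<and> ar_cov x j k \<le> V j \<and> V j \<le> V k" if jk: "1 \<le> j" "j \<le> k" for j k
  proof -
    have "0 < b j" "b j \<le> b k" "0 \<le> A j"
      using b_pos b_mono jk A_ge[of j] by (auto intro: order_trans[of _ "real j"])
    moreover have "ar_cov x j k = A j / (b j * b k)" "V j = A j / (b j * b j)"
      using jk by (simp_all add: ar_cov_eq min_absorb1)
    ultimately have "0 \<le> ar_cov x j k \<and> ar_cov x j k \<le> V j"
      by (auto intro!: divide_left_mono mult_left_mono mult_pos_pos)
    then show ?thesis using V_mono[OF jk] by blast
  qed
  show "0 \<le> ar_cov x j k" "ar_cov x j k \<le> V j" "ar_cov x j k \<le> V k"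
    using le[of j k] le[of k j] ar_cov_sym[of x j k] assms by (cases "j \<le> k"; force)+
qed

text \<open>Tannery's theorem: the ratios \<open>ar_cov x j k / V j\<close> are at most
  \<open>1\<close>, so \<open>h\<close> is a summable majorant, and for fixed \<open>k\<close> they
  are at most \<open>V k / V j\<close>, which tends to \<open>0\<close>.\<close>

lemma potential_div_V:
  assumes top: "filterlim V at_top sequentially" and h: "h \<in> l1_plus" and f: "is_image (ar_cov x) h f"
  shows "(\<lambda>j. f j / V j) \<longlonglongrightarrow> 0"
proof -
  have hn: "0 \<le> h (Suc k)" for k using h by (simp add: l1_plus_def)
  have hs: "summable (\<lambda>k. h (Suc k))"
  proof -
    have "(h has_sum (\<Sum>\<^sub>\<infinity>k\<in>{1..}. h k)) {1..}" using h by (simp add: l1_plus_def)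
    then show ?thesis using has_sum_Suc_sums sums_summable by blast
  qed
  define a where "a k j = ar_cov x (Suc j) (Suc k) / V (Suc j) * h (Suc k)" for k j
  have Vtop: "filterlim (\<lambda>j. V (Suc j)) at_top sequentially"
    using top by (simp add: filterlim_sequentially_Suc[of V])
  have Vp: "0 < V (Suc j)" for j using V_ge_1[of "Suc j"] by simp
  have lim: "(\<lambda>j. a k j) \<longlonglongrightarrow> 0" for k
  proof (rule tendsto_sandwich[OF _ _ tendsto_const])
    show "\<forall>\<^sub>F j in sequentially. 0 \<le> a k j"
      using ar_cov_le_V(1) Vp hn by (auto simp: a_def less_imp_le)
    show "\<forall>\<^sub>F j in sequentially. a k j \<le> V (Suc k) / V (Suc j) * h (Suc k)"
      unfolding a_def using ar_cov_le_V(3) Vp hn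
      by (intro always_eventually allI mult_right_mono divide_right_mono) (auto simp: less_imp_le)
    have "(\<lambda>j. V (Suc k) / V (Suc j)) \<longlonglongrightarrow> 0"
      by (rule tendsto_divide_0[OF tendsto_const filterlim_at_top_imp_at_infinity[OF Vtop]])
    from tendsto_mult_right[OF this, of "h (Suc k)"]
    show "(\<lambda>j. V (Suc k) / V (Suc j) * h (Suc k)) \<longlonglongrightarrow> 0" by simp
  qed
  have "(\<forall>\<^sub>F j in sequentially. summable (\<lambda>k. norm (a k j))) \<and> summable (\<lambda>k::nat. norm (0::real)) \<and>
    (\<lambda>j. \<Sum>k. a k j) \<longlonglongrightarrow> (\<Sum>k::nat. 0)"
  proof (rule tannerys_theorem)
    show "\<forall>\<^sub>F (k, j) in sequentially \<times>\<^sub>F sequentially. norm (a k j) \<le> h (Suc k)"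
    proof (rule always_eventually, clarify)
      fix k j
      have "\<bar>ar_cov x (Suc j) (Suc k) / V (Suc j)\<bar> \<le> 1"
        using ar_cov_le_V(1,2)[of "Suc j" "Suc k"] Vp[of j] by (simp add: divide_le_eq)
      then show "norm (a k j) \<le> h (Suc k)"
        using hn[of k] unfolding a_def real_norm_def abs_mult[of "_ / _"] by (simp only: abs_of_nonneg mult_left_le_one_le abs_ge_zero)
    qed
  qed (use lim hs in auto)
  then have "(\<lambda>j. \<Sum>k. a k j) \<longlonglongrightarrow> (\<Sum>k::nat. 0)" by blast
  moreover have "(\<Sum>k. a k j) = f (Suc j) / V (Suc j)" for j
  proof -
    have "(\<lambda>k. ar_cov x (Suc j) (Suc k) * h (Suc k)) sums f (Suc j)"
      using f has_sum_Suc_sums[of "\<lambda>k. ar_cov x (Suc j) k * h k"] by (simp add: is_image_def)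
    from sums_divide[OF this, of "V (Suc j)"] show ?thesis by (simp add: a_def sums_iff)
  qed
  ultimately have "(\<lambda>j. f (Suc j) / V (Suc j)) \<longlonglongrightarrow> 0" by simp
  then show ?thesis by (rule LIMSEQ_imp_Suc)
qed

lemma c0_div_V:
  assumes "f \<in> c0_plus" shows "(\<lambda>j. f j / V j) \<longlonglongrightarrow> 0"
proof (rule tendsto_sandwich[OF _ _ tendsto_const])
  show "f \<longlonglongrightarrow> 0" using assms by (simp add: c0_plus_def)
  have f: "0 \<le> f j" if "1 \<le> j" for j using assms that by (simp add: c0_plus_def)
  show "\<forall>\<^sub>F j in sequentially. 0 \<le> f j / V j"
    using eventually_ge_at_top[of 1]
  proof eventually_elim
    case (elim j)
    then show ?case using f[OF elim] V_ge_1[OF elim] by simp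
  qed
  show "\<forall>\<^sub>F j in sequentially. f j / V j \<le> f j"
    using eventually_ge_at_top[of 1]
  proof eventually_elim
    case (elim j)
    then show ?case using mult_left_mono[OF V_ge_1[OF elim] f[OF elim]] V_ge_1[OF elim] by (simp add: divide_le_eq)
  qed
qed

text \<open>Summation by parts with \<open>slope_diff\<close>. It isolates the boundary term
  \<open>A (min n j) * slope g (Suc n)\<close>, whose disappearance makes \<open>g\<close> the
  potential of \<open>gen g\<close>.\<close>

lemma potential_partial_sum:
  assumes j: "1 \<le> j"
  shows "(\<Sum>k=1..n. ar_cov x j k * gen g k)
    = (scaled g (min n j) - A (min n j) * slope g (Suc n)) / b j"
proof (induction n)
  case 0
  then show ?case by (simp add: scaled_def A_0)
next
  case (Suc n)
  have "ar_cov x j (Suc n) * gen g (Suc n) = A (min (Suc n) j) / b j * (slope g (Suc n) - slope g (Suc (Suc n)))"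
    using j b_pos[of "Suc n"] b_pos[of j] by (simp add: ar_cov_eq slope_diff min.commute)
  then have "(\<Sum>k=1..Suc n. ar_cov x j k * gen g k)
    = (scaled g (min n j) - A (min n j) * slope g (Suc n) + A (min (Suc n) j) * (slope g (Suc n) - slope g (Suc (Suc n)))) / b j"
    using Suc by (simp add: add_divide_distrib)
  also have "scaled g (min n j) - A (min n j) * slope g (Suc n) + A (min (Suc n) j) * (slope g (Suc n) - slope g (Suc (Suc n)))
    = scaled g (min (Suc n) j) - A (min (Suc n) j) * slope g (Suc (Suc n))"
  proof (cases "n < j")
    case True
    then show ?thesis using scaled_Suc[of g n] by (simp add: min_absorb1 algebra_simps)
  next
    case False
    then show ?thesis by (simp add: min_absorb2 algebra_simps)
  qed
  finally show ?case .
qed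

text \<open>The preimage is \<open>gen f\<close>. Its entries combine three neighbouring values of
  \<open>f\<close> with bounded coefficients, and the boundary slope of
  \<open>potential_partial_sum\<close> vanishes for the same reason, since
  \<open>b \<ge> 1\<close>.\<close>

lemma c0_image:
  assumes conc: "concave_wrt f" and f: "f \<in> c0_plus"
  shows "gen f \<in> c0_plus" "is_image (ar_cov x) (gen f) f"
proof -
  have f0: "f \<longlonglongrightarrow> 0" using f by (simp add: c0_plus_def)
  have fs: "(\<lambda>n. f (Suc n)) \<longlonglongrightarrow> 0" "(\<lambda>n. f (Suc (Suc n))) \<longlonglongrightarrow> 0" "(\<lambda>n. f (n + 3)) \<longlonglongrightarrow> 0"
    using f0 by (auto intro: LIMSEQ_Suc LIMSEQ_ignore_initial_segment)
  have xb: "0 < x (Suc n)" "x (Suc n) \<le> 1" for n using bounds by auto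
  have "(\<lambda>n. gen f (Suc (Suc n))) \<longlonglongrightarrow> 0"
  proof (rule Lim_null_comparison)
    show "\<forall>\<^sub>F n in sequentially. norm (gen f (Suc (Suc n))) \<le> 2 * \<bar>f (Suc (Suc n))\<bar> + \<bar>f (n + 3)\<bar> + \<bar>f (Suc n)\<bar>"
    proof (intro always_eventually allI)
      fix n
      have "\<bar>(1 + (x (Suc (Suc n)))\<^sup>2) * f (Suc (Suc n))\<bar> \<le> 2 * \<bar>f (Suc (Suc n))\<bar>"
        unfolding abs_mult using xb[of "Suc n"] by (intro mult_right_mono) (auto simp: power_le_one)
      moreover have "\<bar>x (Suc (Suc n)) * f (n + 3)\<bar> \<le> \<bar>f (n + 3)\<bar>" "\<bar>x (Suc n) * f (Suc n)\<bar> \<le> \<bar>f (Suc n)\<bar>"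
        using xb[of n] xb[of "Suc n"] by (auto simp: abs_mult mult_left_le_one_le)
      moreover have "gen f (Suc (Suc n)) = (1 + (x (Suc (Suc n)))\<^sup>2) * f (Suc (Suc n)) - x (Suc (Suc n)) * f (n + 3) - x (Suc n) * f (Suc n)"
        by (simp add: gen_def eval_nat_numeral)
      ultimately show "norm (gen f (Suc (Suc n))) \<le> 2 * \<bar>f (Suc (Suc n))\<bar> + \<bar>f (n + 3)\<bar> + \<bar>f (Suc n)\<bar>"
        unfolding real_norm_def by linarith
    qed
    have "(\<lambda>n. 2 * \<bar>f (Suc (Suc n))\<bar> + \<bar>f (n + 3)\<bar> + \<bar>f (Suc n)\<bar>) \<longlonglongrightarrow> 2 * \<bar>0\<bar> + \<bar>0\<bar> + \<bar>0\<bar>"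
      by (intro tendsto_intros fs)
    then show "(\<lambda>n. 2 * \<bar>f (Suc (Suc n))\<bar> + \<bar>f (n + 3)\<bar> + \<bar>f (Suc n)\<bar>) \<longlonglongrightarrow> 0" by simp
  qed
  then have "gen f \<longlonglongrightarrow> 0" by (rule LIMSEQ_imp_Suc[OF LIMSEQ_imp_Suc])
  then show "gen f \<in> c0_plus" using conc by (simp add: c0_plus_def concave_wrt_def)
  have slope0: "(\<lambda>n. slope f (Suc (Suc n))) \<longlonglongrightarrow> 0"
  proof (rule Lim_null_comparison)
    show "\<forall>\<^sub>F n in sequentially. norm (slope f (Suc (Suc n))) \<le> \<bar>f (Suc (Suc n))\<bar> + \<bar>f (Suc n)\<bar>"
    proof (intro always_eventually allI)
      fix n
      have "\<bar>x (Suc n) * f (Suc n)\<bar> \<le> \<bar>f (Suc n)\<bar>"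
        using xb[of n] by (auto simp: abs_mult mult_left_le_one_le)
      then have "\<bar>f (Suc (Suc n)) - x (Suc n) * f (Suc n)\<bar> \<le> \<bar>f (Suc (Suc n))\<bar> + \<bar>f (Suc n)\<bar>" by linarith
      moreover have "1 \<le> b (Suc (Suc n))" by (rule b_ge_1) simp
      then have "\<bar>f (Suc (Suc n)) - x (Suc n) * f (Suc n)\<bar> / b (Suc (Suc n)) \<le> \<bar>f (Suc (Suc n)) - x (Suc n) * f (Suc n)\<bar>"
        by (simp add: divide_le_eq mult_le_cancel_left1)
      ultimately show "norm (slope f (Suc (Suc n))) \<le> \<bar>f (Suc (Suc n))\<bar> + \<bar>f (Suc n)\<bar>"
        using b_pos[of "Suc (Suc n)"] by (simp add: slope_def abs_divide)
    qed
    have "(\<lambda>n. \<bar>f (Suc (Suc n))\<bar> + \<bar>f (Suc n)\<bar>) \<longlonglongrightarrow> \<bar>0\<bar> + \<bar>0\<bar>" by (intro tendsto_intros fs)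
    then show "(\<lambda>n. \<bar>f (Suc (Suc n))\<bar> + \<bar>f (Suc n)\<bar>) \<longlonglongrightarrow> 0" by simp
  qed
  then have slope0: "(\<lambda>n. slope f (Suc n)) \<longlonglongrightarrow> 0" by (rule LIMSEQ_imp_Suc)
  show "is_image (ar_cov x) (gen f) f"
    unfolding is_image_def
  proof (intro allI impI)
    fix j :: nat assume j: "1 \<le> j"
    have "(\<lambda>n. (scaled f j - A j * slope f (Suc n)) / b j) \<longlonglongrightarrow> (scaled f j - A j * 0) / b j"
      using b_pos[of j] by (intro tendsto_intros slope0) auto
    moreover have "(scaled f j - A j * 0) / b j = f j" using j b_pos[of j] by (simp add: scaled_def)
    moreover have "\<forall>\<^sub>F n in sequentially. (scaled f j - A j * slope f (Suc n)) / b j = (\<Sum>k<n. ar_cov x j (Suc k) * gen f (Suc k))"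
      using eventually_ge_at_top[of j]
    proof eventually_elim
      case (elim n)
      have "(\<Sum>k<n. ar_cov x j (Suc k) * gen f (Suc k)) = (\<Sum>k=1..n. ar_cov x j k * gen f k)"
        by (simp add: sum.atLeast1_atMost_eq)
      then show ?case using potential_partial_sum[OF j, where n = n and g = f] elim by (simp add: min_absorb2)
    qed
    ultimately have "(\<lambda>k. ar_cov x j (Suc k) * gen f (Suc k)) sums f j"
      unfolding sums_def using Lim_transform_eventually by fastforce
    moreover have "0 \<le> ar_cov x j (Suc k) * gen f (Suc k)" for k
      using ar_cov_le_V(1)[OF j, of "Suc k"] conc by (simp add: concave_wrt_def)
    ultimately have "((\<lambda>k. ar_cov x j (Suc k) * gen f (Suc k)) has_sum f j) UNIV"
      by (intro sums_nonneg_imp_has_sum)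
    then have "((\<lambda>k. ar_cov x j k * gen f k) has_sum f j) (Suc ` UNIV)"
      by (subst has_sum_reindex) (auto simp: o_def)
    moreover have "Suc ` UNIV = {1..}" by (auto simp: image_iff Suc_le_eq gr0_conv_Suc)
    ultimately show "((\<lambda>k. ar_cov x j k * gen f k) has_sum f j) {1..}" by simp
  qed
qed

text \<open>\<open>A j \<ge> j\<close> and \<open>A j = V j * (b j)\<^sup>2\<close> force
  \<open>b\<close> to grow when \<open>V\<close> is bounded.\<close>

lemma b_at_top:
  assumes "\<And>j. 1 \<le> j \<Longrightarrow> V j \<le> L"
  shows "filterlim b at_top sequentially"
proof -
  have L: "0 < L" using assms[of 1] V_ge_1[of 1] by simp
  have "\<forall>\<^sub>F j in sequentially. sqrt (real j / L) \<le> b j"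
    using eventually_ge_at_top[of 1]
  proof eventually_elim
    case (elim j)
    have "real j \<le> L * (b j)\<^sup>2"
      using A_ge[of j] V_b[OF elim] mult_right_mono[OF assms[OF elim], of "(b j)\<^sup>2"] by simp
    then have "real j / L \<le> (b j)\<^sup>2" using L by (simp add: divide_le_eq mult.commute)
    then show ?case using b_pos[of j] by (intro real_le_lsqrt) auto
  qed
  moreover have "filterlim (\<lambda>j. sqrt (real j / L)) at_top sequentially" using L by real_asymp
  ultimately show ?thesis by (rule filterlim_at_top_mono[rotated])
qed

lemma V_le_lim:
  assumes "V \<longlonglongrightarrow> L" "1 \<le> j" shows "V j \<le> L"
  by (rule LIMSEQ_le_const[OF assms(1)]) (use V_mono assms(2) in \<open>auto intro!: exI[of _ j]\<close>)

text \<open>Row sums of the potential are at most \<open>1 / (1 - \<delta>)\<^sup>2\<close>, because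
  the constant \<open>1\<close> has \<open>gen\<close> at least
  \<open>(1 - \<delta>)\<^sup>2\<close> and dominates the partial potentials of its own
  \<open>gen\<close>. Large indices then contribute little because \<open>h\<close> is small there,
  and finitely many small ones because \<open>b\<close> diverges.\<close>

lemma image_c0:
  assumes \<delta>: "\<delta> < 1" and x: "x \<longlonglongrightarrow> \<delta>" and V: "V \<longlonglongrightarrow> L"
    and fn: "\<And>j. 1 \<le> j \<Longrightarrow> 0 \<le> f j" and h: "h \<in> c0_plus" and f: "is_image (ar_cov x) h f"
  shows "f \<in> c0_plus"
proof -
  define c where "c = 1 / (1 - \<delta>)\<^sup>2"
  have c: "0 < c" using \<delta> by (simp add: c_def)
  have hn: "0 \<le> h k" if "1 \<le> k" for k using h that by (simp add: c0_plus_def)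
  have row: "(\<Sum>k=1..n. ar_cov x j k) \<le> c" if j: "1 \<le> j" for j n
  proof -
    have g: "(1 - \<delta>)\<^sup>2 \<le> gen (\<lambda>_. 1) k" if k: "1 \<le> k" for k
    proof -
      have "x k \<le> \<delta>" by (rule x_le_lim[OF x k])
      then have "(1 - \<delta>)\<^sup>2 \<le> (1 - x k)\<^sup>2" using \<delta> by (intro power_mono) auto
      moreover have "(1 - x k)\<^sup>2 \<le> gen (\<lambda>_. 1) k"
      proof (cases "k = 1")
        case True
        then show ?thesis using bounds[OF k] by (simp add: gen_def power2_eq_square algebra_simps)
      next
        case False
        then have "x (k - 1) \<le> x k" using mono k by (auto simp: mono_on_def)
        then show ?thesis using False by (simp add: gen_def power2_eq_square algebra_simps)
      qed
      ultimately show ?thesis by simp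
    qed
    have "(1 - \<delta>)\<^sup>2 * (\<Sum>k=1..n. ar_cov x j k) = (\<Sum>k=1..n. ar_cov x j k * (1 - \<delta>)\<^sup>2)"
      by (simp add: sum_distrib_left mult.commute)
    also have "\<dots> \<le> (\<Sum>k=1..n. ar_cov x j k * gen (\<lambda>_. 1) k)"
      using g ar_cov_le_V(1)[OF j] by (intro sum_mono mult_left_mono) auto
    also have "\<dots> = (scaled (\<lambda>_. 1) (min n j) - A (min n j) * slope (\<lambda>_. 1) (Suc n)) / b j"
      by (rule potential_partial_sum[OF j])
    also have "\<dots> \<le> scaled (\<lambda>_. 1) j / b j"
    proof (rule divide_right_mono)
      have "0 \<le> A (min n j) * slope (\<lambda>_. 1) (Suc n)"
        using slope_nonneg[OF concave_one, of "Suc n"] A_ge[of "min n j"] by (intro mult_nonneg_nonneg) auto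
      moreover have "scaled (\<lambda>_. 1) (min n j) \<le> scaled (\<lambda>_. 1) j"
        by (rule scaled_mono[OF concave_one]) simp
      ultimately show "scaled (\<lambda>_. 1) (min n j) - A (min n j) * slope (\<lambda>_. 1) (Suc n) \<le> scaled (\<lambda>_. 1) j" by linarith
    qed (use b_pos[of j] in simp)
    also have "\<dots> = 1" using j b_pos[of j] by (simp add: scaled_def)
    finally show ?thesis using \<delta> by (simp add: c_def le_divide_eq mult.commute)
  qed
  have btop: "filterlim b at_top sequentially" by (rule b_at_top[of L]) (rule V_le_lim[OF V])
  have "f \<longlonglongrightarrow> 0"
  proof (rule LIMSEQ_I)
    fix e :: real assume e: "0 < e"
    have "\<forall>\<^sub>F k in sequentially. h k < e / (2 * c)"
      using h e c by (intro order_tendstoD) (auto simp: c0_plus_def)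
    then obtain K where K: "\<And>k. K \<le> k \<Longrightarrow> h k < e / (2 * c)" by (auto simp: eventually_sequentially)
    have "(\<lambda>j. \<Sum>k=1..K. A k / b k * h k / b j) \<longlonglongrightarrow> (\<Sum>k=1..K. 0)"
      by (intro tendsto_sum tendsto_divide_0[OF tendsto_const] filterlim_at_top_imp_at_infinity[OF btop])
    then have "\<forall>\<^sub>F j in sequentially. (\<Sum>k=1..K. A k / b k * h k / b j) < e / 2"
      using e by (intro order_tendstoD) auto
    moreover have "\<forall>\<^sub>F j in sequentially. max 1 K \<le> j" by (rule eventually_ge_at_top)
    ultimately have "\<forall>\<^sub>F j in sequentially. norm (f j - 0) < e"
    proof eventually_elim
      case (elim j)
      then have j: "1 \<le> j" "K \<le> j" by auto
      have "(\<lambda>k. ar_cov x j (Suc k) * h (Suc k)) sums f j"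
        using f has_sum_Suc_sums[of "\<lambda>k. ar_cov x j k * h k"] j by (simp add: is_image_def)
      then have lim: "(\<lambda>n. \<Sum>k=1..n. ar_cov x j k * h k) \<longlonglongrightarrow> f j"
        by (simp add: sums_def sum.atLeast1_atMost_eq)
      have "f j \<le> (\<Sum>k=1..K. A k / b k * h k / b j) + e / 2"
      proof (rule LIMSEQ_le_const2[OF lim], intro exI allI impI)
        fix n assume "K \<le> n"
        have "(\<Sum>k=1..n. ar_cov x j k * h k) \<le> (\<Sum>k=1..n. (if k \<le> K then A k / b k * h k / b j else 0) + ar_cov x j k * (e / (2 * c)))"
        proof (rule sum_mono)
          fix k assume "k \<in> {1..n}"
          then have k: "1 \<le> k" by simp
          have u: "0 \<le> ar_cov x j k" by (rule ar_cov_le_V(1)[OF j(1) k])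
          show "ar_cov x j k * h k \<le> (if k \<le> K then A k / b k * h k / b j else 0) + ar_cov x j k * (e / (2 * c))"
          proof (cases "k \<le> K")
            case True
            then have "ar_cov x j k * h k = A k / b k * h k / b j" using j k by (simp add: ar_cov_eq min_absorb2)
            moreover have "0 \<le> ar_cov x j k * (e / (2 * c))" using u e c by simp
            ultimately show ?thesis using True by simp
          next
            case False
            then have "h k \<le> e / (2 * c)" using K[of k] by simp
            from mult_left_mono[OF this u] show ?thesis using False by simp
          qed
        qed
        also have "\<dots> = (\<Sum>k=1..n. if k \<le> K then A k / b k * h k / b j else 0) + (\<Sum>k=1..n. ar_cov x j k) * (e / (2 * c))"
          by (simp only: sum.distrib sum_distrib_right)
        also have "(\<Sum>k=1..n. if k \<le> K then A k / b k * h k / b j else 0) = (\<Sum>k=1..K. A k / b k * h k / b j)"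
          using \<open>K \<le> n\<close> by (intro sum.mono_neutral_cong_right) auto
        also have "(\<Sum>k=1..n. ar_cov x j k) * (e / (2 * c)) \<le> c * (e / (2 * c))"
          using row[OF j(1), of n] e c by (intro mult_right_mono) auto
        also have "c * (e / (2 * c)) = e / 2" using c by simp
        finally show "(\<Sum>k=1..n. ar_cov x j k * h k) \<le> (\<Sum>k=1..K. A k / b k * h k / b j) + e / 2" by simp
      qed
      then show ?case using elim(1) fn[OF j(1)] by simp
    qed
    then show "\<exists>no. \<forall>n\<ge>no. norm (f n - 0) < e" by (simp add: eventually_sequentially)
  qed
  then show ?thesis using fn by (simp add: c0_plus_def)
qed

section \<open>Growth of \<open>A\<close> in terms of \<open>V\<close>\<close>

lemma A_ratio_V:
  assumes "1 \<le> n"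
  shows "A n = A (Suc n) * (1 - 1 / V (Suc n))"
proof -
  have "0 < V (Suc n)" using V_ge_1[of "Suc n"] by simp
  moreover have "A (Suc n) / V (Suc n) = (b (Suc n))\<^sup>2" using V_b[of "Suc n"] calculation by (simp add: field_simps)
  ultimately show ?thesis by (simp add: right_diff_distrib A_Suc)
qed

text \<open>The ratio \<open>A n / A (Suc n)\<close> is \<open>1 - 1 / V (Suc n)\<close>, so each
  step adds at least \<open>1 / V i\<close> to \<open>ln A\<close>; monotonicity of \<open>V\<close>
  replaces every term by the last.\<close>

lemma ln_A_lower: "1 \<le> j \<Longrightarrow> (real j - 1) / V j \<le> ln (A j)"
proof -
  have "ln (A 1) + (\<Sum>i=2..j. 1 / V i) \<le> ln (A j)" if "1 \<le> j" for j
    using that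
  proof (induction j rule: nat_induct_at_least)
    case (Suc n)
    have V: "0 < V (Suc n)" using V_ge_1[of "Suc n"] by simp
    have Ap: "0 < A n" "0 < A (Suc n)" using A_ge[of n] A_ge[of "Suc n"] Suc(1) by auto
    have "ln (A n / A (Suc n)) \<le> A n / A (Suc n) - 1" using Ap by (intro ln_le_minus_one) simp
    also have "\<dots> = - 1 / V (Suc n)" using A_ratio_V[OF Suc(1)] Ap by (simp add: field_simps)
    finally have "1 / V (Suc n) \<le> ln (A (Suc n)) - ln (A n)" using Ap by (simp add: ln_div)
    then show ?case using Suc by simp
  qed simp
  moreover assume j: "1 \<le> j"
  moreover have "(\<Sum>i=2..j. 1 / V j) \<le> (\<Sum>i=2..j. 1 / V i)"
  proof (rule sum_mono)
    fix i assume "i \<in> {2..j}"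
    then show "1 / V j \<le> 1 / V i" using V_mono[of i j] V_ge_1[of i] V_ge_1[of j] j by (intro divide_left_mono) auto
  qed
  moreover have "A 1 = 1" by (simp add: A_Suc A_0 b_1)
  moreover have "(\<Sum>i=2..j. 1 / V j) = (real j - 1) / V j" using j by (simp add: of_nat_diff)
  ultimately show "(real j - 1) / V j \<le> ln (A j)" by (smt (verit) ln_one)
qed

end

section \<open>Growth of the normalization\<close>

text \<open>Concavity of the power \<open>p = 1 - \<gamma>\<close>, in the form of Young's
  inequality, gives the increment bound that a comparison with an integral would give.\<close>

lemma powr_sum_le:
  fixes \<gamma> :: real
  assumes "0 < \<gamma>" "\<gamma> < 1"
  shows "(\<Sum>i=1..n. real i powr - \<gamma>) \<le> real n powr (1 - \<gamma>) / (1 - \<gamma>)"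
proof (induction n)
  case (Suc n)
  define p where "p = 1 - \<gamma>"
  have p: "0 < p" "p < 1" using assms by (auto simp: p_def)
  have "real n powr p \<le> real (Suc n) powr p - p * real (Suc n) powr - \<gamma>"
  proof (cases "n = 0")
    case True
    then show ?thesis using p by (simp add: p_def)
  next
    case False
    have "(real n / real (Suc n)) powr p * 1 powr (1 - p) \<le> p * (real n / real (Suc n)) + (1 - p) * 1"
      using p False by (intro Youngs_inequality_0) auto
    also have "\<dots> = 1 - p / real (Suc n)" by (simp add: field_simps)
    finally have "real n powr p / real (Suc n) powr p \<le> 1 - p / real (Suc n)" by (simp add: powr_divide)
    then have "real n powr p \<le> (1 - p / real (Suc n)) * real (Suc n) powr p"
      by (simp only: pos_divide_le_eq powr_gt_zero of_nat_eq_0_iff nat.distinct simp_thms)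
    also have "\<dots> = real (Suc n) powr p - p * (real (Suc n) powr p / real (Suc n))" by (simp add: left_diff_distrib)
    also have "real (Suc n) powr p / real (Suc n) = real (Suc n) powr - \<gamma>"
      by (simp add: p_def powr_diff powr_minus divide_inverse)
    finally show ?thesis .
  qed
  then have "(real n powr p + p * real (Suc n) powr - \<gamma>) / p \<le> real (Suc n) powr p / p"
    using p by (intro divide_right_mono) auto
  then have "real n powr p / p + real (Suc n) powr - \<gamma> \<le> real (Suc n) powr p / p"
    using p by (simp add: add_divide_distrib)
  then show ?case using Suc unfolding p_def by simp
qed simp

context ar_weights
begin

text \<open>The increments of \<open>ln A\<close> are at most \<open>1 / (V i - 1)\<close>, and
  \<open>V i \<ge> 2\<close> turns this into \<open>2 / V i\<close>. The lost factor
  \<open>2\<close> disappears under the second logarithm.\<close>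

lemma ln_A_upper:
  assumes N: "1 \<le> N" "2 \<le> V N" and j: "N \<le> j"
  shows "ln (A j) \<le> ln (A N) + (\<Sum>i=Suc N..j. 2 / V i)"
  using j
proof (induction j rule: dec_induct)
  case (step n)
  have n1: "1 \<le> n" using N step by simp
  have V2: "2 \<le> V (Suc n)" using V_mono[of N "Suc n"] N step by simp
  have Ap: "0 < A n" "0 < A (Suc n)" using A_ge[of n] A_ge[of "Suc n"] n1 by auto
  have r: "A (Suc n) / A n = V (Suc n) / (V (Suc n) - 1)"
  proof -
    have "A (Suc n) * (V (Suc n) - 1) = A n * V (Suc n)"
      using A_ratio_V[OF n1] V2 by (simp add: field_simps)
    then show ?thesis using V2 Ap by (simp add: field_simps)
  qed
  have "ln (A (Suc n) / A n) \<le> A (Suc n) / A n - 1" using Ap by (intro ln_le_minus_one) simp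
  also have "\<dots> = 1 / (V (Suc n) - 1)" unfolding r using V2 by (simp add: field_simps)
  also have "\<dots> \<le> 2 / V (Suc n)" using V2 by (simp add: field_simps)
  finally have "ln (A (Suc n)) \<le> ln (A n) + 2 / V (Suc n)" using Ap by (simp add: ln_div)
  then show ?case using step by simp
qed simp

text \<open>Elementary Potter bounds: regular variation at the ratio \<open>2\<close> controls
  doubling of the index, and monotonicity of \<open>V\<close> fills the gaps in an induction that
  halves the index.\<close>

lemma regularly_varying_power_bounds:
  assumes rv: "regularly_varying V \<beta>" and \<gamma>: "0 < \<gamma>" "\<gamma> < \<beta>" "\<beta> < \<gamma>'"
  obtains c C where "0 < c" "0 < C" "\<forall>\<^sub>F n in sequentially. c * real n powr \<gamma> \<le> V n \<and> V n \<le> C * real n powr \<gamma>'"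
proof -
  have two: "nat \<lfloor>2 * real n\<rfloor> = 2 * n" for n
    by (metis floor_of_nat nat_int of_nat_mult of_nat_numeral)
  have "(\<lambda>n. V (nat \<lfloor>2 * real n\<rfloor>) / V n) \<longlonglongrightarrow> 2 powr \<beta>"
    using rv by (simp add: regularly_varying_def)
  then have lim: "(\<lambda>n. V (2 * n) / V n) \<longlonglongrightarrow> 2 powr \<beta>" by (simp only: two)
  have "\<forall>\<^sub>F n in sequentially. 2 powr \<gamma> < V (2 * n) / V n" "\<forall>\<^sub>F n in sequentially. V (2 * n) / V n < 2 powr \<gamma>'"
    using \<gamma> by (auto intro!: order_tendstoD[OF lim] powr_less_mono)
  then have "\<forall>\<^sub>F n in sequentially. 2 powr \<gamma> < V (2 * n) / V n \<and> V (2 * n) / V n < 2 powr \<gamma>' \<and> 2 \<le> n"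
    using eventually_ge_at_top[of 2] by eventually_elim simp
  then obtain N where N: "\<And>n. N \<le> n \<Longrightarrow> 2 powr \<gamma> < V (2 * n) / V n \<and> V (2 * n) / V n < 2 powr \<gamma>' \<and> 2 \<le> n"
    by (auto simp: eventually_sequentially)
  have N2: "2 \<le> N" using N[of N] by simp
  have dbl: "2 powr \<gamma> * V n \<le> V (2 * n)" "V (2 * n) \<le> 2 powr \<gamma>' * V n" if "N \<le> n" for n
    using N[OF that] V_ge_1[of n] by (auto simp: less_divide_eq divide_less_eq)
  \<comment> \<open>The shifts to \<open>real n + 1\<close> here and \<open>real n - 1\<close> in
    \<open>up\<close> absorb the rounding: \<open>n + 1 \<le> 2 * (m + 1)\<close> for
    \<open>m = n div 2\<close>, and \<open>2 * (m - 1) \<le> n - 1\<close> for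
    \<open>m = (n + 1) div 2\<close>.\<close>
  have low: "(real n + 1) powr \<gamma> / (2 * real N + 1) powr \<gamma> \<le> V n" if "N \<le> n" for n
    using that
  proof (induction n rule: less_induct)
    case (less n)
    show ?case
    proof (cases "n \<le> 2 * N")
      case True
      then have "(real n + 1) powr \<gamma> / (2 * real N + 1) powr \<gamma> \<le> 1"
        using \<gamma> by (simp add: divide_le_eq powr_mono2)
      then show ?thesis using V_ge_1[of n] less N2 by linarith
    next
      case False
      define m where "m = n div 2"
      have m: "N \<le> m" "m < n" "2 * m \<le> n" "n \<le> 2 * m + 1" using False N2 by (auto simp: m_def)
      have "(real n + 1) powr \<gamma> \<le> (2 * (real m + 1)) powr \<gamma>" using m \<gamma> by (intro powr_mono2) auto
      also have "\<dots> = 2 powr \<gamma> * (real m + 1) powr \<gamma>" by (rule powr_mult)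
      finally have "(real n + 1) powr \<gamma> / (2 * real N + 1) powr \<gamma> \<le> 2 powr \<gamma> * ((real m + 1) powr \<gamma> / (2 * real N + 1) powr \<gamma>)"
        by (simp add: divide_right_mono)
      also have "\<dots> \<le> 2 powr \<gamma> * V m" using less.IH[OF m(2,1)] by (intro mult_left_mono) auto
      also have "\<dots> \<le> V (2 * m)" by (rule dbl(1)[OF m(1)])
      also have "\<dots> \<le> V n" using m N2 by (intro V_mono) auto
      finally show ?thesis .
    qed
  qed
  have up: "V n \<le> V (2 * N) * (real n - 1) powr \<gamma>'" if "N \<le> n" for n
    using that
  proof (induction n rule: less_induct)
    case (less n)
    show ?case
    proof (cases "n \<le> 2 * N")
      case True
      have "1 \<le> (real n - 1) powr \<gamma>'" using less N2 \<gamma> by (intro ge_one_powr_ge_zero) auto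
      then have "V (2 * N) * 1 \<le> V (2 * N) * (real n - 1) powr \<gamma>'" using V_ge_1[of "2 * N"] N2 by (intro mult_left_mono) auto
      moreover have "V n \<le> V (2 * N)" using True less N2 by (intro V_mono) auto
      ultimately show ?thesis by simp
    next
      case False
      define m where "m = (n + 1) div 2"
      have m: "N \<le> m" "m < n" "2 * m \<le> n + 1" "n \<le> 2 * m" using False N2 by (auto simp: m_def)
      have "V n \<le> V (2 * m)" using m N2 less by (intro V_mono) auto
      also have "\<dots> \<le> 2 powr \<gamma>' * V m" by (rule dbl(2)[OF m(1)])
      also have "\<dots> \<le> 2 powr \<gamma>' * (V (2 * N) * (real m - 1) powr \<gamma>')" using less.IH[OF m(2,1)] by (intro mult_left_mono) auto
      also have "\<dots> = V (2 * N) * (2 * (real m - 1)) powr \<gamma>'" by (simp only: powr_mult mult_ac)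
      also have "\<dots> \<le> V (2 * N) * (real n - 1) powr \<gamma>'"
        using V_ge_1[of "2 * N"] N2 m \<gamma> by (intro mult_left_mono powr_mono2) auto
      finally show ?thesis .
    qed
  qed
  show thesis
  proof (rule that)
    show "0 < 1 / (2 * real N + 1) powr \<gamma>" by simp
    show "0 < V (2 * N)" using V_ge_1[of "2 * N"] N2 by simp
    show "\<forall>\<^sub>F n in sequentially. 1 / (2 * real N + 1) powr \<gamma> * real n powr \<gamma> \<le> V n \<and> V n \<le> V (2 * N) * real n powr \<gamma>'"
      using eventually_ge_at_top[of N]
    proof eventually_elim
      case (elim n)
      have "real n powr \<gamma> / (2 * real N + 1) powr \<gamma> \<le> (real n + 1) powr \<gamma> / (2 * real N + 1) powr \<gamma>"
        using \<gamma> by (intro divide_right_mono powr_mono2) auto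
      moreover have "V (2 * N) * (real n - 1) powr \<gamma>' \<le> V (2 * N) * real n powr \<gamma>'"
        using V_ge_1[of "2 * N"] N2 \<gamma> elim by (intro mult_left_mono powr_mono2) auto
      ultimately show ?case using low[OF elim] up[OF elim] by simp
    qed
  qed
qed

text \<open>With \<open>V\<close> between powers with exponents near \<open>\<beta>\<close>,
  \<open>ln_A_lower\<close> and \<open>ln_A_upper\<close> put \<open>ln (A j)\<close> between powers
  of \<open>j\<close> with exponents near \<open>1 - \<beta>\<close>. The second logarithm reads off
  the exponent.\<close>

lemma LL_regularly_varying:
  assumes \<beta>: "0 < \<beta>" "\<beta> < 1" and rv: "regularly_varying V \<beta>" and top: "filterlim V at_top sequentially"
  shows "(\<lambda>j. LL j / ln (real j)) \<longlonglongrightarrow> 1 - \<beta>"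
proof (rule order_tendstoI)
  fix a assume a: "a < 1 - \<beta>"
  \<comment> \<open>The midpoint between \<open>\<beta>\<close> and \<open>1 - a\<close>, with the
    latter cut off at \<open>1\<close> in case \<open>a\<close> is negative.\<close>
  define \<gamma>' where "\<gamma>' = (\<beta> + min 1 (1 - a)) / 2"
  have \<gamma>': "\<beta> < \<gamma>'" "\<gamma>' < 1" "a < 1 - \<gamma>'" using a \<beta> by (auto simp: \<gamma>'_def min_def field_simps)
  obtain c C where C: "0 < C" and ev: "\<forall>\<^sub>F n in sequentially. c * real n powr (\<beta> / 2) \<le> V n \<and> V n \<le> C * real n powr \<gamma>'"
  proof -
    have "0 < \<beta> / 2" "\<beta> / 2 < \<beta>" using \<beta> by auto
    from regularly_varying_power_bounds[OF rv this \<gamma>'(1)] show thesis using that by blast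
  qed
  have "(\<lambda>j. ln ((real j - 1) / (C * real j powr \<gamma>')) / ln (real j)) \<longlonglongrightarrow> 1 - \<gamma>'"
    using C \<gamma>' by real_asymp
  then have "\<forall>\<^sub>F j in sequentially. a < ln ((real j - 1) / (C * real j powr \<gamma>')) / ln (real j)"
    using \<gamma>' by (intro order_tendstoD(1)) auto
  then show "\<forall>\<^sub>F j in sequentially. a < LL j / ln (real j)"
    using ev eventually_ge_at_top[of 2]
  proof eventually_elim
    case (elim j)
    have V: "0 < V j" using V_ge_1[of j] elim by simp
    have "(real j - 1) / (C * real j powr \<gamma>') \<le> (real j - 1) / V j"
      using elim V by (intro divide_left_mono) auto
    also have "\<dots> \<le> ln (A j)" using elim by (intro ln_A_lower) auto
    finally have le: "(real j - 1) / (C * real j powr \<gamma>') \<le> ln (A j)" .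
    have "0 < (real j - 1) / (C * real j powr \<gamma>')" using elim C by simp
    then have "ln ((real j - 1) / (C * real j powr \<gamma>')) \<le> LL j" unfolding LL_def using le by simp
    then have "ln ((real j - 1) / (C * real j powr \<gamma>')) / ln (real j) \<le> LL j / ln (real j)"
      using elim by (intro divide_right_mono) auto
    then show ?case using elim by linarith
  qed
next
  fix a assume a: "1 - \<beta> < a"
  define \<gamma> where "\<gamma> = (\<beta> + max 0 (1 - a)) / 2"
  have \<gamma>: "0 < \<gamma>" "\<gamma> < \<beta>" "1 - \<gamma> < a" "\<gamma> < 1" using a \<beta> by (auto simp: \<gamma>_def max_def field_simps)
  obtain c C where c: "0 < c" and ev: "\<forall>\<^sub>F n in sequentially. c * real n powr \<gamma> \<le> V n \<and> V n \<le> C * real n powr 1"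
    using regularly_varying_power_bounds[OF rv \<gamma>(1,2) \<beta>(2)] by blast
  have "\<forall>\<^sub>F n in sequentially. 2 \<le> V n" using top by (simp add: filterlim_at_top)
  then have "\<forall>\<^sub>F n in sequentially. 1 \<le> n \<and> 2 \<le> V n \<and> c * real n powr \<gamma> \<le> V n"
    using ev eventually_ge_at_top[of 1] by eventually_elim simp
  then obtain N where N: "\<And>n. N \<le> n \<Longrightarrow> 1 \<le> n \<and> 2 \<le> V n \<and> c * real n powr \<gamma> \<le> V n"
    by (auto simp: eventually_sequentially)
  define p where "p = 1 - \<gamma>"
  have p: "0 < p" "p < a" using \<gamma> by (auto simp: p_def)
  define K where "K = 2 / (c * p)"
  have K: "0 < K" using c p by (simp add: K_def)
  define D where "D = 1 + \<bar>ln (A N)\<bar>"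
  have D: "0 < D" by (simp add: D_def add_pos_nonneg)
  have "(\<lambda>j. ln (D + K * real j powr p) / ln (real j)) \<longlonglongrightarrow> p"
    using D K p by real_asymp
  then have "\<forall>\<^sub>F j in sequentially. ln (D + K * real j powr p) / ln (real j) < a"
    using p by (intro order_tendstoD(2)) auto
  then show "\<forall>\<^sub>F j in sequentially. LL j / ln (real j) < a"
    using eventually_ge_at_top[of "max N 3"]
  proof eventually_elim
    case (elim j)
    have j: "N \<le> j" "3 \<le> j" using elim by auto
    have "ln (A j) \<le> ln (A N) + (\<Sum>i=Suc N..j. 2 / V i)" using N[of N] j by (intro ln_A_upper) auto
    also have "(\<Sum>i=Suc N..j. 2 / V i) \<le> (\<Sum>i=Suc N..j. (2 / c) * real i powr - \<gamma>)"
    proof (rule sum_mono)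
      fix i assume "i \<in> {Suc N..j}"
      then have i: "1 \<le> i" "c * real i powr \<gamma> \<le> V i" using N[of i] by auto
      then have "2 / V i \<le> 2 / (c * real i powr \<gamma>)" using c V_ge_1[of i] by (intro divide_left_mono mult_pos_pos) auto
      then show "2 / V i \<le> (2 / c) * real i powr - \<gamma>" by (simp add: powr_minus divide_inverse mult_ac)
    qed
    also have "\<dots> \<le> (\<Sum>i=1..j. (2 / c) * real i powr - \<gamma>)"
      using c by (intro sum_mono2) auto
    also have "\<dots> = (2 / c) * (\<Sum>i=1..j. real i powr - \<gamma>)" by (simp add: sum_distrib_left)
    also have "\<dots> \<le> (2 / c) * (real j powr (1 - \<gamma>) / (1 - \<gamma>))"
      using c \<gamma> by (intro mult_left_mono powr_sum_le) auto
    also have "\<dots> = K * real j powr p" by (simp add: K_def p_def)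
    finally have le: "ln (A j) \<le> D + K * real j powr p" by (simp add: D_def)
    have "1 < A j" using A_ge[of j] j by simp
    then have "0 < ln (A j)" by simp
    then have "LL j \<le> ln (D + K * real j powr p)" unfolding LL_def using le by simp
    then have "LL j / ln (real j) \<le> ln (D + K * real j powr p) / ln (real j)"
      using j by (intro divide_right_mono) auto
    then show ?case using elim by linarith
  qed
qed

text \<open>For bounded \<open>V\<close>, \<open>ln (A j)\<close> is of order \<open>j\<close>:
  \<open>ln_A_lower\<close> gives at least linear growth, and by \<open>A_ratio\<close> the sequence
  \<open>A\<close> grows at most geometrically.\<close>

lemma LL_bounded:
  assumes V: "\<And>j. 1 \<le> j \<Longrightarrow> V j \<le> L"
  shows "(\<lambda>j. LL j / ln (real j)) \<longlonglongrightarrow> 1"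
proof -
  define C where "C = 1 + 1 / (x 1)\<^sup>2"
  have C: "1 < C" using bounds[of 1] by (simp add: C_def)
  have L: "0 < L" using V[of 1] V_ge_1[of 1] by simp
  have up: "A j \<le> C ^ j" if "1 \<le> j" for j
    using that
  proof (induction j rule: nat_induct_at_least)
    case base
    then show ?case using C by (simp add: A_Suc A_0 b_1)
  next
    case (Suc n)
    have "A (Suc n) \<le> C * A n" using A_ratio[OF Suc(1)] by (simp add: C_def)
    also have "\<dots> \<le> C * C ^ n" using Suc C by (intro mult_left_mono) auto
    finally show ?case by simp
  qed
  have 1: "(\<lambda>j. ln ((real j - 1) / L) / ln (real j)) \<longlonglongrightarrow> 1" using L by real_asymp
  have lC: "0 < ln C" using C by simp
  have 2: "(\<lambda>j. ln (real j * ln C) / ln (real j)) \<longlonglongrightarrow> 1" using lC by real_asymp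
  show ?thesis
  proof (rule tendsto_sandwich[OF _ _ 1 2])
    show "\<forall>\<^sub>F j in sequentially. ln ((real j - 1) / L) / ln (real j) \<le> LL j / ln (real j)"
      using eventually_ge_at_top[of 2]
    proof eventually_elim
      case (elim j)
      have "(real j - 1) / L \<le> (real j - 1) / V j"
        using elim V[of j] V_ge_1[of j] L by (intro divide_left_mono mult_pos_pos) auto
      also have "\<dots> \<le> ln (A j)" using elim by (intro ln_A_lower) auto
      finally have le: "(real j - 1) / L \<le> ln (A j)" .
      have "0 < (real j - 1) / L" using elim L by simp
      then have "ln ((real j - 1) / L) \<le> LL j" unfolding LL_def using le by simp
      then show ?case using elim by (intro divide_right_mono) auto
    qed
    show "\<forall>\<^sub>F j in sequentially. LL j / ln (real j) \<le> ln (real j * ln C) / ln (real j)"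
      using eventually_ge_at_top[of 2]
    proof eventually_elim
      case (elim j)
      have A1: "1 < A j" using A_ge[of j] elim by simp
      have "ln (A j) \<le> ln (C ^ j)" using up[of j] elim A1 C by (subst ln_le_cancel_iff) auto
      then have le: "ln (A j) \<le> real j * ln C" using C by (simp add: ln_realpow)
      have "0 < ln (A j)" using A1 by simp
      then have "LL j \<le> ln (real j * ln C)" unfolding LL_def using le by simp
      then show ?case using elim by (intro divide_right_mono) auto
    qed
  qed
qed

end

section \<open>Transfer of the law to the three normalizations\<close>

theorem theorem1p8:
  fixes x f :: "nat \<Rightarrow> real" and p :: "real \<Rightarrow> nat \<Rightarrow> nat \<Rightarrow> real"
  assumes "mono_on {1..} x"
    and "\<forall>j\<ge>1. 0 < x j \<and> x j \<le> 1"
    and "markov_transition p" and "symmetric_transition p"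
    and "potential_density p (ar_cov x)"
    and "excessive p f"
  shows
    "(filterlim (\<lambda>j. ar_cov x j j) at_top sequentially \<longleftrightarrow> x \<longlonglongrightarrow> 1) \<and>
     (\<forall>\<delta>. 0 < \<delta> \<and> \<delta> < 1 \<longrightarrow>
        ((\<lambda>j. ar_cov x j j) \<longlonglongrightarrow> 1 / (1 - \<delta>\<^sup>2) \<longleftrightarrow> x \<longlonglongrightarrow> \<delta>)) \<and>
     (\<forall>(\<alpha>::real) (M::'a measure) (Z :: nat \<Rightarrow> 'a \<Rightarrow> real).
        0 < \<alpha> \<and> permanental_sequence M \<alpha> (\<lambda>j k. ar_cov x j k + f k) Z \<longrightarrow>
        (filterlim (\<lambda>j. ar_cov x j j) at_top sequentially \<and>
         (\<exists>h\<in>l1_plus. is_image (ar_cov x) h f) \<longrightarrow>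
           (AE \<omega> in M. limsup (\<lambda>j. ereal (Z j \<omega> /
              (ar_cov x j j * ln (ln (ar_cov x j j * (ar_b x j)\<^sup>2))))) = 1) \<and>
           (\<forall>\<beta>. 0 < \<beta> \<and> \<beta> < 1 \<and> regularly_varying (\<lambda>j. ar_cov x j j) \<beta> \<longrightarrow>
              (AE \<omega> in M. limsup (\<lambda>j. ereal (Z j \<omega> / (ar_cov x j j * ln (real j)))) =
                 ereal (1 - \<beta>)))) \<and>
        (\<forall>\<delta>. 0 < \<delta> \<and> \<delta> < 1 \<and> (\<lambda>j. ar_cov x j j) \<longlonglongrightarrow> 1 / (1 - \<delta>\<^sup>2) \<and> f \<in> c0_plus \<longrightarrow>
           (AE \<omega> in M. limsup (\<lambda>j. ereal (Z j \<omega> / ln (real j))) =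
              ereal (1 / (1 - \<delta>\<^sup>2))))) \<and>
     (\<forall>\<delta>. 0 < \<delta> \<and> \<delta> < 1 \<and> (\<lambda>j. ar_cov x j j) \<longlonglongrightarrow> 1 / (1 - \<delta>\<^sup>2) \<longrightarrow>
        (f \<in> c0_plus \<longleftrightarrow> (\<exists>h\<in>c0_plus. is_image (ar_cov x) h f)))"
proof -
  interpret ar_weights x using assms(1,2) by unfold_locales auto
  have conc: "concave_wrt f" using assms(3,5,6) by (rule excessive_concave)
  have fn: "0 \<le> f j" if "1 \<le> j" for j using conc that by (simp add: concave_wrt_def)
  have pos: "\<forall>\<^sub>F j in sequentially. 1 \<le> j \<and> 0 < V j \<and> 0 < LL j \<and> 0 < ln (real j)"
  proof -
    have "\<forall>\<^sub>F j in sequentially. 0 < LL j" using LL_at_top unfolding filterlim_at_top_dense by blast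
    then show ?thesis using eventually_ge_at_top[of 2]
    proof eventually_elim
      case (elim j)
      then show ?case using V_ge_1[of j] by simp
    qed
  qed
  \<comment> \<open>The normalizations by \<open>ln (real j)\<close> differ from
    \<open>V j * LL j\<close> by a factor with a positive finite limit, which can be taken out of
    the upper limit in \<open>ereal\<close>.\<close>
  have limsup_scale: "limsup (\<lambda>j. ereal (z j / g j)) = ereal a"
    if z: "limsup (\<lambda>j. ereal (z j / (V j * LL j))) = 1" and a: "0 < a"
      and g: "(\<lambda>j. V j * LL j / g j) \<longlonglongrightarrow> a" for z g a
  proof -
    have "limsup (\<lambda>j. ereal (V j * LL j / g j) * ereal (z j / (V j * LL j)))
        = ereal a * limsup (\<lambda>j. ereal (z j / (V j * LL j)))"
      using g a by (intro ereal_limsup_lim_mult) auto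
    moreover have "limsup (\<lambda>j. ereal (V j * LL j / g j) * ereal (z j / (V j * LL j))) = limsup (\<lambda>j. ereal (z j / g j))"
    proof (rule Limsup_eq)
      show "\<forall>\<^sub>F j in sequentially. ereal (V j * LL j / g j) * ereal (z j / (V j * LL j)) = ereal (z j / g j)"
        using pos by eventually_elim simp
    qed
    ultimately show ?thesis using z by simp
  qed
  have lil: "AE \<omega> in M. limsup (\<lambda>j. ereal (Z j \<omega> / (V j * LL j))) = 1"
    if "0 < \<alpha>" "permanental_sequence M \<alpha> (\<lambda>j k. ar_cov x j k + f k) Z" "(\<lambda>j. f j / V j) \<longlonglongrightarrow> 0"
    for \<alpha> and M :: "'a measure" and Z
  proof -
    interpret prob_space M using that(2) by (simp add: permanental_sequence_def)
    interpret ar_permanental x M f \<alpha> Z using that conc by unfold_locales auto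
    show ?thesis using that(3) by (rule law_of_iterated_logarithm)
  qed
  have bound: "V j \<le> 1 / (1 - \<delta>\<^sup>2)" if "V \<longlonglongrightarrow> 1 / (1 - \<delta>\<^sup>2)" "1 \<le> j" for \<delta> j
    using that by (rule V_le_lim)
  show ?thesis
  proof (intro conjI allI impI)
    show "filterlim V at_top sequentially \<longleftrightarrow> x \<longlonglongrightarrow> 1" by (rule V_at_top_iff)
  next
    fix \<delta> :: real assume "0 < \<delta> \<and> \<delta> < 1"
    then show "V \<longlonglongrightarrow> 1 / (1 - \<delta>\<^sup>2) \<longleftrightarrow> x \<longlonglongrightarrow> \<delta>" by (intro V_tendsto_iff) auto
  next
    fix \<alpha> :: real and M :: "'a measure" and Z :: "nat \<Rightarrow> 'a \<Rightarrow> real"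
    assume Z: "0 < \<alpha> \<and> permanental_sequence M \<alpha> (\<lambda>j k. ar_cov x j k + f k) Z"
    assume H: "filterlim V at_top sequentially \<and> (\<exists>h\<in>l1_plus. is_image (ar_cov x) h f)"
    then have fV: "(\<lambda>j. f j / V j) \<longlonglongrightarrow> 0" using potential_div_V by blast
    have eq: "limsup (\<lambda>j. ereal (Z j \<omega> / (V j * ln (ln (V j * (b j)\<^sup>2))))) = limsup (\<lambda>j. ereal (Z j \<omega> / (V j * LL j)))" for \<omega>
    proof (rule Limsup_eq)
      show "\<forall>\<^sub>F j in sequentially. ereal (Z j \<omega> / (V j * ln (ln (V j * (b j)\<^sup>2)))) = ereal (Z j \<omega> / (V j * LL j))"
        using eventually_ge_at_top[of 1] by eventually_elim (simp add: V_b LL_def)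
    qed
    show "AE \<omega> in M. limsup (\<lambda>j. ereal (Z j \<omega> / (V j * ln (ln (V j * (b j)\<^sup>2))))) = 1"
      unfolding eq using lil Z fV by blast
    fix \<beta> :: real assume \<beta>: "0 < \<beta> \<and> \<beta> < 1 \<and> regularly_varying V \<beta>"
    have "(\<lambda>j. LL j / ln (real j)) \<longlonglongrightarrow> 1 - \<beta>" using \<beta> H by (intro LL_regularly_varying) auto
    moreover have "\<forall>\<^sub>F j in sequentially. LL j / ln (real j) = V j * LL j / (V j * ln (real j))"
      using pos by eventually_elim simp
    ultimately have lim: "(\<lambda>j. V j * LL j / (V j * ln (real j))) \<longlonglongrightarrow> 1 - \<beta>" by (rule Lim_transform_eventually)
    have "AE \<omega> in M. limsup (\<lambda>j. ereal (Z j \<omega> / (V j * LL j))) = 1" using lil Z fV by blast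
    then show "AE \<omega> in M. limsup (\<lambda>j. ereal (Z j \<omega> / (V j * ln (real j)))) = ereal (1 - \<beta>)"
    proof eventually_elim
      case (elim \<omega>)
      show ?case by (rule limsup_scale[OF elim _ lim]) (use \<beta> in simp)
    qed
  next
    fix \<alpha> :: real and M :: "'a measure" and Z :: "nat \<Rightarrow> 'a \<Rightarrow> real" and \<delta> :: real
    assume Z: "0 < \<alpha> \<and> permanental_sequence M \<alpha> (\<lambda>j k. ar_cov x j k + f k) Z"
    assume \<delta>: "0 < \<delta> \<and> \<delta> < 1 \<and> V \<longlonglongrightarrow> 1 / (1 - \<delta>\<^sup>2) \<and> f \<in> c0_plus"
    then have d: "0 < 1 / (1 - \<delta>\<^sup>2)" by (simp add: abs_square_less_1)
    have V: "V \<longlonglongrightarrow> 1 / (1 - \<delta>\<^sup>2)" using \<delta> by blast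
    \<comment> \<open>\<open>LL j\<close> is asymptotic to \<open>ln (real j)\<close>, so the
      constant in the limit is that of \<open>V\<close>.\<close>
    have "(\<lambda>j. V j * (LL j / ln (real j))) \<longlonglongrightarrow> 1 / (1 - \<delta>\<^sup>2) * 1"
      by (intro tendsto_mult V LL_bounded[where L = "1 / (1 - \<delta>\<^sup>2)"] bound[OF V])
    then have lim: "(\<lambda>j. V j * LL j / ln (real j)) \<longlonglongrightarrow> 1 / (1 - \<delta>\<^sup>2)" by simp
    have "(\<lambda>j. f j / V j) \<longlonglongrightarrow> 0" using c0_div_V \<delta> by blast
    then have "AE \<omega> in M. limsup (\<lambda>j. ereal (Z j \<omega> / (V j * LL j))) = 1" using lil Z by blast
    then show "AE \<omega> in M. limsup (\<lambda>j. ereal (Z j \<omega> / ln (real j))) = ereal (1 / (1 - \<delta>\<^sup>2))"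
    proof eventually_elim
      case (elim \<omega>)
      show ?case by (rule limsup_scale[OF elim d lim])
    qed
  next
    fix \<delta> :: real
    assume \<delta>: "0 < \<delta> \<and> \<delta> < 1 \<and> V \<longlonglongrightarrow> 1 / (1 - \<delta>\<^sup>2)"
    then have "x \<longlonglongrightarrow> \<delta>" using V_tendsto_iff by blast
    then show "f \<in> c0_plus \<longleftrightarrow> (\<exists>h\<in>c0_plus. is_image (ar_cov x) h f)"
      using c0_image[OF conc] image_c0[of \<delta> "1 / (1 - \<delta>\<^sup>2)" f] fn \<delta> by blast
  qed
qed

end
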